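(* Let $M$ be the one-cusped hyperbolic 3-manifold m137 (defined by an explicit ideal triangulation in the context), with $$\pi_1(M)=\left\langle a,b\ \middle|\ a^3b^2a^{-1}b^{-3}a^{-1}b^2\right\rangle ,$$ and let $\alpha=a^{-1}b^{-1}$ and $\beta=a^{-1}b^2a^4b^2$, a basis of $\pi_1(\partial M)$. Then the $\mathrm{SL}(2,\mathbb C)$ character variety $X(M)$ has an ideal point $x$ at which some peripheral element has a trace function with a pole, whose associated slope is $\{\alpha,\alpha^{-1}\}$, and whose associated root of unity is a sixth root of unity not equal to $\pm1$.
   Context: The manifold $M$ (m137 in the Callahan–Hildebrand–Weeks census) is regarded as a compact 3-manifold with torus boundary. It is the complement of a knot in $S^2\times S^1$, and $\alpha$ is a meridian of that knot. Its interior is obtained by gluing four ideal tetrahedra numbered $0,1,2,3$, each with vertices numbered $0,1,2,3$ and faces indexed by the opposite vertex. In the table below, the entry $k:\sigma$ in row $i$ and column $j$ ($i,j=0,\dots,3$), where $\sigma$ is a permutation of $\{0,1,2,3\}$ written as $(\sigma(0)\sigma(1)\sigma(2)\sigma(3))$, means that face $j$ of tetrahedron $i$ is glued to face $\sigma(j)$ of tetrahedron $k$ so that for $m\ne j$ vertex $m$ of tetrahedron $i$ is glued to vertex $\sigma(m)$ of tetrahedron $k$: Row 0: $1:(0132)$, $1:(3201)$, $2:(0132)$, $3:(0132)$. Row 1: $0:(0132)$, $2:(1230)$, $0:(2310)$, $3:(3201)$. Row 2: $3:(3120)$, $3:(3012)$, $1:(3012)$, $0:(0132)$. Row 3: $2:(1230)$,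 $1:(2310)$, $0:(0132)$, $2:(3120)$. $X(M)$ denotes the $\mathrm{SL}(2,\mathbb C)$ character variety of $M$ (the set of characters of representations $\pi_1(M)\to\mathrm{SL}(2,\mathbb C)$), a complex affine algebraic set. For $\gamma\in\pi_1(M)$, $\mathrm{tr}_\gamma$ is the regular function on $X(M)$ whose value at the character of $\rho$ is $\mathrm{tr}(\rho(\gamma))$. Ideal points: if $X_0\subset X(M)$ is an irreducible curve, let $f:\widetilde X_0\to X_0$ be a birational map with $\widetilde X_0$ a smooth projective curve; the ideal points of $X_0$ are the points of $\widetilde X_0\setminus f^{-1}(X_0)$, i.e. the points of $\widetilde X_0$ at which some $\mathrm{tr}_\gamma$, viewed as a meromorphic function on $\widetilde X_0$, has a pole. An ideal point of $X(M)$ means an ideal point of some irreducible curve in $X(M)$. Slopes and roots of unity: a slope is a pair $\{\delta,\delta^{-1}\}$ of mutually inverse primitive elements of $\pi_1(\partial M)\cong\mathbb Z^2$. If $x$ is an ideal point at which the trace function of some peripheral element (element of $\pi_1(\partial M)$) has a pole, there is exactly one slope $\{\delta,\delta^{-1}\}$ with $\mathrm{tr}_\delta(x)$ finite; it is called the slope associated to $x$ (it is the boundary slope of every incompressible surface associated to $x$). By a theorem of Cooper, Culler, Gillet, Long and Shalen, $\mathrm{tr}_\delta(x)=\lambda+\lambda^{-1}$ for a root of unity $\lambda$, well defined up to inversion, called the root of unity associated to $x$. *)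

theory Defs
  imports "HOL-Analysis.Analysis" "HOL-Algebra.Group" "HOL-Homology.Simplices"
begin

section \<open>Manifolds glued from truncated tetrahedra\<close>

text \<open>
  A gluing table lists, for tetrahedron \<open>i\<close> and face \<open>j\<close>, the pair \<open>(k, \<sigma>)\<close> with
  \<open>\<sigma>\<close> written as \<open>[\<sigma> 0, \<sigma> 1, \<sigma> 2, \<sigma> 3]\<close>.  Points of a tetrahedron are given by barycentric
  coordinates (functions on \<open>nat\<close> vanishing above 3).  Cutting off the corners where some
  coordinate exceeds 3/4 turns the ideal tetrahedra into truncated ones, so that the quotient
  is the compact manifold whose interior is the ideally triangulated one; the triangles where
  some coordinate equals 3/4 form its boundary.
\<close>

type_synonym gluing_table = "(nat \<times> nat list) list list"
type_synonym glued_point = "(nat \<times> (nat \<Rightarrow> real)) set"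

definition truncated_simplex :: "(nat \<Rightarrow> real) set" where
  "truncated_simplex = {p \<in> standard_simplex 3. \<forall>j\<le>3. p j \<le> 3/4}"

definition tetrahedra :: "gluing_table \<Rightarrow> (nat \<times> (nat \<Rightarrow> real)) set" where
  "tetrahedra T = {..<length T} \<times> truncated_simplex"

text \<open>
  On face \<open>j\<close>, where \<open>p j = 0\<close>, the affine extension of the vertex map \<open>m \<mapsto> \<sigma> m\<close> (\<open>m \<noteq> j\<close>)
  is \<open>q (\<sigma> m) = p m\<close>, and \<open>q (\<sigma> j) = 0 = p j\<close>.
\<close>

definition face_pairing :: "gluing_table \<Rightarrow> ((nat \<times> (nat \<Rightarrow> real)) \<times> (nat \<times> (nat \<Rightarrow> real))) set" where
  "face_pairing T = {((i, p), (k, q)). (i, p) \<in> tetrahedra T \<and> (k, q) \<in> tetrahedra T \<and>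
     (\<exists>j\<le>3. \<exists>\<sigma>. T ! i ! j = (k, \<sigma>) \<and> p j = 0 \<and> (\<forall>m\<le>3. q (\<sigma> ! m) = p m))}"

definition gluing_relation :: "gluing_table \<Rightarrow> ((nat \<times> (nat \<Rightarrow> real)) \<times> (nat \<times> (nat \<Rightarrow> real))) set" where
  "gluing_relation T =
     (face_pairing T \<union> (face_pairing T)\<inverse>)\<^sup>* \<inter> tetrahedra T \<times> tetrahedra T"

definition quotient_topology :: "'a topology \<Rightarrow> ('a \<times> 'a) set \<Rightarrow> 'a set topology" where
  "quotient_topology X r =
     topology (\<lambda>U. U \<subseteq> topspace X // r \<and> openin X {x \<in> topspace X. r `` {x} \<in> U})"

definition glued_manifold :: "gluing_table \<Rightarrow> glued_point topology" where
  "glued_manifold T = quotient_topology (top_of_set (tetrahedra T)) (gluing_relation T)"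

definition glued_boundary :: "gluing_table \<Rightarrow> glued_point set" where
  "glued_boundary T = {gluing_relation T `` {(i, p)} | i p. (i, p) \<in> tetrahedra T \<and> (\<exists>j\<le>3. p j = 3/4)}"

definition m137 :: gluing_table where
  "m137 =
    [[(1, [0,1,3,2]), (1, [3,2,0,1]), (2, [0,1,3,2]), (3, [0,1,3,2])],
     [(0, [0,1,3,2]), (2, [1,2,3,0]), (0, [2,3,1,0]), (3, [3,2,0,1])],
     [(3, [3,1,2,0]), (3, [3,0,1,2]), (1, [3,0,1,2]), (0, [0,1,3,2])],
     [(2, [1,2,3,0]), (1, [2,3,1,0]), (0, [0,1,3,2]), (2, [3,1,2,0])]]"


section \<open>Fundamental group and peripheral subgroup\<close>

definition loops :: "'a topology \<Rightarrow> 'a \<Rightarrow> (real \<Rightarrow> 'a) set" where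
  "loops X x = {p. pathin X p \<and> p 0 = x \<and> p 1 = x}"

definition loop_class :: "'a topology \<Rightarrow> 'a \<Rightarrow> (real \<Rightarrow> 'a) \<Rightarrow> (real \<Rightarrow> 'a) set" where
  "loop_class X x p =
     {q \<in> loops X x. homotopic_with (\<lambda>h. h 0 = x \<and> h 1 = x) (top_of_set {0..1}) X p q}"

definition loop_join :: "(real \<Rightarrow> 'a) \<Rightarrow> (real \<Rightarrow> 'a) \<Rightarrow> real \<Rightarrow> 'a" where
  "loop_join p q = (\<lambda>t. if t \<le> 1/2 then p (2 * t) else q (2 * t - 1))"

definition fundamental_group :: "'a topology \<Rightarrow> 'a \<Rightarrow> (real \<Rightarrow> 'a) set monoid" where
  "fundamental_group X x =
     \<lparr>carrier = loop_class X x ` loops X x,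
      mult = (\<lambda>A B. \<Union>p\<in>A. \<Union>q\<in>B. loop_class X x (loop_join p q)),
      one = loop_class X x (\<lambda>_. x)\<rparr>"

text \<open>The image of the fundamental group of the subspace \<open>B\<close> under the inclusion.\<close>

definition subspace_subgroup :: "'a topology \<Rightarrow> 'a set \<Rightarrow> 'a \<Rightarrow> (real \<Rightarrow> 'a) set set" where
  "subspace_subgroup X B x = loop_class X x ` loops (subtopology X B) x"

abbreviation m137_group :: "glued_point \<Rightarrow> (real \<Rightarrow> glued_point) set monoid" where
  "m137_group x \<equiv> fundamental_group (glued_manifold m137) x"

abbreviation m137_peripheral :: "glued_point \<Rightarrow> (real \<Rightarrow> glued_point) set set" where
  "m137_peripheral x \<equiv> subspace_subgroup (glued_manifold m137) (glued_boundary m137) x"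


section \<open>Group presentations and bases\<close>

text \<open>Words in generators indexed by \<open>'i\<close>: the syllable \<open>(i, k)\<close> stands for the \<open>k\<close>-th power of \<open>i\<close>.\<close>

type_synonym 'i word = "('i \<times> int) list"

definition word_value :: "('g, 'm) monoid_scheme \<Rightarrow> ('i \<Rightarrow> 'g) \<Rightarrow> 'i word \<Rightarrow> 'g" where
  "word_value G g w = foldr (\<lambda>(i, k) h. g i [^]\<^bsub>G\<^esub> k \<otimes>\<^bsub>G\<^esub> h) w \<one>\<^bsub>G\<^esub>"

text \<open>
  Equality of words in the group presented by the relators \<open>R\<close>: the congruence generated by
  the free-group identities and \<open>r = 1\<close> for \<open>r \<in> R\<close>.
\<close>

inductive presented_eq :: "'i word set \<Rightarrow> 'i word \<Rightarrow> 'i word \<Rightarrow> bool" for R where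
  refl: "presented_eq R u u"
| sym: "presented_eq R u v \<Longrightarrow> presented_eq R v u"
| trans: "presented_eq R u v \<Longrightarrow> presented_eq R v w \<Longrightarrow> presented_eq R u w"
| cong: "presented_eq R u v \<Longrightarrow> presented_eq R (s @ u @ t) (s @ v @ t)"
| zero: "presented_eq R [(i, 0)] []"
| add: "presented_eq R [(i, k), (i, l)] [(i, k + l)]"
| relator: "r \<in> R \<Longrightarrow> presented_eq R r []"

definition presented_by :: "('g, 'm) monoid_scheme \<Rightarrow> ('i \<Rightarrow> 'g) \<Rightarrow> 'i word set \<Rightarrow> bool" where
  "presented_by G g R \<longleftrightarrow>
     range g \<subseteq> carrier G \<and>
     range (word_value G g) = carrier G \<and>
     (\<forall>u v. word_value G g u = word_value G g v \<longleftrightarrow> presented_eq R u v)"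

definition free_abelian_basis :: "('g, 'm) monoid_scheme \<Rightarrow> 'g set \<Rightarrow> 'g \<Rightarrow> 'g \<Rightarrow> bool" where
  "free_abelian_basis G P u v \<longleftrightarrow>
     u \<otimes>\<^bsub>G\<^esub> v = v \<otimes>\<^bsub>G\<^esub> u \<and>
     bij_betw (\<lambda>(m :: int, n :: int). u [^]\<^bsub>G\<^esub> m \<otimes>\<^bsub>G\<^esub> v [^]\<^bsub>G\<^esub> n) UNIV P"

datatype gen = Gen_a | Gen_b

definition m137_relator :: "gen word" where
  "m137_relator = [(Gen_a, 3), (Gen_b, 2), (Gen_a, -1), (Gen_b, -3), (Gen_a, -1), (Gen_b, 2)]"

definition alpha_word :: "gen word" where
  "alpha_word = [(Gen_a, -1), (Gen_b, -1)]"

definition beta_word :: "gen word" where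
  "beta_word = [(Gen_a, -1), (Gen_b, 2), (Gen_a, 4), (Gen_b, 2)]"


section \<open>Irreducible curves\<close>

text \<open>Irreducibility and Krull dimension one with respect to a family \<open>Z\<close> of closed sets.\<close>

definition irreducible_closed :: "'a set set \<Rightarrow> 'a set \<Rightarrow> bool" where
  "irreducible_closed Z Y \<longleftrightarrow>
     Y \<in> Z \<and> Y \<noteq> {} \<and> (\<forall>A\<in>Z. \<forall>B\<in>Z. Y \<subseteq> A \<union> B \<longrightarrow> Y \<subseteq> A \<or> Y \<subseteq> B)"

definition irreducible_curve :: "'a set set \<Rightarrow> 'a set \<Rightarrow> bool" where
  "irreducible_curve Z Y \<longleftrightarrow>
     irreducible_closed Z Y \<and>
     (\<exists>A. irreducible_closed Z A \<and> A \<subset> Y) \<and>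
     \<not> (\<exists>A B. irreducible_closed Z A \<and> irreducible_closed Z B \<and> A \<subset> B \<and> B \<subset> Y)"


section \<open>The character variety\<close>

definition SL2C :: "(complex^2^2) monoid" where
  "SL2C = \<lparr>carrier = {A. det A = 1}, mult = (**), one = mat 1\<rparr>"

definition character_variety :: "('g, 'm) monoid_scheme \<Rightarrow> ('g \<Rightarrow> complex) set" where
  "character_variety G = {\<lambda>\<gamma>\<in>carrier G. trace (\<rho> \<gamma>) | \<rho>. \<rho> \<in> hom G SL2C}"

text \<open>
  The affine coordinates on the character variety of a finitely generated group are finitely
  many trace functions \<open>\<xi> \<mapsto> \<xi> \<gamma>\<close> generating the ring of all of them, so the regular functions
  are the complex algebra generated by the trace functions.
\<close>

inductive_set regular_functions :: "('g, 'm) monoid_scheme \<Rightarrow> (('g \<Rightarrow> complex) \<Rightarrow> complex) set"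
  for G :: "('g, 'm) monoid_scheme" where
  const: "(\<lambda>_. c) \<in> regular_functions G"
| trace_function: "\<gamma> \<in> carrier G \<Longrightarrow> (\<lambda>\<xi>. \<xi> \<gamma>) \<in> regular_functions G"
| add: "\<phi> \<in> regular_functions G \<Longrightarrow> \<psi> \<in> regular_functions G \<Longrightarrow> (\<lambda>\<xi>. \<phi> \<xi> + \<psi> \<xi>) \<in> regular_functions G"
| mult: "\<phi> \<in> regular_functions G \<Longrightarrow> \<psi> \<in> regular_functions G \<Longrightarrow> (\<lambda>\<xi>. \<phi> \<xi> * \<psi> \<xi>) \<in> regular_functions G"

definition character_closed_sets :: "('g, 'm) monoid_scheme \<Rightarrow> ('g \<Rightarrow> complex) set set" where
  "character_closed_sets G =
     {{\<xi> \<in> character_variety G. \<forall>\<phi>\<in>S. \<phi> \<xi> = 0} | S. S \<subseteq> regular_functions G}"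


section \<open>Smooth projective curves\<close>

text \<open>
  Points of \<open>n\<close>-dimensional complex projective space are represented by all their homogeneous
  coordinate vectors, indexed by \<open>{..n}\<close>; subsets of projective space become cones
  without the origin.
\<close>

type_synonym hvec = "nat \<Rightarrow> complex"

definition homogeneous_coords :: "nat \<Rightarrow> hvec set" where
  "homogeneous_coords n = {v. (\<forall>i>n. v i = 0) \<and> (\<exists>i. v i \<noteq> 0)}"

text \<open>\<open>hpoly n d\<close>: homogeneous polynomials of degree \<open>d\<close> in \<open>n + 1\<close> variables, as functions.\<close>

inductive_set hpoly_graded :: "nat \<Rightarrow> (nat \<times> (hvec \<Rightarrow> complex)) set" for n :: nat where
  const: "(0, \<lambda>_. c) \<in> hpoly_graded n"
| coord: "i \<le> n \<Longrightarrow> (1, \<lambda>v. v i) \<in> hpoly_graded n"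
| add: "(d, F) \<in> hpoly_graded n \<Longrightarrow> (d, H) \<in> hpoly_graded n \<Longrightarrow> (d, \<lambda>v. F v + H v) \<in> hpoly_graded n"
| mult: "(d, F) \<in> hpoly_graded n \<Longrightarrow> (e, H) \<in> hpoly_graded n \<Longrightarrow> (d + e, \<lambda>v. F v * H v) \<in> hpoly_graded n"

definition hpoly :: "nat \<Rightarrow> nat \<Rightarrow> (hvec \<Rightarrow> complex) set" where
  "hpoly n d = {F. (d, F) \<in> hpoly_graded n}"

definition projective_closed_sets :: "nat \<Rightarrow> hvec set set" where
  "projective_closed_sets n =
     {{v \<in> homogeneous_coords n. \<forall>F\<in>S. F v = 0} | S. S \<subseteq> (\<Union>d. hpoly n d)}"

text \<open>
  The Zariski tangent space at \<open>x\<close> of the affine cone over \<open>C\<close>.  It contains the line through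
  \<open>x\<close>, and its quotient by that line is the tangent space of \<open>C\<close> at the point given by \<open>x\<close>;
  so smoothness of a curve means that the cone's tangent space has dimension at most 2.
\<close>

definition cone_tangent_space :: "nat \<Rightarrow> hvec set \<Rightarrow> hvec \<Rightarrow> hvec set" where
  "cone_tangent_space n C x =
     {w. (\<forall>i>n. w i = 0) \<and>
         (\<forall>d. \<forall>F\<in>hpoly n d. (\<forall>v\<in>C. F v = 0) \<longrightarrow> deriv (\<lambda>t. F (\<lambda>i. x i + t * w i)) 0 = 0)}"

definition smooth_projective_curve :: "nat \<Rightarrow> hvec set \<Rightarrow> bool" where
  "smooth_projective_curve n C \<longleftrightarrow>
     irreducible_curve (projective_closed_sets n) C \<and>
     (\<forall>x\<in>C. \<exists>u. \<forall>w\<in>cone_tangent_space n C x. \<exists>s t. w = (\<lambda>i. s * x i + t * u i))"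

text \<open>
  Let \<open>g\<close> be a function on a nonempty open subset \<open>U\<close> of a smooth projective curve that is
  a quotient of homogeneous polynomials of equal degree, i.e. a rational (= meromorphic)
  function on the curve.  It is finite at \<open>x\<close> with value \<open>z\<close> if it is a quotient \<open>F / H\<close> with
  \<open>H x \<noteq> 0\<close> and \<open>F x / H x = z\<close>; it has a pole at \<open>x\<close> if \<open>1 / g\<close> is finite at \<open>x\<close> with value 0.
\<close>

definition finite_value_at :: "nat \<Rightarrow> hvec set \<Rightarrow> (hvec \<Rightarrow> complex) \<Rightarrow> hvec \<Rightarrow> complex \<Rightarrow> bool" where
  "finite_value_at n U g x z \<longleftrightarrow>
     (\<exists>d. \<exists>F\<in>hpoly n d. \<exists>H\<in>hpoly n d.
        (\<forall>v\<in>U. F v = g v * H v) \<and> H x \<noteq> 0 \<and> F x = z * H x)"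

definition pole_at :: "nat \<Rightarrow> hvec set \<Rightarrow> (hvec \<Rightarrow> complex) \<Rightarrow> hvec \<Rightarrow> bool" where
  "pole_at n U g x \<longleftrightarrow>
     (\<exists>d. \<exists>F\<in>hpoly n d. \<exists>H\<in>hpoly n d.
        (\<forall>v\<in>U. F v = g v * H v) \<and> F x \<noteq> 0 \<and> H x = 0)"


section \<open>Smooth projective models and ideal points\<close>

text \<open>
  A smooth projective curve together with a rational map from it to a curve of
  characters; \<open>rmap\<close> is only meaningful on the open set \<open>rdom\<close>.
\<close>

record 'g curve_model =
  adim :: nat
  curve :: "hvec set"
  rdom :: "hvec set"
  rmap :: "hvec \<Rightarrow> 'g \<Rightarrow> complex"

text \<open>
  The rational map is birational onto \<open>X0\<close>: it restricts to an isomorphism between the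
  nonempty open sets \<open>rdom\<close> and \<open>V\<close>, the inverse being given in homogeneous coordinates by
  regular functions \<open>h i\<close>.  (Homogeneous coordinates of a rational map on an affine curve can
  always be cleared of denominators.)
\<close>

definition smooth_projective_model ::
  "('g, 'm) monoid_scheme \<Rightarrow> ('g \<Rightarrow> complex) set \<Rightarrow> 'g curve_model \<Rightarrow> bool" where
  "smooth_projective_model G X0 M \<longleftrightarrow>
     smooth_projective_curve (adim M) (curve M) \<and>
     rdom M \<noteq> {} \<and> (\<exists>Z\<in>projective_closed_sets (adim M). rdom M = curve M - Z) \<and>
     (\<forall>\<gamma>\<in>carrier G. \<forall>v\<in>rdom M. \<exists>z. finite_value_at (adim M) (rdom M) (\<lambda>u. rmap M u \<gamma>) v z) \<and>
     (\<exists>V h. V \<noteq> {} \<and> (\<exists>Z\<in>character_closed_sets G. V = X0 - Z) \<and>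
        (\<forall>i. h i \<in> regular_functions G) \<and>
        (\<forall>v\<in>rdom M. rmap M v \<in> V \<and> (\<exists>c. c \<noteq> 0 \<and> (\<lambda>i. h i (rmap M v)) = (\<lambda>i. c * v i))) \<and>
        (\<forall>\<xi>\<in>V. (\<lambda>i. h i \<xi>) \<in> rdom M \<and> rmap M (\<lambda>i. h i \<xi>) = \<xi>))"

definition trace_value :: "'g curve_model \<Rightarrow> hvec \<Rightarrow> 'g \<Rightarrow> complex \<Rightarrow> bool" where
  "trace_value M x \<gamma> z \<longleftrightarrow> finite_value_at (adim M) (rdom M) (\<lambda>v. rmap M v \<gamma>) x z"

definition trace_pole :: "'g curve_model \<Rightarrow> hvec \<Rightarrow> 'g \<Rightarrow> bool" where
  "trace_pole M x \<gamma> \<longleftrightarrow> pole_at (adim M) (rdom M) (\<lambda>v. rmap M v \<gamma>) x"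

definition ideal_point ::
  "('g, 'm) monoid_scheme \<Rightarrow> ('g \<Rightarrow> complex) set \<Rightarrow> 'g curve_model \<Rightarrow> hvec \<Rightarrow> bool" where
  "ideal_point G X0 M x \<longleftrightarrow>
     irreducible_curve (character_closed_sets G) X0 \<and>
     smooth_projective_model G X0 M \<and>
     x \<in> curve M \<and> (\<exists>\<gamma>\<in>carrier G. trace_pole M x \<gamma>)"


section \<open>Slopes and roots of unity\<close>

definition primitive_element :: "('g, 'm) monoid_scheme \<Rightarrow> 'g set \<Rightarrow> 'g \<Rightarrow> bool" where
  "primitive_element G P \<delta> \<longleftrightarrow>
     \<delta> \<in> P \<and> (\<forall>\<eta>\<in>P. \<forall>k :: int. \<delta> = \<eta> [^]\<^bsub>G\<^esub> k \<longrightarrow> \<bar>k\<bar> = 1)"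

definition slopes :: "('g, 'm) monoid_scheme \<Rightarrow> 'g set \<Rightarrow> 'g set set" where
  "slopes G P = {{\<delta>, inv\<^bsub>G\<^esub> \<delta>} | \<delta>. primitive_element G P \<delta>}"

text \<open>\<open>s\<close> is the one and only slope whose trace function is finite at \<open>x\<close>.\<close>

definition associated_slope ::
  "('g, 'm) monoid_scheme \<Rightarrow> 'g set \<Rightarrow> 'g curve_model \<Rightarrow> hvec \<Rightarrow> 'g set \<Rightarrow> bool" where
  "associated_slope G P M x s \<longleftrightarrow>
     {s' \<in> slopes G P. \<forall>\<delta>\<in>s'. \<exists>z. trace_value M x \<delta> z} = {s}"

definition associated_root_of_unity ::
  "('g, 'm) monoid_scheme \<Rightarrow> 'g set \<Rightarrow> 'g curve_model \<Rightarrow> hvec \<Rightarrow> complex \<Rightarrow> bool" where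
  "associated_root_of_unity G P M x \<omega> \<longleftrightarrow>
     (\<exists>k::nat. k > 0 \<and> \<omega> ^ k = 1) \<and>
     (\<exists>s. associated_slope G P M x s \<and> (\<forall>\<delta>\<in>s. trace_value M x \<delta> (\<omega> + inverse \<omega>)))"

end

theory Submission
  imports Defs "HOL-Computational_Algebra.Polynomial_Factorial"
    "HOL-Computational_Algebra.Fundamental_Theorem_Algebra"
    "HOL-Computational_Algebra.Field_as_Ring"
begin

text \<open>
  Write \<open>x = tr a\<close>, \<open>y = tr b\<close>, \<open>z = tr ab\<close>.  The relator is equivalent to \<open>b\<^sup>2a\<^sup>3b\<^sup>2 = ab\<^sup>3a\<close>, an equation
  between palindromes, and comparing coefficients of \<open>1\<close>, \<open>a\<close>, \<open>b\<close> cuts out a curve of characters.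
  Eliminating \<open>z\<close> gives the plane quartic \<open>y\<^sup>4 - x\<^sup>3y - 3y\<^sup>2 + 2xy + 1 = 0\<close> with
  \<open>z = (x\<^sup>2 + xy - 1) / (y\<^sup>2 - 1)\<close>.  The quartic is irreducible and smooth in the projective plane, so
  it is the smooth projective model.  At its point \<open>x = \<infinity>\<close>, \<open>y / x = \<omega>\<close> with \<open>\<omega>\<close> a primitive cube root of
  unity, \<open>tr \<alpha> = z\<close> has the value \<open>-1 = \<omega> + 1 / \<omega>\<close>, while \<open>tr \<beta> = x\<^sup>3 - x\<^sup>2y - 3x + yz\<^sup>2\<close> has a pole.
  Since \<open>\<alpha>\<close> and \<open>\<beta>\<close> commute and the eigenvalues of \<open>\<alpha>\<close> stay bounded near that point, every
  \<open>tr \<alpha>\<^sup>m\<beta>\<^sup>n\<close> with \<open>n \<noteq> 0\<close> is unbounded there.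

  Irreducibility and the dimension both come down to the fact that a polynomial which is not
  identically zero on the quartic has only finitely many zeros on it.
\<close>

section \<open>The fundamental group\<close>

text \<open>\<open>presented_by\<close> does not assert the group axioms, so they are first proved
  for homotopy classes of loops. Finite values and poles are defined through quotients of forms, not
  through valuations, and infinitely many slopes must be excluded at once. Values and poles are
  therefore exhibited by explicit quotients, but non-finiteness is proved by limits: if the trace of
  \<alpha>^m \<beta>^n with n nonzero were finite, it would be bounded along points of the curve
  tending to the ideal point, and a growth estimate with constants depending only on m would bound
  tr \<beta> along them as well. The choice of the point: the quartic meets the line at infinity
  where y^4 = x^3 y, so y/x is 0, 1 or a primitive cube root of unity. With z bounded, tr \<beta>
  behaves like x^3 (1 - y/x), whose leading term survives at the primitive cube roots and cancels at
  y/x = 1. The trace of \<alpha> is z because \<alpha> is the inverse of ba. A cube root of unity is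
  in particular a sixth root of unity.\<close>

abbreviation loop_homotopic :: "'a topology \<Rightarrow> 'a \<Rightarrow> (real \<Rightarrow> 'a) \<Rightarrow> (real \<Rightarrow> 'a) \<Rightarrow> bool" where
  "loop_homotopic X x \<equiv> homotopic_with (\<lambda>h. h 0 = x \<and> h 1 = x) (top_of_set {0..1}) X"

lemma loop_homotopic_refl_iff: "loop_homotopic X x p p \<longleftrightarrow> p \<in> loops X x"
  by (auto simp: loops_def pathin_def)

lemma loop_homotopic_imp_loops:
  assumes "loop_homotopic X x p q"
  shows "p \<in> loops X x" "q \<in> loops X x"
  using homotopic_with_imp_continuous_maps[OF assms] homotopic_with_imp_property[OF assms]
  by (auto simp: loops_def pathin_def)

lemma loop_class_eq_homotopic: "loop_class X x p = {q. loop_homotopic X x p q}"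
  by (auto simp: loop_class_def dest: loop_homotopic_imp_loops(2))

lemma loop_class_eqI: "loop_homotopic X x p q \<Longrightarrow> loop_class X x p = loop_class X x q"
  unfolding loop_class_eq_homotopic
  by (auto intro: homotopic_with_trans homotopic_with_symD)

lemma continuous_map_square_iff:
  "continuous_map (prod_topology (top_of_set {0..1::real}) (top_of_set {0..1::real})) X h
     \<longleftrightarrow> continuous_map (top_of_set ({0..1} \<times> {0..1})) X h"
  by (simp add: prod_topology_subtopology subtopology_Times [symmetric]
      subtopology_subtopology Times_Int_Times)

lemma loop_homotopic_join:
  assumes "loop_homotopic X x p p'" "loop_homotopic X x q q'"
  shows "loop_homotopic X x (loop_join p q) (loop_join p' q')"
proof -
  let ?S = "{0..1::real} \<times> {0..1::real}"
  obtain h where h: "continuous_map (top_of_set ?S) X h"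
      "\<And>s. h (0, s) = p s" "\<And>s. h (1, s) = p' s"
      "\<And>t. t \<in> {0..1} \<Longrightarrow> h (t, 0) = x \<and> h (t, 1) = x"
    using assms(1) unfolding homotopic_with_def continuous_map_square_iff by auto
  obtain k where k: "continuous_map (top_of_set ?S) X k"
      "\<And>s. k (0, s) = q s" "\<And>s. k (1, s) = q' s"
      "\<And>t. t \<in> {0..1} \<Longrightarrow> k (t, 0) = x \<and> k (t, 1) = x"
    using assms(2) unfolding homotopic_with_def continuous_map_square_iff by auto
  define H where "H = (\<lambda>u. if snd u \<le> 1/2 then (h \<circ> (\<lambda>v. (fst v, 2 * snd v))) u
                            else (k \<circ> (\<lambda>v. (fst v, 2 * snd v - 1))) u)"
  have 1: "continuous_map (top_of_set ?S) euclideanreal snd"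
    by (simp add: continuous_on_snd continuous_on_id)
  have cH: "continuous_map (top_of_set ?S) X H"
    unfolding H_def
  proof (rule continuous_map_cases_le[OF 1])
    show "continuous_map (subtopology (top_of_set ?S) {v \<in> topspace (top_of_set ?S). snd v \<le> 1/2}) X
        (h \<circ> (\<lambda>v. (fst v, 2 * snd v)))"
      by (rule continuous_map_compose[OF _ h(1)])
         (auto simp: subtopology_subtopology continuous_map_in_subtopology intro!: continuous_intros)
    show "continuous_map (subtopology (top_of_set ?S) {v \<in> topspace (top_of_set ?S). 1/2 \<le> snd v}) X
        (k \<circ> (\<lambda>v. (fst v, 2 * snd v - 1)))"
      by (rule continuous_map_compose[OF _ k(1)])
         (auto simp: subtopology_subtopology continuous_map_in_subtopology intro!: continuous_intros)
  next
    fix v assume v: "v \<in> topspace (top_of_set ?S)" "snd v = 1/2"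
    then have "fst v \<in> {0..1}" "2 * snd v = 1" "2 * snd v - 1 = 0"
      by auto
    then show "(h \<circ> (\<lambda>v. (fst v, 2 * snd v))) v = (k \<circ> (\<lambda>v. (fst v, 2 * snd v - 1))) v"
      unfolding comp_def using h(4) k(4) by metis
  qed simp
  show ?thesis
    unfolding homotopic_with_def continuous_map_square_iff
  proof (intro exI conjI)
    show "continuous_map (top_of_set ?S) X H" by (rule cH)
  qed (use h k in \<open>auto simp: H_def loop_join_def\<close>)
qed

text \<open>The unit interval is convex, so the straight-line homotopy from \<phi> to \<psi> stays
  inside it and can be composed with p. Associativity, unit and inverse of the fundamental group are
  all instances, with different choices of \<phi> and \<psi>.\<close>

lemma loop_homotopic_reparametrize:
  fixes \<phi> \<psi> :: "real \<Rightarrow> real"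
  assumes p: "pathin X p"
    and \<phi>: "continuous_on {0..1} \<phi>" "\<And>s. s \<in> {0..1} \<Longrightarrow> \<phi> s \<in> {0..1}"
    and \<psi>: "continuous_on {0..1} \<psi>" "\<And>s. s \<in> {0..1} \<Longrightarrow> \<psi> s \<in> {0..1}"
    and ends: "\<phi> 0 = \<psi> 0" "\<phi> 1 = \<psi> 1" "p (\<phi> 0) = x" "p (\<phi> 1) = x"
    and f: "\<And>s. s \<in> {0..1} \<Longrightarrow> f s = p (\<phi> s)"
    and g: "\<And>s. s \<in> {0..1} \<Longrightarrow> g s = p (\<psi> s)"
  shows "loop_homotopic X x f g"
proof -
  let ?S = "{0..1::real} \<times> {0..1::real}"
  let ?k = "\<lambda>v::real \<times> real. (1 - fst v) * \<phi> (snd v) + fst v * \<psi> (snd v)"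
  have range: "(1 - t) * \<phi> s + t * \<psi> s \<in> {0..1}" if "t \<in> {0..1}" "s \<in> {0..1}" for t s
    using convexD_alt[OF convex_real_interval(5), of "\<phi> s" 0 1 "\<psi> s" t] \<phi>(2)[of s] \<psi>(2)[of s] that
    by simp
  have "continuous_on ?S (\<lambda>v. \<phi> (snd v))" "continuous_on ?S (\<lambda>v. \<psi> (snd v))"
    by (auto intro!: continuous_on_compose2[OF \<phi>(1)] continuous_on_compose2[OF \<psi>(1)] continuous_intros)
  then have "continuous_on ?S ?k"
    by (intro continuous_intros)
  then have "continuous_map (top_of_set ?S) (top_of_set {0..1}) ?k"
    using range by (auto simp: continuous_map_in_subtopology)
  then have c: "continuous_map (top_of_set ?S) X (p \<circ> ?k)"
    using continuous_map_compose p unfolding pathin_def by blast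
  have "loop_homotopic X x (p \<circ> \<phi>) (p \<circ> \<psi>)"
    unfolding homotopic_with_def continuous_map_square_iff
    using c ends by (intro exI[of _ "p \<circ> ?k"]) (auto simp: algebra_simps)
  then show ?thesis
    by (rule homotopic_with_eq) (use f g in auto)
qed

lemma loop_join_in_loops: "p \<in> loops X x \<Longrightarrow> q \<in> loops X x \<Longrightarrow> loop_join p q \<in> loops X x"
  using loop_homotopic_join[of x X p p q q] by (simp only: loop_homotopic_refl_iff)

lemma loop_join_assoc:
  assumes "p \<in> loops X x" "q \<in> loops X x" "r \<in> loops X x"
  shows "loop_homotopic X x (loop_join (loop_join p q) r) (loop_join p (loop_join q r))"
proof -
  let ?f = "loop_join p (loop_join q r)"
  have f: "?f \<in> loops X x"
    using assms by (intro loop_join_in_loops)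
  \<comment> \<open>Rebracketing is precomposition with the concave piecewise linear map that is 2s
    up to 1/4, s + 1/4 up to 1/2 and (s + 1)/2 afterwards; such a map is the minimum of its linear
    pieces.\<close>
  have cont: "continuous_on {0..1} (\<lambda>s::real. min (2 * s) (min (s + 1/4) ((s + 1) / 2)))"
    by (intro continuous_intros) auto
  show ?thesis
  proof (rule loop_homotopic_reparametrize[where p = ?f and \<phi> = "\<lambda>s. min (2 * s) (min (s + 1/4) ((s + 1) / 2))"
        and \<psi> = "\<lambda>s. s"])
    show "loop_join (loop_join p q) r s = ?f (min (2 * s) (min (s + 1/4) ((s + 1) / 2)))"
      if "s \<in> {0..1}" for s
    proof -
      consider "s \<le> 1/4" | "1/4 < s" "s \<le> 1/2" | "1/2 < s" by linarith
      then show ?thesis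
      proof cases
        case 1
        then have "min (2 * s) (min (s + 1/4) ((s + 1) / 2)) = 2 * s" by (simp add: min_def)
        then show ?thesis using 1 by (simp add: loop_join_def)
      next
        case 2
        then have "min (2 * s) (min (s + 1/4) ((s + 1) / 2)) = s + 1/4" by (simp add: min_def)
        then show ?thesis using 2 by (simp add: loop_join_def algebra_simps)
      next
        case 3
        then have "min (2 * s) (min (s + 1/4) ((s + 1) / 2)) = (s + 1) / 2" by (simp add: min_def)
        then show ?thesis using 3 by (simp add: loop_join_def algebra_simps add_divide_distrib)
      qed
    qed
  qed (use f cont in \<open>auto simp: loops_def min_def\<close>)
qed

lemma loop_join_const:
  assumes "p \<in> loops X x"
  shows "loop_homotopic X x (loop_join (\<lambda>_. x) p) p"
proof -
  have cont: "continuous_on {0..1} (\<lambda>s::real. max 0 (2 * s - 1))"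
    by (intro continuous_intros)
  have eq: "loop_join (\<lambda>_. x) p s = p (max 0 (2 * s - 1))" for s
  proof (cases "s \<le> 1/2")
    case True
    then have "max 0 (2 * s - 1) = 0" by simp
    then show ?thesis using True assms by (simp add: loop_join_def loops_def)
  qed (simp add: loop_join_def)
  show ?thesis
    by (rule loop_homotopic_reparametrize[where p = p and \<phi> = "\<lambda>s. max 0 (2 * s - 1)" and \<psi> = "\<lambda>s. s"])
       (use assms cont in \<open>auto simp: loops_def eq\<close>)
qed

lemma loop_join_reverse:
  assumes "p \<in> loops X x"
  shows "loop_homotopic X x (loop_join (\<lambda>s. p (1 - s)) p) (\<lambda>_. x)"
proof -
  \<comment> \<open>Running p backwards and then forwards is p along |1 - 2s|, which has the same
    end points as the constant parameter 1.\<close>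
  have cont: "continuous_on {0..1} (\<lambda>s::real. \<bar>1 - 2 * s\<bar>)"
    by (intro continuous_intros)
  show ?thesis
    by (rule loop_homotopic_reparametrize[where p = p and \<phi> = "\<lambda>s. \<bar>1 - 2 * s\<bar>" and \<psi> = "\<lambda>_. 1"])
       (use assms cont in \<open>auto simp: loops_def abs_if loop_join_def\<close>)
qed

lemma reverse_in_loops:
  assumes "p \<in> loops X x"
  shows "(\<lambda>s. p (1 - s)) \<in> loops X x"
  unfolding loop_homotopic_refl_iff[symmetric]
  by (rule loop_homotopic_reparametrize[where p = p and \<phi> = "\<lambda>s. 1 - s" and \<psi> = "\<lambda>s. 1 - s"])
     (use assms in \<open>auto simp: loops_def intro!: continuous_intros\<close>)

text \<open>The product is defined as a union over all representatives. Joining respects homotopy,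
  so every member of the union is the same class, and the union is not empty since p and q represent
  their own classes.\<close>

lemma mult_fundamental_group:
  assumes "p \<in> loops X x" "q \<in> loops X x"
  shows "loop_class X x p \<otimes>\<^bsub>fundamental_group X x\<^esub> loop_class X x q = loop_class X x (loop_join p q)"
proof -
  have "loop_class X x (loop_join p' q') = loop_class X x (loop_join p q)"
    if "loop_homotopic X x p p'" "loop_homotopic X x q q'" for p' q'
    by (rule loop_class_eqI[symmetric], rule loop_homotopic_join[OF that])
  moreover have "loop_homotopic X x p p" "loop_homotopic X x q q"
    using assms by (simp_all only: loop_homotopic_refl_iff)
  ultimately have "(\<Union>p'\<in>{p'. loop_homotopic X x p p'}. \<Union>q'\<in>{q'. loop_homotopic X x q q'}.
      loop_class X x (loop_join p' q')) = loop_class X x (loop_join p q)"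
    by blast
  then show ?thesis
    unfolding fundamental_group_def monoid.simps loop_class_eq_homotopic[of X x p]
      loop_class_eq_homotopic[of X x q] .
qed

lemma const_in_loops: "x \<in> topspace X \<Longrightarrow> (\<lambda>_. x) \<in> loops X x"
  by (simp add: loops_def)

lemma group_fundamental_group:
  assumes x: "x \<in> topspace X"
  shows "group (fundamental_group X x)"
proof -
  let ?G = "fundamental_group X x"
  have carr: "carrier ?G = loop_class X x ` loops X x"
    and one: "\<one>\<^bsub>?G\<^esub> = loop_class X x (\<lambda>_. x)"
    by (auto simp: fundamental_group_def)
  show ?thesis
  proof (rule groupI)
    fix P Q R
    assume "P \<in> carrier ?G" "Q \<in> carrier ?G" "R \<in> carrier ?G"
    then obtain p q r where "P = loop_class X x p" "Q = loop_class X x q" "R = loop_class X x r"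
        "p \<in> loops X x" "q \<in> loops X x" "r \<in> loops X x"
      unfolding carr by auto
    then show "P \<otimes>\<^bsub>?G\<^esub> Q \<otimes>\<^bsub>?G\<^esub> R = P \<otimes>\<^bsub>?G\<^esub> (Q \<otimes>\<^bsub>?G\<^esub> R)"
      by (simp add: mult_fundamental_group loop_join_in_loops loop_class_eqI[OF loop_join_assoc])
  next
    fix P assume "P \<in> carrier ?G"
    then obtain p where p: "P = loop_class X x p" "p \<in> loops X x"
      unfolding carr by auto
    show "\<one>\<^bsub>?G\<^esub> \<otimes>\<^bsub>?G\<^esub> P = P"
      using loop_class_eqI[OF loop_join_const[OF p(2)]]
      by (simp only: p(1) one mult_fundamental_group[OF const_in_loops[OF x] p(2)])
    have "loop_class X x (\<lambda>s. p (1 - s)) \<otimes>\<^bsub>?G\<^esub> P = \<one>\<^bsub>?G\<^esub>"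
      using loop_class_eqI[OF loop_join_reverse[OF p(2)]]
      by (simp only: p(1) one mult_fundamental_group[OF reverse_in_loops[OF p(2)] p(2)])
    then show "\<exists>Q\<in>carrier ?G. Q \<otimes>\<^bsub>?G\<^esub> P = \<one>\<^bsub>?G\<^esub>"
      unfolding carr using reverse_in_loops[OF p(2)] by blast
  qed (auto simp: carr one mult_fundamental_group loop_join_in_loops const_in_loops[OF x])
qed

text \<open>Supplies the hypothesis of \<open>group_fundamental_group\<close>: a presented group has
  an element, hence a loop, and a loop starts inside the space.\<close>

lemma fundamental_group_nonempty_imp_topspace:
  assumes "carrier (fundamental_group X x) \<noteq> {}"
  shows "x \<in> topspace X"
proof -
  obtain p where "p \<in> loops X x"
    using assms by (auto simp: fundamental_group_def)
  then show ?thesis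
    using path_start_in_topspace[of X p] by (simp add: loops_def)
qed


section \<open>Irreducible curves\<close>

lemma irreducible_closed_finite_cover:
  assumes "irreducible_closed Z Y" "finite \<F>" "\<F> \<subseteq> Z" "Y \<subseteq> \<Union>\<F>"
    and Un: "\<And>A B. A \<in> Z \<Longrightarrow> B \<in> Z \<Longrightarrow> A \<union> B \<in> Z"
  shows "\<exists>A\<in>\<F>. Y \<subseteq> A"
  using assms(2-4)
proof (induction \<F>)
  case empty
  then show ?case using assms(1) by (auto simp: irreducible_closed_def)
next
  case (insert A \<F>)
  show ?case
  proof (cases "\<F> = {}")
    case False
    have "\<Union>\<F> \<in> Z"
      using insert.hyps(1) False insert.prems(1)
      by (induction \<F> rule: finite_ne_induct) (auto simp: Un)
    moreover have "A \<in> Z" "Y \<subseteq> A \<union> \<Union>\<F>" "\<F> \<subseteq> Z"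
      using insert.prems by auto
    ultimately have "Y \<subseteq> A \<or> Y \<subseteq> \<Union>\<F>"
      using assms(1) unfolding irreducible_closed_def by blast
    then show ?thesis
      using insert.IH \<open>\<F> \<subseteq> Z\<close> by blast
  qed (use insert in auto)
qed

text \<open>
  \<open>E x\<close> is the set of all representatives of the point represented by \<open>x\<close>: a singleton
  in the affine setting, a punctured line in the projective one.
\<close>

lemma irreducible_curveI:
  assumes "X \<in> Z"
    and Un: "\<And>A B. A \<in> Z \<Longrightarrow> B \<in> Z \<Longrightarrow> A \<union> B \<in> Z"
    and refl: "\<And>x. x \<in> X \<Longrightarrow> x \<in> E x"
    and sym: "\<And>x y. x \<in> X \<Longrightarrow> y \<in> E x \<Longrightarrow> x \<in> E y"
    and saturated: "\<And>A x y. A \<in> Z \<Longrightarrow> x \<in> A \<Longrightarrow> y \<in> E x \<Longrightarrow> y \<in> A"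
    and closed: "\<And>x. x \<in> X \<Longrightarrow> E x \<in> Z"
    and fin: "\<And>A. A \<in> Z \<Longrightarrow> \<not> X \<subseteq> A \<Longrightarrow> finite (E ` (A \<inter> X))"
    and inf: "infinite (E ` X)"
  shows "irreducible_curve Z X"
proof -
  have pt: "irreducible_closed Z (E x)" if "x \<in> X" for x
    unfolding irreducible_closed_def
  proof (intro conjI ballI impI)
    show "E x \<in> Z" "E x \<noteq> {}" using closed refl that by auto
    fix A B assume "A \<in> Z" "B \<in> Z" "E x \<subseteq> A \<union> B"
    then show "E x \<subseteq> A \<or> E x \<subseteq> B"
      using saturated refl[OF that] by blast
  qed
  have irr: "irreducible_closed Z X"
    unfolding irreducible_closed_def
  proof (intro conjI ballI impI)
    show "X \<noteq> {}" using inf by auto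
    fix A B assume AB: "A \<in> Z" "B \<in> Z" "X \<subseteq> A \<union> B"
    show "X \<subseteq> A \<or> X \<subseteq> B"
    proof (rule ccontr)
      assume "\<not> (X \<subseteq> A \<or> X \<subseteq> B)"
      then have "finite (E ` (A \<inter> X) \<union> E ` (B \<inter> X))"
        using fin AB by auto
      moreover have "E ` X \<subseteq> E ` (A \<inter> X) \<union> E ` (B \<inter> X)"
        using AB by auto
      ultimately show False using inf finite_subset by blast
    qed
  qed fact
  obtain x where x: "x \<in> X" using inf by fastforce
  have "E x \<subseteq> X" using saturated x \<open>X \<in> Z\<close> by blast
  moreover have "E x \<noteq> X"
  proof
    assume eq: "E x = X"
    have "E y = E x" if "y \<in> X" for y
    proof
      have y: "y \<in> E x" using that eq by simp
      show "E y \<subseteq> E x" using saturated[OF closed[OF x] y] by blast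
      show "E x \<subseteq> E y" using saturated[OF closed[OF that] sym[OF x y]] by blast
    qed
    then have "E ` X \<subseteq> {E x}" by auto
    then show False using inf finite_subset by blast
  qed
  \<comment> \<open>No chain of length two: a proper closed B is a finite union of classes, so
    irreducibility puts it inside a single class \<open>E b\<close>. A nonempty closed A inside B
    meets this class and, being saturated, contains it.\<close>
  moreover have "\<not> (A \<subset> B \<and> B \<subset> X)" if "irreducible_closed Z A" and B: "irreducible_closed Z B" for A B
  proof
    assume sub: "A \<subset> B \<and> B \<subset> X"
    have Z: "A \<in> Z" "B \<in> Z" "A \<noteq> {}" using that by (auto simp: irreducible_closed_def)
    have "\<not> X \<subseteq> B" "B \<inter> X = B" using sub by auto
    then have "finite (E ` B)" using fin[OF Z(2)] by simp
    moreover have "E ` B \<subseteq> Z" using closed sub by auto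
    moreover have "B \<subseteq> \<Union>(E ` B)" using refl sub by auto
    ultimately have "\<exists>Y\<in>E ` B. B \<subseteq> Y"
      by (intro irreducible_closed_finite_cover[OF B _ _ _ Un])
    then obtain b where b: "b \<in> B" "B \<subseteq> E b"
      by auto
    obtain a where a: "a \<in> A" using Z by auto
    then have "a \<in> E b" using b sub by auto
    then have "b \<in> A" using sym[of b a] b sub saturated[OF Z(1) a] by auto
    then have "E b \<subseteq> A" using saturated[OF Z(1)] by blast
    then show False using b sub by auto
  qed
  ultimately show ?thesis
    unfolding irreducible_curve_def using irr pt[OF x] by (meson psubsetI)
qed


section \<open>Polynomials on the plane quartic\<close>

text \<open>The outer variable is y and the coefficients are polynomials in x. Degrees and
  pseudo-division below thus refer to y, and a constant of the outer ring is a polynomial in x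
  alone.\<close>

definition eval2 :: "complex poly poly \<Rightarrow> complex \<Rightarrow> complex \<Rightarrow> complex" where
  "eval2 P x y = poly (poly P [:y:]) x"

definition polyfun2 :: "(complex \<Rightarrow> complex \<Rightarrow> complex) \<Rightarrow> bool" where
  "polyfun2 f \<longleftrightarrow> (\<exists>P. \<forall>x y. f x y = eval2 P x y)"

lemma polyfun2_const [simp]: "polyfun2 (\<lambda>x y. c)"
  unfolding polyfun2_def by (rule exI[of _ "[:[:c:]:]"]) (simp add: eval2_def)

lemma polyfun2_fst [simp]: "polyfun2 (\<lambda>x y. x)"
  unfolding polyfun2_def by (rule exI[of _ "[:[:0, 1:]:]"]) (simp add: eval2_def)

lemma polyfun2_snd [simp]: "polyfun2 (\<lambda>x y. y)"
  unfolding polyfun2_def by (rule exI[of _ "[:0, 1:]"]) (simp add: eval2_def)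

lemma polyfun2_add: "polyfun2 f \<Longrightarrow> polyfun2 g \<Longrightarrow> polyfun2 (\<lambda>x y. f x y + g x y)"
  unfolding polyfun2_def
proof (elim exE)
  fix P Q assume "\<forall>x y. f x y = eval2 P x y" "\<forall>x y. g x y = eval2 Q x y"
  then show "\<exists>R. \<forall>x y. f x y + g x y = eval2 R x y"
    by (intro exI[of _ "P + Q"]) (simp add: eval2_def)
qed

lemma polyfun2_mult: "polyfun2 f \<Longrightarrow> polyfun2 g \<Longrightarrow> polyfun2 (\<lambda>x y. f x y * g x y)"
  unfolding polyfun2_def
proof (elim exE)
  fix P Q assume "\<forall>x y. f x y = eval2 P x y" "\<forall>x y. g x y = eval2 Q x y"
  then show "\<exists>R. \<forall>x y. f x y * g x y = eval2 R x y"
    by (intro exI[of _ "P * Q"]) (simp add: eval2_def)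
qed

lemma polyfun2_diff: "polyfun2 f \<Longrightarrow> polyfun2 g \<Longrightarrow> polyfun2 (\<lambda>x y. f x y - g x y)"
  using polyfun2_add[of f "\<lambda>x y. (-1) * g x y"] polyfun2_mult[of "\<lambda>x y. -1" g] by simp

lemma polyfun2_power: "polyfun2 f \<Longrightarrow> polyfun2 (\<lambda>x y. f x y ^ n)"
  by (induction n) (auto intro: polyfun2_mult)

lemmas polyfun2_intros = polyfun2_add polyfun2_mult polyfun2_diff polyfun2_power
  polyfun2_const polyfun2_fst polyfun2_snd

section \<open>Irreducibility of the affine quartic\<close>

definition quartic :: "complex \<Rightarrow> complex \<Rightarrow> complex" where
  "quartic x y = y^4 - x^3 * y - 3 * y^2 + 2 * x * y + 1"

definition quartic_poly :: "complex poly poly" where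
  "quartic_poly = [:[:1:], [:0, 2, 0, -1:], [:-3:], 0, [:1:]:]"

lemma eval2_quartic_poly: "eval2 quartic_poly x y = quartic x y"
  by (simp add: eval2_def quartic_poly_def quartic_def algebra_simps power_numeral_reduce)

lemma coeff_quartic_poly:
  "coeff quartic_poly 0 = [:1:]" "coeff quartic_poly 1 = [:0, 2, 0, -1:]"
  "coeff quartic_poly 2 = [:-3:]" "coeff quartic_poly 3 = 0" "coeff quartic_poly 4 = [:1:]"
  by (simp_all add: quartic_poly_def numeral_eq_Suc)

lemma degree_quartic_poly: "degree quartic_poly = 4"
  by (simp add: quartic_poly_def)

text \<open>The quartic is monic in y, so a linear factor yields a root r that is a polynomial in x.
  Its constant coefficient is 1, so r divides 1 and is a nonzero number c; but then the coefficient
  of x^3 after substituting c is -c.\<close>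

lemma degree_1_mult_quartic_poly:
  assumes "quartic_poly = G * H" "degree G = 1"
  shows False
proof -
  obtain b a where G: "G = [:b, a:]" "a \<noteq> 0"
  proof
    show "G = [:coeff G 0, coeff G 1:]"
      using assms(2) by (intro poly_eqI) (auto simp: coeff_pCons coeff_eq_0 split: nat.splits)
    show "coeff G 1 \<noteq> 0" using assms(2) by (metis leading_coeff_0_iff degree_0 zero_neq_one)
  qed
  have "degree H = 3"
  proof -
    have "G \<noteq> 0" "H \<noteq> 0" using assms degree_quartic_poly by auto
    then have "degree (G * H) = degree G + degree H" by (rule degree_mult_eq)
    then show ?thesis using assms degree_quartic_poly by simp
  qed
  then have "coeff (G * H) 4 = a * coeff H 3"
    by (simp add: G numeral_eq_Suc coeff_eq_0)
  then have unit: "a * coeff H 3 = 1"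
    using coeff_quartic_poly(5) assms(1) by (simp add: one_pCons)
  \<comment> \<open>This is -b/a, since \<open>coeff H 3\<close> is the inverse of
    \<open>a\<close>.\<close>
  define r where "r = - b * coeff H 3"
  have "poly G r = 0" by (simp add: G r_def) (metis unit mult.commute mult.left_commute mult.right_neutral add.right_inverse mult.assoc)
  then have r: "poly quartic_poly r = 0" by (simp add: assms(1))
  then have r0: "1 + r * ([:0, 2, 0, -1:] + r * ([:-3:] + r * r)) = 0"
    by (simp add: quartic_poly_def one_pCons)
  then have "r * (- ([:0, 2, 0, -1:] + r * ([:-3:] + r * r))) = 1"
    by (simp only: mult_minus_right add_eq_0_iff minus_minus)
  then have "r dvd 1" by (metis dvd_triv_left)
  then obtain c where c: "r = [:c:]" "c dvd 1"
    by (rule is_unit_polyE)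
  then have "c \<noteq> 0" by auto
  then have "coeff (1 + r * ([:0, 2, 0, -1:] + r * ([:-3:] + r * r))) 3 = - c"
    by (simp add: c(1) one_pCons numeral_eq_Suc)
  then show False using r0 \<open>c \<noteq> 0\<close> by simp
qed

text \<open>The outer coefficients \<open>b0\<close>, \<open>c0\<close>, \<open>b2\<close>,
  \<open>c2\<close> are units, hence numbers. The vanishing y^3 coefficient expresses
  \<open>c1\<close> through \<open>b1\<close>, and then the y^2 coefficient shows that the square of
  \<open>b1\<close> is a number. So all six coefficients are numbers, whereas the y coefficient 2x -
  x^3 is not.\<close>

lemma degree_2_mult_quartic_poly:
  assumes "quartic_poly = G * H" "degree G = 2"
  shows False
proof -
  have "degree H = 2"
  proof -
    have "G \<noteq> 0" "H \<noteq> 0" using assms degree_quartic_poly by auto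
    then have "degree (G * H) = degree G + degree H" by (rule degree_mult_eq)
    then show ?thesis using assms degree_quartic_poly by simp
  qed
  have *: "P = [:coeff P 0, coeff P 1, coeff P 2:]" if "degree P = 2" for P :: "complex poly poly"
    using that by (intro poly_eqI) (auto simp: coeff_pCons numeral_2_eq_2 coeff_eq_0 split: nat.splits)
  obtain b0 b1 b2 where G: "G = [:b0, b1, b2:]" using *[OF assms(2)] by metis
  obtain c0 c1 c2 where H: "H = [:c0, c1, c2:]" using *[OF \<open>degree H = 2\<close>] by metis
  have "coeff quartic_poly 0 = b0 * c0" "coeff quartic_poly 1 = b0 * c1 + b1 * c0"
    "coeff quartic_poly 2 = b0 * c2 + b1 * c1 + b2 * c0"
    "coeff quartic_poly 3 = b1 * c2 + b2 * c1" "coeff quartic_poly 4 = b2 * c2"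
    unfolding assms(1) G H by (simp_all add: numeral_eq_Suc)
  then have e: "b0 * c0 = [:1:]" "b0 * c1 + b1 * c0 = [:0, 2, 0, -1:]"
    "b0 * c2 + b1 * c1 + b2 * c0 = [:-3:]" "b1 * c2 + b2 * c1 = 0" "b2 * c2 = [:1:]"
    by (simp_all only: coeff_quartic_poly)
  have unit_const: "degree p = 0" if "p * q = [:1:]" for p q :: "complex poly"
    using that by (metis degree_mult_eq degree_pCons_0 add_is_0 mult_zero_left mult_zero_right one_neq_zero pCons_eq_0_iff)
  have d: "degree b0 = 0" "degree c0 = 0" "degree b2 = 0" "degree c2 = 0"
    using unit_const e(1) e(5) by (metis mult.commute)+
  have deg0: "degree (p * q) = 0" if "degree p = 0" "degree q = 0" for p q :: "complex poly"
    using degree_mult_le[of p q] that by simp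
  have b2: "b2 * (b1 * c1) = - (b1 * b1) * c2"
    using e(4) by (metis (no_types, lifting) add_eq_0_iff mult.assoc mult.commute mult_minus_left)
  have "b1 * b1 * c2 * c2 = - (b2 * (b1 * c1)) * c2"
    unfolding b2 by simp
  also have "\<dots> = - (b1 * c1) * (b2 * c2)"
    by (simp add: algebra_simps)
  also have "\<dots> = - (b1 * c1)"
    using e(5) by (simp add: one_pCons[symmetric])
  also have "\<dots> = b0 * c2 + b2 * c0 - [:-3:]"
    unfolding e(3)[symmetric] by (simp add: algebra_simps)
  finally have "b1 * b1 * (c2 * c2) = b0 * c2 + b2 * c0 - [:-3:]" by (simp add: mult.assoc)
  moreover have "degree (b0 * c2 + b2 * c0 - [:-3:]) \<le> 0"
    using d by (intro degree_diff_le degree_add_le) (auto simp: deg0)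
  moreover have "c2 \<noteq> 0" using e(5) by auto
  ultimately have b1: "degree b1 = 0"
    using degree_mult_eq[of "b1 * b1" "c2 * c2"] degree_mult_eq[of b1 b1] by (cases "b1 = 0") auto
  have "b2 * c1 = - (b1 * c2)"
    using e(4) by (simp add: add_eq_0_iff)
  then have "c1 * (b2 * c2) = - (b1 * c2) * c2"
    by (metis mult.assoc mult.commute)
  then have "c1 = - (b1 * c2) * c2" using e(5) by (simp add: one_pCons[symmetric])
  then have "degree c1 = 0"
    using b1 d by (simp add: deg0)
  then have "degree (b0 * c1 + b1 * c0) \<le> 0"
    using b1 d by (intro degree_add_le) (auto simp: deg0)
  then show False using e(2) by simp
qed

text \<open>The splittings 1 + 3, 2 + 2 and 3 + 1 of the y-degree are excluded above. In the
  splitting 0 + 4 the factor of degree 0 is a polynomial in x; it is a unit because the leading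
  coefficients multiply to 1.\<close>

lemma irreducible_quartic_poly: "irreducible quartic_poly"
proof (rule irreducibleI)
  show "quartic_poly \<noteq> 0" using degree_quartic_poly by auto
  show "\<not> quartic_poly dvd 1"
    using degree_quartic_poly by (metis degree_1 dvd_imp_degree_le one_neq_zero le_zero_eq zero_neq_numeral)
  fix G H assume eq: "quartic_poly = G * H"
  have "G \<noteq> 0" "H \<noteq> 0" using eq degree_quartic_poly by auto
  then have deg: "degree G + degree H = 4"
    using degree_quartic_poly degree_mult_eq eq by metis
  have lead: "lead_coeff G * lead_coeff H = 1"
    using lead_coeff_mult[of G H] degree_quartic_poly coeff_quartic_poly(5)
    by (simp add: eq[symmetric] one_pCons)
  have const_unit: "P dvd 1" if "degree P = 0" "lead_coeff P * q = 1" for P :: "complex poly poly" and q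
  proof -
    obtain p where "P = [:p:]" using \<open>degree P = 0\<close> by (rule degree_eq_zeroE)
    then have "P * [:q:] = 1" using that(2) by (simp add: one_pCons mult.commute)
    then show ?thesis by (metis dvd_triv_left)
  qed
  have "degree G \<noteq> 1" "degree G \<noteq> 2" "degree H \<noteq> 1"
    using degree_1_mult_quartic_poly[OF eq] degree_2_mult_quartic_poly[OF eq]
      degree_1_mult_quartic_poly[of H G] eq by (auto simp: mult.commute)
  with deg have "degree G = 0 \<or> degree H = 0" by linarith
  then show "G dvd 1 \<or> H dvd 1"
    using const_unit[OF _ lead] const_unit[of H "lead_coeff G"] lead by (auto simp: mult.commute)
qed

lemma eval2_add: "eval2 (P + Q) x y = eval2 P x y + eval2 Q x y"
  and eval2_mult: "eval2 (P * Q) x y = eval2 P x y * eval2 Q x y"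
  by (simp_all add: eval2_def)

text \<open>
  The ideal of \<open>P\<close> and the quartic contains a nonzero polynomial in \<open>x\<close> alone: a member of
  minimal degree in \<open>y\<close> divides, up to factors in \<open>x\<close>, both generators by pseudo-division,
  and the quartic is prime.
\<close>

lemma ideal_quartic_contains_constant:
  fixes P :: "complex poly poly"
  assumes "\<not> quartic_poly dvd P"
  shows "\<exists>U V c. c \<noteq> 0 \<and> U * quartic_poly + V * P = [:c:]"
proof -
  define I where "I = {U * quartic_poly + V * P | U V. True}"
  have I_diff: "a * b - c * d \<in> I" if bd: "b \<in> I" "d \<in> I" for a b c d
  proof -
    obtain U V U' V' where "b = U * quartic_poly + V * P" "d = U' * quartic_poly + V' * P"
      using bd by (auto simp: I_def)
    then have "a * b - c * d = (a * U - c * U') * quartic_poly + (a * V - c * V') * P"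
      by (simp add: algebra_simps)
    then show ?thesis by (auto simp: I_def)
  qed
  have F: "quartic_poly \<in> I" unfolding I_def
    by (rule CollectI, rule exI[of _ 1], rule exI[of _ 0]) simp
  have P: "P \<in> I" unfolding I_def
    by (rule CollectI, rule exI[of _ 0], rule exI[of _ 1]) simp
  have "quartic_poly \<noteq> 0" using degree_quartic_poly by auto
  then obtain m where m: "m \<in> I" "m \<noteq> 0"
    and min: "\<And>n. n \<in> I \<Longrightarrow> n \<noteq> 0 \<Longrightarrow> degree m \<le> degree n"
    using ex_has_least_nat[of "\<lambda>n. n \<in> I \<and> n \<noteq> 0" quartic_poly degree] F by auto
  have div: "\<exists>c q. c \<noteq> 0 \<and> smult c n = m * q" if "n \<in> I" for n
  proof -
    obtain q r where qr: "pseudo_divmod n m = (q, r)" by force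
    let ?c = "lead_coeff m ^ (Suc (degree n) - degree m)"
    have eq: "smult ?c n = m * q + r" and r: "r = 0 \<or> degree r < degree m"
      using pseudo_divmod[OF m(2) qr] by simp_all
    have "r = [:?c:] * n - q * m"
      using eq by (simp add: algebra_simps)
    then have "r \<in> I"
      using I_diff[OF that m(1), of "[:?c:]" q] by simp
    then have "r = 0" using r min by force
    then show ?thesis
      using eq m(2) by (intro exI[of _ ?c] exI[of _ q]) simp
  qed
  have prime: "prime_elem quartic_poly"
    using irreducible_quartic_poly by (rule irreducible_imp_prime_elem)
  obtain c q where c: "c \<noteq> 0" "smult c quartic_poly = m * q" using div[OF F] by auto
  \<comment> \<open>If the quartic divided q, cancelling it from c * quartic = m * q would make m a
    divisor of the polynomial c in x alone, so m would have y-degree 0.\<close>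
  have q: "\<not> quartic_poly dvd q" if "degree m > 0"
  proof
    assume "quartic_poly dvd q"
    then obtain q' where q': "q = quartic_poly * q'" by blast
    then have "quartic_poly * (m * q') = quartic_poly * [:c:]"
      using c(2) by (simp add: algebra_simps)
    then have "m * q' = [:c:]"
      using \<open>quartic_poly \<noteq> 0\<close> mult_left_cancel by blast
    moreover from this have "q' \<noteq> 0" using c(1) by auto
    ultimately have "degree m + degree q' = 0"
      using degree_mult_eq[OF m(2)] by (metis degree_pCons_0)
    then show False using that by simp
  qed
  have "degree m = 0"
  proof (rule ccontr)
    assume "degree m \<noteq> 0"
    then have "\<not> quartic_poly dvd q" using q by simp
    moreover have "quartic_poly dvd m * q"
      using c(2) by (metis dvd_smult dvd_refl)
    ultimately have "quartic_poly dvd m"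
      using prime by (simp add: prime_elem_dvd_mult_iff)
    moreover obtain d p where d: "d \<noteq> 0" "smult d P = m * p" using div[OF P] by auto
    ultimately have "quartic_poly dvd [:d:] * P" by (simp add: dvd_mult2)
    then have "quartic_poly dvd [:d:]"
      using assms prime prime_elem_dvd_mult_iff by blast
    then have "degree quartic_poly \<le> degree [:d:]"
      using d(1) by (intro dvd_imp_degree_le) auto
    then show False by (simp add: degree_quartic_poly)
  qed
  then obtain r where "m = [:r:]" by (rule degree_eq_zeroE)
  then show ?thesis
    using m by (auto simp: I_def) metis
qed

section \<open>Zeros of polynomial functions on the quartic\<close>

lemma finite_quartic_fibre: "finite {y. quartic x y = 0}"
proof -
  have "quartic x y = poly [:1, 2 * x - x^3, -3, 0, 1:] y" for y
    by (simp add: quartic_def algebra_simps power_numeral_reduce)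
  then show ?thesis by (simp only:) (rule poly_roots_finite, simp)
qed

text \<open>Either the quartic divides the polynomial, or the ideal of the two contains a nonzero
  polynomial in x alone. The latter leaves finitely many x, and over each of them the quartic has
  finitely many y.\<close>

lemma quartic_zeros_finite_or_all:
  assumes "polyfun2 f"
  shows "(\<forall>x y. quartic x y = 0 \<longrightarrow> f x y = 0) \<or> finite {(x, y). quartic x y = 0 \<and> f x y = 0}"
proof -
  obtain P where P: "\<And>x y. f x y = eval2 P x y" using assms by (auto simp: polyfun2_def)
  show ?thesis
  proof (cases "quartic_poly dvd P")
    case True
    then show ?thesis
      by (auto simp: P eval2_mult eval2_quartic_poly elim!: dvdE)
  next
    case False
    then obtain U V c where c: "c \<noteq> 0" "U * quartic_poly + V * P = [:c:]"
      using ideal_quartic_contains_constant by blast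
    have "poly c x = 0" if "quartic x y = 0" "f x y = 0" for x y
    proof -
      have "eval2 [:c:] x y = 0"
        using that unfolding c(2)[symmetric] by (simp add: P eval2_add eval2_mult eval2_quartic_poly)
      then show ?thesis by (simp add: eval2_def)
    qed
    then have "{(x, y). quartic x y = 0 \<and> f x y = 0} \<subseteq> (SIGMA x:{x. poly c x = 0}. {y. quartic x y = 0})"
      by auto
    moreover have "finite (SIGMA x:{x. poly c x = 0}. {y. quartic x y = 0})"
      using poly_roots_finite[OF c(1)] finite_quartic_fibre by (intro finite_SigmaI) auto
    ultimately show ?thesis using finite_subset by blast
  qed
qed

lemma infinite_quartic_zeros: "infinite {(x, y). quartic x y = 0}"
proof -
  have "\<exists>x. quartic x y = 0" if "y \<noteq> 0" for y
  proof -
    \<comment> \<open>For fixed nonzero y the quartic is a cubic in x with leading coefficient -y,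
      so every such y occurs on the curve.\<close>
    have "\<exists>x. poly [:y^4 - 3 * y^2 + 1, 2 * y, 0, - y:] x = 0"
      using that by (intro fundamental_theorem_of_algebra_alt) (auto simp: fundamental_theorem_of_algebra_alt)
    then show ?thesis
      by (auto simp: quartic_def algebra_simps power_numeral_reduce)
  qed
  then have "- {0} \<subseteq> snd ` {(x, y). quartic x y = 0}"
    by force
  moreover have "infinite (- {0 :: complex})"
    using infinite_UNIV_char_0 finite_compl by (metis finite.emptyI finite_insert)
  ultimately show ?thesis
    using finite_subset by blast
qed


section \<open>Homomorphisms of presented groups\<close>

lemma word_value_Nil [simp]: "word_value G g [] = \<one>\<^bsub>G\<^esub>"
  by (simp add: word_value_def)

lemma word_value_Cons [simp]:
  "word_value G g ((i, k) # w) = g i [^]\<^bsub>G\<^esub> k \<otimes>\<^bsub>G\<^esub> word_value G g w"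
  by (simp add: word_value_def)

lemma (in group) commute_int_pow:
  assumes "x \<otimes> y = y \<otimes> x" "x \<in> carrier G" "y \<in> carrier G"
  shows "x [^] (i::int) \<otimes> y = y \<otimes> x [^] i"
proof (cases i rule: int_cases)
  case (nonneg n)
  then show ?thesis using group_commutes_pow[OF assms] by (simp add: int_pow_int)
next
  case (neg n)
  let ?u = "x [^] Suc n"
  have u: "?u \<in> carrier G" "?u \<otimes> y = y \<otimes> ?u"
    using assms group_commutes_pow[OF assms, of "Suc n"] by blast+
  have "inv ?u \<otimes> y = inv ?u \<otimes> (y \<otimes> ?u) \<otimes> inv ?u"
    using u(1) assms(3) by (simp add: m_assoc del: nat_pow_Suc)
  also have "\<dots> = y \<otimes> inv ?u"
    unfolding u(2)[symmetric] using u(1) assms(3) by (simp add: m_assoc[symmetric] del: nat_pow_Suc)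
  finally show ?thesis
    using assms(2) unfolding neg by (simp add: int_pow_neg_int del: of_nat_Suc nat_pow_Suc)
qed

context group
begin

lemma word_value_closed [simp]: "range g \<subseteq> carrier G \<Longrightarrow> word_value G g w \<in> carrier G"
  by (induction w) (auto simp: image_subset_iff)

lemma word_value_append:
  assumes "range g \<subseteq> carrier G"
  shows "word_value G g (u @ v) = word_value G g u \<otimes> word_value G g v"
  using assms
proof (induction u)
  case (Cons p u)
  moreover obtain i k where "p = (i, k)" by force
  moreover have "g i \<in> carrier G" using assms by auto
  ultimately show ?case using word_value_closed[OF assms] by (simp add: m_assoc)
qed (use word_value_closed[OF assms] in simp)

lemma presented_eq_imp_word_value_eq:
  assumes "range g \<subseteq> carrier G" "\<And>r. r \<in> R \<Longrightarrow> word_value G g r = \<one>"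
    and "presented_eq R u v"
  shows "word_value G g u = word_value G g v"
  using assms(3)
proof induction
  case (add i k l)
  have "g i \<in> carrier G" using assms(1) by auto
  then show ?case by (simp add: int_pow_mult)
qed (use assms(1,2) in \<open>auto simp: word_value_append\<close>)

end

lemma hom_word_value:
  assumes "group G" "group H" "\<rho> \<in> hom G H" "range g \<subseteq> carrier G"
  shows "\<rho> (word_value G g w) = word_value H (\<lambda>i. \<rho> (g i)) w"
proof -
  interpret G: group G by fact
  interpret group_hom G H \<rho>
    using assms by (simp add: group_hom_def group_hom_axioms_def)
  show ?thesis
  proof (induction w)
    case (Cons p w)
    obtain i k where p: "p = (i, k)" by force
    have "g i \<in> carrier G" using assms(4) by auto
    then show ?case
      using Cons G.word_value_closed[OF assms(4)] by (simp add: p hom_int_pow)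
  qed simp
qed

text \<open>Von Dyck's theorem. The image of an element is read off from an arbitrarily chosen word
  for it; two words for the same element are \<open>presented_eq\<close>, and each generating step
  of that relation preserves values in H.\<close>

lemma presented_by_hom_exists:
  assumes "group G" "group H" "presented_by G g R"
    and "range f \<subseteq> carrier H" "\<And>r. r \<in> R \<Longrightarrow> word_value H f r = \<one>\<^bsub>H\<^esub>"
  shows "\<exists>\<rho>\<in>hom G H. \<forall>w. \<rho> (word_value G g w) = word_value H f w"
proof -
  interpret G: group G by fact
  interpret H: group H by fact
  have g: "range g \<subseteq> carrier G" "range (word_value G g) = carrier G"
    and eq: "\<And>u v. word_value G g u = word_value G g v \<Longrightarrow> presented_eq R u v"
    using assms(3) by (auto simp: presented_by_def)
  define \<rho> where "\<rho> \<gamma> = word_value H f (SOME w. word_value G g w = \<gamma>)" for \<gamma>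
  have \<rho>: "\<rho> (word_value G g w) = word_value H f w" for w
  proof -
    have "word_value G g (SOME u. word_value G g u = word_value G g w) = word_value G g w"
      by (rule someI[of "\<lambda>u. word_value G g u = word_value G g w" w]) simp
    from H.presented_eq_imp_word_value_eq[OF assms(4,5) eq[OF this]]
    show ?thesis unfolding \<rho>_def by simp
  qed
  have "\<rho> \<in> hom G H"
  proof (rule homI)
    fix \<gamma> \<delta> assume "\<gamma> \<in> carrier G" "\<delta> \<in> carrier G"
    then obtain u v where uv: "\<gamma> = word_value G g u" "\<delta> = word_value G g v"
      using g(2) by (metis imageE)
    then show "\<rho> \<gamma> \<in> carrier H"
      by (simp add: \<rho> H.word_value_closed[OF assms(4)])
    show "\<rho> (\<gamma> \<otimes>\<^bsub>G\<^esub> \<delta>) = \<rho> \<gamma> \<otimes>\<^bsub>H\<^esub> \<rho> \<delta>"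
      unfolding uv G.word_value_append[OF g(1), symmetric] \<rho> by (rule H.word_value_append[OF assms(4)])
  qed
  then show ?thesis using \<rho> by blast
qed


section \<open>Trace polynomials\<close>

lemma mat2_eq_iff:
  fixes A B :: "complex^2^2"
  shows "A = B \<longleftrightarrow> A$1$1 = B$1$1 \<and> A$1$2 = B$1$2 \<and> A$2$1 = B$2$1 \<and> A$2$2 = B$2$2"
  by (auto simp: vec_eq_iff forall_2)

lemma mat2_mult_nth:
  fixes A B :: "complex^2^2"
  shows "(A ** B)$i$j = A$i$1 * B$1$j + A$i$2 * B$2$j"
  by (simp add: matrix_matrix_mult_def sum_2)

lemma trace_2: "trace (A :: complex^2^2) = A$1$1 + A$2$2"
  by (simp add: trace_def sum_2)

text \<open>By Cayley-Hamilton this is the inverse of a matrix of determinant 1, written without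
  division so that its entries stay polynomial.\<close>

definition adjugate2 :: "complex^2^2 \<Rightarrow> complex^2^2" where
  "adjugate2 A = (\<chi> i j. trace A * mat 1 $ i $ j - A $ i $ j)"

lemma mat_1_nth [simp]:
  "(mat 1 :: complex^2^2) $ 1 $ 1 = 1" "(mat 1 :: complex^2^2) $ 1 $ 2 = 0"
  "(mat 1 :: complex^2^2) $ 2 $ 1 = 0" "(mat 1 :: complex^2^2) $ 2 $ 2 = 1"
  by (simp_all add: mat_def)

lemma det_adjugate2: "det (adjugate2 A) = det A"
  by (simp add: det_2 adjugate2_def trace_2 algebra_simps)

lemma adjugate2_mult: "det A = 1 \<Longrightarrow> adjugate2 A ** A = mat 1"
  by (simp add: det_2 adjugate2_def trace_2 mat2_eq_iff mat2_mult_nth algebra_simps)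

lemma group_SL2C: "group SL2C"
proof (rule groupI)
  fix A assume "A \<in> carrier SL2C"
  then show "\<exists>B\<in>carrier SL2C. B \<otimes>\<^bsub>SL2C\<^esub> A = \<one>\<^bsub>SL2C\<^esub>"
    by (intro bexI[of _ "adjugate2 A"]) (auto simp: SL2C_def adjugate2_mult det_adjugate2)
qed (auto simp: SL2C_def det_mul matrix_mul_assoc)

lemma carrier_SL2C [simp]: "A \<in> carrier SL2C \<longleftrightarrow> det A = 1"
  and mult_SL2C [simp]: "A \<otimes>\<^bsub>SL2C\<^esub> B = A ** B"
  and one_SL2C [simp]: "\<one>\<^bsub>SL2C\<^esub> = mat 1"
  by (simp_all add: SL2C_def)

lemma inv_SL2C: "det A = 1 \<Longrightarrow> inv\<^bsub>SL2C\<^esub> A = adjugate2 A"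
  using group.inv_equality[OF group_SL2C, of "adjugate2 A" A] adjugate2_mult[of A] det_adjugate2[of A]
  by simp

text \<open>Polynomial functions as an inductive closure: the arguments about them are inductions on
  how they are built (regularity, clearing of denominators, homogenization).\<close>

inductive_set polyfun3 :: "(complex \<Rightarrow> complex \<Rightarrow> complex \<Rightarrow> complex) set" where
  const: "(\<lambda>x y z. c) \<in> polyfun3"
| fst: "(\<lambda>x y z. x) \<in> polyfun3"
| snd: "(\<lambda>x y z. y) \<in> polyfun3"
| thd: "(\<lambda>x y z. z) \<in> polyfun3"
| add: "P \<in> polyfun3 \<Longrightarrow> Q \<in> polyfun3 \<Longrightarrow> (\<lambda>x y z. P x y z + Q x y z) \<in> polyfun3"
| mult: "P \<in> polyfun3 \<Longrightarrow> Q \<in> polyfun3 \<Longrightarrow> (\<lambda>x y z. P x y z * Q x y z) \<in> polyfun3"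

lemma polyfun3_uminus: "P \<in> polyfun3 \<Longrightarrow> (\<lambda>x y z. - P x y z) \<in> polyfun3"
  using polyfun3.mult[OF polyfun3.const[of "-1"], of P] by simp

lemma polyfun3_diff: "P \<in> polyfun3 \<Longrightarrow> Q \<in> polyfun3 \<Longrightarrow> (\<lambda>x y z. P x y z - Q x y z) \<in> polyfun3"
  using polyfun3.add[OF _ polyfun3_uminus, of P Q] by simp

lemmas polyfun3_intros = polyfun3.intros polyfun3_uminus polyfun3_diff

text \<open>Coordinates with respect to 1, A, B, AB. Their span is stable under left multiplication
  by A, B and their inverses, so a word in A and B can be evaluated on four coefficients.\<close>

definition lin4 :: "complex \<Rightarrow> complex \<Rightarrow> complex \<Rightarrow> complex \<Rightarrow> complex^2^2 \<Rightarrow> complex^2^2 \<Rightarrow> complex^2^2" where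
  "lin4 p q r s A B = (\<chi> i j. p * mat 1 $ i $ j + q * A $ i $ j + r * B $ i $ j + s * (A ** B) $ i $ j)"

lemma trace_lin4: "trace (lin4 p q r s A B) = 2 * p + q * trace A + r * trace B + s * trace (A ** B)"
  by (simp add: lin4_def trace_2 algebra_simps)

text \<open>The four identities below are the Cayley-Hamilton theorem for \<open>A\<close>, \<open>B\<close> and its polarisation.\<close>

lemma mult_lin4:
  fixes A B :: "complex^2^2"
  defines "x \<equiv> trace A" and "y \<equiv> trace B" and "z \<equiv> trace (A ** B)"
  assumes "det A = 1" "det B = 1"
  shows "A ** lin4 p q r s A B = lin4 (- q) (p + x * q) (- s) (r + x * s) A B"
    and "adjugate2 A ** lin4 p q r s A B = lin4 (x * p + q) (- p) (x * r + s) (- r) A B"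
    and "B ** lin4 p q r s A B = lin4 (q * (z - x * y) - r - s * x) (q * y + s) (p + q * x + y * r + z * s) (- q) A B"
    and "adjugate2 B ** lin4 p q r s A B = lin4 (y * p - q * (z - x * y) + r + s * x) (- s) (- p - q * x - z * s) (y * s + q) A B"
proof -
  have A: "A$1$1 * A$2$2 = 1 + A$1$2 * A$2$1" and B: "B$1$1 * B$2$2 = 1 + B$1$2 * B$2$1"
    using assms(4,5) by (simp_all add: det_2 diff_eq_eq)
  show "A ** lin4 p q r s A B = lin4 (- q) (p + x * q) (- s) (r + x * s) A B"
    unfolding x_def mat2_eq_iff lin4_def trace_2 mat2_mult_nth vec_lambda_beta mat_1_nth
    using A by (intro conjI; algebra)
  show "adjugate2 A ** lin4 p q r s A B = lin4 (x * p + q) (- p) (x * r + s) (- r) A B"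
    unfolding x_def mat2_eq_iff lin4_def adjugate2_def trace_2 mat2_mult_nth vec_lambda_beta mat_1_nth
    using A by (intro conjI; algebra)
  show "B ** lin4 p q r s A B = lin4 (q * (z - x * y) - r - s * x) (q * y + s) (p + q * x + y * r + z * s) (- q) A B"
    unfolding x_def y_def z_def mat2_eq_iff lin4_def trace_2 mat2_mult_nth vec_lambda_beta mat_1_nth
    using B by (intro conjI; algebra)
  show "adjugate2 B ** lin4 p q r s A B = lin4 (y * p - q * (z - x * y) + r + s * x) (- s) (- p - q * x - z * s) (y * s + q) A B"
    unfolding x_def y_def z_def mat2_eq_iff lin4_def adjugate2_def trace_2 mat2_mult_nth vec_lambda_beta mat_1_nth
    using B by (intro conjI; algebra)
qed

text \<open>The four coefficients are chosen before A and B: one set of polynomials in the three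
  traces has to serve all pairs of matrices.\<close>

definition trace_linear :: "(complex^2^2 \<Rightarrow> complex^2^2 \<Rightarrow> complex^2^2) \<Rightarrow> bool" where
  "trace_linear W \<longleftrightarrow>
     (\<exists>p\<in>polyfun3. \<exists>q\<in>polyfun3. \<exists>r\<in>polyfun3. \<exists>s\<in>polyfun3. \<forall>A B. det A = 1 \<longrightarrow> det B = 1 \<longrightarrow>
        W A B = (let x = trace A; y = trace B; z = trace (A ** B)
                 in lin4 (p x y z) (q x y z) (r x y z) (s x y z) A B))"

lemma trace_linear_one: "trace_linear (\<lambda>A B. mat 1)"
  unfolding trace_linear_def Let_def
  by (rule bexI[OF _ polyfun3.const[of 1]], (rule bexI[OF _ polyfun3.const[of 0]])+)
     (simp add: lin4_def mat2_eq_iff)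

lemma trace_linear_mult:
  assumes "trace_linear W"
  shows "trace_linear (\<lambda>A B. A ** W A B)" "trace_linear (\<lambda>A B. adjugate2 A ** W A B)"
    "trace_linear (\<lambda>A B. B ** W A B)" "trace_linear (\<lambda>A B. adjugate2 B ** W A B)"
proof -
  obtain p q r s where P: "p \<in> polyfun3" "q \<in> polyfun3" "r \<in> polyfun3" "s \<in> polyfun3"
    and W: "\<And>A B. det A = 1 \<Longrightarrow> det B = 1 \<Longrightarrow> W A B =
        (let x = trace A; y = trace B; z = trace (A ** B)
         in lin4 (p x y z) (q x y z) (r x y z) (s x y z) A B)"
    using assms unfolding trace_linear_def by blast
  show "trace_linear (\<lambda>A B. A ** W A B)"
    unfolding trace_linear_def Let_def
    apply (rule bexI[of _ "\<lambda>x y z. - q x y z"])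
     apply (rule bexI[of _ "\<lambda>x y z. p x y z + x * q x y z"])
      apply (rule bexI[of _ "\<lambda>x y z. - s x y z"])
       apply (rule bexI[of _ "\<lambda>x y z. r x y z + x * s x y z"])
    by (simp_all add: W Let_def mult_lin4 P polyfun3_intros)
  show "trace_linear (\<lambda>A B. adjugate2 A ** W A B)"
    unfolding trace_linear_def Let_def
    apply (rule bexI[of _ "\<lambda>x y z. x * p x y z + q x y z"])
     apply (rule bexI[of _ "\<lambda>x y z. - p x y z"])
      apply (rule bexI[of _ "\<lambda>x y z. x * r x y z + s x y z"])
       apply (rule bexI[of _ "\<lambda>x y z. - r x y z"])
    by (simp_all add: W Let_def mult_lin4 P polyfun3_intros)
  show "trace_linear (\<lambda>A B. B ** W A B)"
    unfolding trace_linear_def Let_def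
    apply (rule bexI[of _ "\<lambda>x y z. q x y z * (z - x * y) - r x y z - s x y z * x"])
     apply (rule bexI[of _ "\<lambda>x y z. q x y z * y + s x y z"])
      apply (rule bexI[of _ "\<lambda>x y z. p x y z + q x y z * x + y * r x y z + z * s x y z"])
       apply (rule bexI[of _ "\<lambda>x y z. - q x y z"])
    by (simp_all add: W Let_def mult_lin4 P polyfun3_intros)
  show "trace_linear (\<lambda>A B. adjugate2 B ** W A B)"
    unfolding trace_linear_def Let_def
    apply (rule bexI[of _ "\<lambda>x y z. y * p x y z - q x y z * (z - x * y) + r x y z + s x y z * x"])
     apply (rule bexI[of _ "\<lambda>x y z. - s x y z"])
      apply (rule bexI[of _ "\<lambda>x y z. - p x y z - q x y z * x - z * s x y z"])
       apply (rule bexI[of _ "\<lambda>x y z. y * s x y z + q x y z"])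
    by (simp_all add: W Let_def mult_lin4 P polyfun3_intros)
qed

definition gen_pair :: "'a \<Rightarrow> 'a \<Rightarrow> gen \<Rightarrow> 'a" where
  "gen_pair A B i = (case i of Gen_a \<Rightarrow> A | Gen_b \<Rightarrow> B)"

lemma gen_pair_simps [simp]: "gen_pair A B Gen_a = A" "gen_pair A B Gen_b = B"
  by (simp_all add: gen_pair_def)

lemma range_gen_pair: "range (gen_pair A B) = {A, B}"
  by (auto simp: gen_pair_def image_iff split: gen.splits)

lemma trace_linear_cong:
  assumes "trace_linear W" "\<And>A B. det A = 1 \<Longrightarrow> det B = 1 \<Longrightarrow> V A B = W A B"
  shows "trace_linear V"
  using assms unfolding trace_linear_def by simp

lemma trace_linear_nat_pow_mult:
  assumes "trace_linear W" 
    and X: "\<And>W. trace_linear W \<Longrightarrow> trace_linear (\<lambda>A B. X A B ** W A B)"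
  shows "trace_linear (\<lambda>A B. X A B [^]\<^bsub>SL2C\<^esub> (n::nat) ** W A B)"
  using assms(1)
proof (induction n arbitrary: W)
  case (Suc n)
  then show ?case
    using Suc.IH[OF X[OF Suc.prems]] by (simp add: matrix_mul_assoc)
qed (simp add: nat_pow_def)

lemma trace_linear_int_pow_mult:
  assumes "trace_linear W" 
    and X: "\<And>W. trace_linear W \<Longrightarrow> trace_linear (\<lambda>A B. X A B ** W A B)"
      "\<And>W. trace_linear W \<Longrightarrow> trace_linear (\<lambda>A B. adjugate2 (X A B) ** W A B)"
    and det: "\<And>A B. det A = 1 \<Longrightarrow> det B = 1 \<Longrightarrow> det (X A B) = 1"
  shows "trace_linear (\<lambda>A B. X A B [^]\<^bsub>SL2C\<^esub> (k::int) ** W A B)"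
proof (cases "k < 0")
  case False
  then have "X A B [^]\<^bsub>SL2C\<^esub> k = X A B [^]\<^bsub>SL2C\<^esub> nat k" for A B
    by (simp add: int_pow_def2 del: pow_nat)
  then show ?thesis
    using trace_linear_nat_pow_mult[OF assms(1), of X "nat k"] X(1) by (simp del: pow_nat)
next
  case True
  have "X A B [^]\<^bsub>SL2C\<^esub> k = adjugate2 (X A B) [^]\<^bsub>SL2C\<^esub> nat (- k)" if "det A = 1" "det B = 1" for A B
    using True that det group.nat_pow_inv[OF group_SL2C, of "X A B" "nat (- k)"]
    by (simp add: int_pow_def2 inv_SL2C del: pow_nat)
  moreover have "trace_linear (\<lambda>A B. adjugate2 (X A B) [^]\<^bsub>SL2C\<^esub> nat (- k) ** W A B)"
    by (rule trace_linear_nat_pow_mult[OF assms(1) X(2)])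
  ultimately show ?thesis
    by (elim trace_linear_cong) (simp del: pow_nat)
qed

lemma trace_linear_word: "trace_linear (\<lambda>A B. word_value SL2C (gen_pair A B) w)"
proof (induction w)
  case Nil
  then show ?case by (simp add: trace_linear_one)
next
  case (Cons p w)
  obtain i k where p: "p = (i, k)" by force
  show ?case
    using trace_linear_int_pow_mult[OF Cons trace_linear_mult(1,2)]
      trace_linear_int_pow_mult[OF Cons trace_linear_mult(3,4)]
    by (cases i) (simp_all add: p)
qed

text \<open>The theorem of Fricke and Vogt for two generators, obtained by taking the trace of the
  form given by \<open>trace_linear_word\<close>. It makes tr a, tr b, tr ab coordinates on the
  character variety.\<close>

lemma trace_word_polyfun3:
  "\<exists>P\<in>polyfun3. \<forall>A B. det A = 1 \<longrightarrow> det B = 1 \<longrightarrow>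
     trace (word_value SL2C (gen_pair A B) w) = P (trace A) (trace B) (trace (A ** B))"
proof -
  obtain p q r s where P: "p \<in> polyfun3" "q \<in> polyfun3" "r \<in> polyfun3" "s \<in> polyfun3"
    and W: "\<And>A B. det A = 1 \<Longrightarrow> det B = 1 \<Longrightarrow> word_value SL2C (gen_pair A B) w =
        (let x = trace A; y = trace B; z = trace (A ** B)
         in lin4 (p x y z) (q x y z) (r x y z) (s x y z) A B)"
    using trace_linear_word[of w] unfolding trace_linear_def by blast
  show ?thesis
    by (rule bexI[of _ "\<lambda>x y z. 2 * p x y z + q x y z * x + r x y z * y + s x y z * z"])
       (simp_all add: W Let_def trace_lin4 P polyfun3_intros)
qed


section \<open>Homogeneous polynomials\<close>

lemma hpoly_const: "(\<lambda>v. c) \<in> hpoly n 0"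
  and hpoly_coord: "i \<le> n \<Longrightarrow> (\<lambda>v. v i) \<in> hpoly n 1"
  and hpoly_add: "F \<in> hpoly n d \<Longrightarrow> H \<in> hpoly n d \<Longrightarrow> (\<lambda>v. F v + H v) \<in> hpoly n d"
  and hpoly_mult: "F \<in> hpoly n d \<Longrightarrow> H \<in> hpoly n e \<Longrightarrow> (\<lambda>v. F v * H v) \<in> hpoly n (d + e)"
  unfolding hpoly_def using hpoly_graded.intros by blast+

lemma hpoly_mult_eq:
  "F \<in> hpoly n d \<Longrightarrow> H \<in> hpoly n e \<Longrightarrow> d + e = k \<Longrightarrow> (\<lambda>v. F v * H v) \<in> hpoly n k"
  using hpoly_mult by blast

lemma hpoly_cmult: "F \<in> hpoly n d \<Longrightarrow> (\<lambda>v. c * F v) \<in> hpoly n d"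
  using hpoly_mult[OF hpoly_const] by fastforce

lemma hpoly_diff: "F \<in> hpoly n d \<Longrightarrow> H \<in> hpoly n d \<Longrightarrow> (\<lambda>v. F v - H v) \<in> hpoly n d"
  using hpoly_add[OF _ hpoly_cmult[of H n d "-1"]] by simp

lemma hpoly_power: "F \<in> hpoly n d \<Longrightarrow> (\<lambda>v. F v ^ m) \<in> hpoly n (m * d)"
  by (induction m) (auto intro: hpoly_mult simp: hpoly_const)

lemma hpoly_induct [consumes 1, case_names const coord add mult]:
  assumes "F \<in> hpoly n d"
    and "\<And>c. P 0 (\<lambda>_. c)"
    and "\<And>i. i \<le> n \<Longrightarrow> P 1 (\<lambda>v. v i)"
    and "\<And>d F H. P d F \<Longrightarrow> P d H \<Longrightarrow> P d (\<lambda>v. F v + H v)"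
    and "\<And>d e F H. P d F \<Longrightarrow> P e H \<Longrightarrow> P (d + e) (\<lambda>v. F v * H v)"
  shows "P d F"
proof -
  have "(d, F) \<in> hpoly_graded n" using assms(1) by (simp add: hpoly_def)
  then show ?thesis
    by (induction d F rule: hpoly_graded.induct) (use assms(2-) in auto)
qed

lemma hpoly_scale: "F \<in> hpoly n d \<Longrightarrow> F (\<lambda>i. c * v i) = c ^ d * F v"
  by (induction rule: hpoly_induct) (auto simp: algebra_simps power_add)

lemma hpoly_tendsto:
  assumes "F \<in> hpoly n d" "\<And>i. ((\<lambda>k. v k i) \<longlongrightarrow> x i) net"
  shows "((\<lambda>k. F (v k)) \<longlongrightarrow> F x) net"
  using assms(1) by (induction rule: hpoly_induct) (auto intro: tendsto_intros assms(2))

section \<open>Points of projective space and Zariski closed sets\<close>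

definition line_of :: "hvec \<Rightarrow> hvec set" where
  "line_of v = {\<lambda>i. c * v i | c. c \<noteq> 0}"

lemma line_of_scale: "c \<noteq> 0 \<Longrightarrow> line_of (\<lambda>i. c * v i) = line_of v"
proof -
  assume c: "c \<noteq> 0"
  have "\<exists>b. (\<lambda>i. a * v i) = (\<lambda>i. b * (c * v i)) \<and> b \<noteq> 0" if "a \<noteq> 0" for a
    using that c by (intro exI[of _ "a / c"]) auto
  moreover have "\<exists>b. (\<lambda>i. a * (c * v i)) = (\<lambda>i. b * v i) \<and> b \<noteq> 0" if "a \<noteq> 0" for a
    using that c by (intro exI[of _ "a * c"]) auto
  ultimately show ?thesis unfolding line_of_def by auto
qed

lemma line_of_refl: "v \<in> line_of v"
  unfolding line_of_def by (rule CollectI, rule exI[of _ 1]) simp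

lemma line_of_sym: "w \<in> line_of v \<Longrightarrow> v \<in> line_of w"
  using line_of_scale line_of_refl unfolding line_of_def[of v] by fastforce

lemma projective_closed_saturated:
  assumes "A \<in> projective_closed_sets n" "v \<in> A" "w \<in> line_of v"
  shows "w \<in> A"
proof -
  obtain S where S: "S \<subseteq> (\<Union>d. hpoly n d)" "A = {v \<in> homogeneous_coords n. \<forall>F\<in>S. F v = 0}"
    using assms(1) by (auto simp: projective_closed_sets_def)
  obtain c where c: "c \<noteq> 0" "w = (\<lambda>i. c * v i)" using assms(3) by (auto simp: line_of_def)
  have "F w = 0" if F: "F \<in> S" for F
  proof -
    obtain d where "F \<in> hpoly n d" using S F by auto
    then show ?thesis using hpoly_scale[of F n d c v] assms(2) that by (simp add: S c)
  qed
  then show ?thesis using assms(2) c by (auto simp: S homogeneous_coords_def)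
qed

lemma projective_closed_Un:
  assumes "A \<in> projective_closed_sets n" "B \<in> projective_closed_sets n"
  shows "A \<union> B \<in> projective_closed_sets n"
proof -
  obtain S where S: "S \<subseteq> (\<Union>d. hpoly n d)" "A = {v \<in> homogeneous_coords n. \<forall>F\<in>S. F v = 0}"
    using assms(1) by (auto simp: projective_closed_sets_def)
  obtain T where T: "T \<subseteq> (\<Union>d. hpoly n d)" "B = {v \<in> homogeneous_coords n. \<forall>F\<in>T. F v = 0}"
    using assms(2) by (auto simp: projective_closed_sets_def)
  let ?U = "{\<lambda>v. F v * H v | F H. F \<in> S \<and> H \<in> T}"
  have "?U \<subseteq> (\<Union>d. hpoly n d)"
    using S(1) T(1) hpoly_mult by fastforce
  moreover have "A \<union> B = {v \<in> homogeneous_coords n. \<forall>F\<in>?U. F v = 0}"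
    unfolding S T by fastforce
  ultimately show ?thesis unfolding projective_closed_sets_def by blast
qed

lemma line_of_closed:
  assumes "v \<in> homogeneous_coords n"
  shows "line_of v \<in> projective_closed_sets n"
proof -
  \<comment> \<open>The 2 by 2 minors of the pair (v, u) all vanish exactly when u is proportional
    to v.\<close>
  let ?S = "{\<lambda>u. v j * u i - v i * u j | i j. i \<le> n \<and> j \<le> n}"
  have "?S \<subseteq> (\<Union>d. hpoly n d)"
    using hpoly_diff[OF hpoly_cmult[OF hpoly_coord] hpoly_cmult[OF hpoly_coord]] by blast
  moreover have "line_of v = {u \<in> homogeneous_coords n. \<forall>F\<in>?S. F u = 0}"
  proof (rule equalityI; rule subsetI)
    fix u assume "u \<in> line_of v"
    then show "u \<in> {u \<in> homogeneous_coords n. \<forall>F\<in>?S. F u = 0}"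
      using assms by (auto simp: line_of_def homogeneous_coords_def)
  next
    fix u assume u: "u \<in> {u \<in> homogeneous_coords n. \<forall>F\<in>?S. F u = 0}"
    obtain j where j: "v j \<noteq> 0" "j \<le> n"
      using assms by (auto simp: homogeneous_coords_def) (meson not_le)
    have eq: "v j * u i = v i * u j" if "i \<le> n" for i
    proof -
      have "(\<lambda>u. v j * u i - v i * u j) \<in> ?S" using that j by blast
      moreover have "\<forall>F\<in>?S. F u = 0" using CollectD[OF u] by (rule conjunct2)
      ultimately have "v j * u i - v i * u j = 0" by (rule bspec[rotated])
      then show ?thesis by simp
    qed
    have *: "u i = u j / v j * v i" for i
    proof (cases "i \<le> n")
      case True
      then show ?thesis using eq[OF True] j by (simp add: field_simps)
    next
      case False
      then show ?thesis using u assms by (auto simp: homogeneous_coords_def)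
    qed
    have "\<exists>i. u i \<noteq> 0" using u by (auto simp: homogeneous_coords_def)
    then have "u j / v j \<noteq> 0" using * by (metis mult_zero_left)
    then show "u \<in> line_of v" using * unfolding line_of_def by blast
  qed
  ultimately show ?thesis unfolding projective_closed_sets_def by blast
qed


section \<open>The projective quartic\<close>

text \<open>Coordinate 0 is the homogenizing one: w = 1 gives the affine points, w = 0 the line at
  infinity.\<close>

definition hpoint :: "complex \<Rightarrow> complex \<Rightarrow> complex \<Rightarrow> hvec" where
  "hpoint w x y = (\<lambda>i. if i = 0 then w else if i = 1 then x else if i = 2 then y else 0)"

lemma hpoint_nth [simp]: "hpoint w x y 0 = w" "hpoint w x y (Suc 0) = x" "hpoint w x y 2 = y"
  by (simp_all add: hpoint_def)

lemma scale_hpoint: "(\<lambda>i. c * hpoint w x y i) = hpoint (c * w) (c * x) (c * y)"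
  by (auto simp: hpoint_def)

lemma hpoint_homogeneous_coords: "hpoint w x y \<in> homogeneous_coords 2 \<longleftrightarrow> w \<noteq> 0 \<or> x \<noteq> 0 \<or> y \<noteq> 0"
proof -
  have "(\<exists>i. hpoint w x y i \<noteq> 0) \<longleftrightarrow> w \<noteq> 0 \<or> x \<noteq> 0 \<or> y \<noteq> 0"
  proof
    assume "w \<noteq> 0 \<or> x \<noteq> 0 \<or> y \<noteq> 0"
    then have "hpoint w x y 0 \<noteq> 0 \<or> hpoint w x y 1 \<noteq> 0 \<or> hpoint w x y 2 \<noteq> 0" by simp
    then show "\<exists>i. hpoint w x y i \<noteq> 0" by blast
  qed (auto simp: hpoint_def split: if_splits)
  then show ?thesis by (auto simp: homogeneous_coords_def hpoint_def)
qed

lemma homogeneous_coords_2: "v \<in> homogeneous_coords 2 \<Longrightarrow> v = hpoint (v 0) (v 1) (v 2)"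
proof
  fix i assume "v \<in> homogeneous_coords 2"
  then have "v i = 0" if "i > 2" using that by (auto simp: homogeneous_coords_def)
  moreover consider "i = 0" | "i = 1" | "i = 2" | "i > 2" by linarith
  ultimately show "v i = hpoint (v 0) (v 1) (v 2) i" by cases (auto simp: hpoint_def)
qed

lemma polyfun2_hpoly:
  assumes "F \<in> hpoly 2 d"
  shows "polyfun2 (\<lambda>x y. F (hpoint 1 x y))"
  using assms
proof (induction rule: hpoly_induct)
  case (coord i)
  then consider "i = 0" | "i = 1" | "i = 2" by linarith
  then show ?case by cases (simp_all add: polyfun2_intros)
qed (auto intro: polyfun2_intros)

definition quartic_form :: "hvec \<Rightarrow> complex" where
  "quartic_form v = v 2 ^ 4 - v 1 ^ 3 * v 2 - 3 * (v 2 ^ 2 * v 0 ^ 2) + 2 * (v 1 * v 2 * v 0 ^ 2) + v 0 ^ 4"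

definition quartic_curve :: "hvec set" where
  "quartic_curve = {v \<in> homogeneous_coords 2. quartic_form v = 0}"

lemma hpoly_2_coord_power:
  "(\<lambda>v. v 0 ^ m) \<in> hpoly 2 m" "(\<lambda>v. v 1 ^ m) \<in> hpoly 2 m" "(\<lambda>v. v 2 ^ m) \<in> hpoly 2 m"
  using hpoly_power[OF hpoly_coord, of _ 2 m] by auto

lemma hpoly_quartic_form: "quartic_form \<in> hpoly 2 4"
proof -
  have 1: "(\<lambda>v. v 2 ^ 4) \<in> hpoly 2 4" "(\<lambda>v. v 0 ^ 4) \<in> hpoly 2 4"
    by (rule hpoly_2_coord_power)+
  have 2: "(\<lambda>v. v 1 ^ 3 * v 2) \<in> hpoly 2 4"
    using hpoly_mult[OF hpoly_2_coord_power(2)[of 3] hpoly_coord[of 2 2]] by simp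
  have 3: "(\<lambda>v. 3 * (v 2 ^ 2 * v 0 ^ 2)) \<in> hpoly 2 4"
    using hpoly_cmult[OF hpoly_mult[OF hpoly_2_coord_power(3)[of 2] hpoly_2_coord_power(1)[of 2]], of 3] by simp
  have 4: "(\<lambda>v. 2 * (v 1 * v 2 * v 0 ^ 2)) \<in> hpoly 2 4"
    using hpoly_cmult[OF hpoly_mult[OF hpoly_mult[OF hpoly_coord[of 1 2] hpoly_coord[of 2 2]] hpoly_2_coord_power(1)[of 2]], of 2]
    by (simp add: numeral_eq_Suc)
  have "(\<lambda>v. v 2 ^ 4 - v 1 ^ 3 * v 2 - 3 * (v 2 ^ 2 * v 0 ^ 2) + 2 * (v 1 * v 2 * v 0 ^ 2) + v 0 ^ 4) \<in> hpoly 2 4"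
    by (intro hpoly_add hpoly_diff 1 2 3 4)
  then show ?thesis by (simp add: quartic_form_def[abs_def])
qed

lemma quartic_curve_closed: "quartic_curve \<in> projective_closed_sets 2"
  unfolding projective_closed_sets_def quartic_curve_def
  using hpoly_quartic_form by (intro CollectI exI[of _ "{quartic_form}"]) auto

lemma quartic_form_hpoint: "quartic_form (hpoint 1 x y) = quartic x y"
  by (simp add: quartic_form_def quartic_def)

lemma quartic_curve_affine: "hpoint 1 x y \<in> quartic_curve \<longleftrightarrow> quartic x y = 0"
  by (simp add: quartic_curve_def hpoint_homogeneous_coords quartic_form_hpoint)

text \<open>On v 0 = 0 the form reduces to y^4 - x^3 y, and x = 0 would force y = 0 too. So x can be
  scaled to 1, and the points at infinity are given by \<eta> = 0 and the three cube roots of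
  unity.\<close>

lemma quartic_curve_cases:
  assumes "v \<in> quartic_curve"
  obtains (affine) c x y where "c \<noteq> 0" "v = (\<lambda>i. c * hpoint 1 x y i)" "quartic x y = 0"
  | (infinite) c \<eta> where "c \<noteq> 0" "v = (\<lambda>i. c * hpoint 0 1 \<eta> i)" "\<eta> ^ 4 = \<eta>"
proof (cases "v 0 = 0")
  case False
  have v: "v = (\<lambda>i. v 0 * hpoint 1 (v 1 / v 0) (v 2 / v 0) i)"
    unfolding scale_hpoint using False assms homogeneous_coords_2[of v]
    by (simp add: quartic_curve_def)
  have "quartic_form (\<lambda>i. v 0 * hpoint 1 (v 1 / v 0) (v 2 / v 0) i) = 0"
    using assms v by (simp add: quartic_curve_def)
  then have "quartic (v 1 / v 0) (v 2 / v 0) = 0"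
    using hpoly_scale[OF hpoly_quartic_form] False by (simp add: quartic_form_hpoint)
  then show ?thesis using affine False v by blast
next
  case True
  have eq: "v 2 ^ 4 = v 1 ^ 3 * v 2"
    using assms True by (simp add: quartic_curve_def quartic_form_def)
  have "v 1 \<noteq> 0"
  proof
    assume "v 1 = 0"
    then have "v 2 = 0" using eq by simp
    then have "v = hpoint 0 0 0"
      using assms homogeneous_coords_2[of v] True \<open>v 1 = 0\<close> by (simp add: quartic_curve_def)
    then show False using assms hpoint_homogeneous_coords[of 0 0 0] by (simp add: quartic_curve_def)
  qed
  have v: "v = (\<lambda>i. v 1 * hpoint 0 1 (v 2 / v 1) i)"
    unfolding scale_hpoint using True \<open>v 1 \<noteq> 0\<close> assms homogeneous_coords_2[of v]
    by (simp add: quartic_curve_def)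
  have "(v 2 / v 1) ^ 4 = v 2 / v 1"
    using eq \<open>v 1 \<noteq> 0\<close> by (simp add: field_simps power_numeral_reduce)
  then show ?thesis using infinite \<open>v 1 \<noteq> 0\<close> v by blast
qed

text \<open>The value of a monic polynomial at \<eta> is the product of the differences between
  \<eta> and its roots. Read backwards: a small value at \<eta> forces a root close to
  \<eta>.\<close>

lemma monic_poly_lower_bound:
  fixes p :: "complex poly"
  assumes "lead_coeff p = 1" "\<And>y. poly p y = 0 \<Longrightarrow> norm (\<eta> - y) \<ge> e" "e \<ge> 0"
  shows "norm (poly p \<eta>) \<ge> e ^ degree p"
  using assms(1,2)
proof (induction "degree p" arbitrary: p)
  case 0
  then obtain c where "p = [:c:]" by (metis degree_eq_zeroE)
  then show ?case using 0 by simp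
next
  case (Suc n)
  then obtain r where r: "poly p r = 0"
    using fundamental_theorem_of_algebra constant_degree by (metis nat.simps(3))
  then obtain q where q: "p = [:-r, 1:] * q"
    unfolding poly_eq_0_iff_dvd by blast
  have "q \<noteq> 0" using q Suc.prems(1) by auto
  then have deg: "degree p = Suc (degree q)"
    unfolding q by (subst degree_mult_eq) auto
  have lead: "lead_coeff q = 1" using Suc.prems(1) unfolding q lead_coeff_mult by simp
  have "e ^ degree q \<le> norm (poly q \<eta>)"
    using Suc.hyps(1)[of q] Suc.hyps(2) deg lead Suc.prems(2) q by auto
  then have "e * e ^ degree q \<le> norm (\<eta> - r) * norm (poly q \<eta>)"
    using Suc.prems(2)[OF r] assms(3) by (intro mult_mono) auto
  then show ?case
    unfolding deg by (simp add: q norm_mult[symmetric] algebra_simps)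
qed

text \<open>Continuity of roots: on w = 1/(k+1), x = 1 the form is a monic quartic in y that tends
  to y^4 - y, of which \<eta> is a root, so it has roots tending to \<eta>.\<close>

lemma quartic_near_infinity:
  assumes "\<eta> ^ 4 = \<eta>"
  obtains w y :: "nat \<Rightarrow> complex"
  where "\<And>k. w k \<noteq> 0" "w \<longlonglongrightarrow> 0" "y \<longlonglongrightarrow> \<eta>" "\<And>k. quartic_form (hpoint (w k) 1 (y k)) = 0"
proof -
  define w :: "nat \<Rightarrow> complex" where "w k = of_real (inverse (real (Suc k)))" for k
  \<comment> \<open>\<open>p k\<close> is the form at (w k : 1 : y) as a polynomial in y. The radius
    \<open>e k\<close> below is the fourth root of its absolute value at \<eta> plus a positive null
    sequence; the added term turns the lower bound for root-free discs into a contradiction.\<close>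
  define p where "p k = [:w k ^ 4, 2 * w k ^ 2 - 1, - 3 * w k ^ 2, 0, 1:]" for k
  define e where "e k = root 4 (norm (poly (p k) \<eta>) + inverse (real (Suc k)))" for k
  have w0: "w k \<noteq> 0" for k by (simp add: w_def del: of_nat_Suc)
  have inv0: "(\<lambda>k. inverse (real (Suc k))) \<longlonglongrightarrow> 0"
    by (rule LIMSEQ_inverse_real_of_nat)
  then have w: "w \<longlonglongrightarrow> 0"
    using tendsto_of_real[OF inv0, where 'a = complex] by (simp add: w_def[abs_def])
  have "poly (p k) \<eta> = w k ^ 4 + 2 * \<eta> * w k ^ 2 - 3 * \<eta> ^ 2 * w k ^ 2 + (\<eta> ^ 4 - \<eta>)" for k
    by (simp add: p_def algebra_simps power_numeral_reduce)
  then have "poly (p k) \<eta> = w k ^ 4 + 2 * \<eta> * w k ^ 2 - 3 * \<eta> ^ 2 * w k ^ 2" for k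
    using assms by simp
  moreover have "(\<lambda>k. w k ^ 4 + 2 * \<eta> * w k ^ 2 - 3 * \<eta> ^ 2 * w k ^ 2) \<longlonglongrightarrow> 0 ^ 4 + 2 * \<eta> * 0 ^ 2 - 3 * \<eta> ^ 2 * 0 ^ 2"
    by (intro tendsto_intros w)
  ultimately have "(\<lambda>k. poly (p k) \<eta>) \<longlonglongrightarrow> 0" by simp
  then have "(\<lambda>k. norm (poly (p k) \<eta>) + inverse (real (Suc k))) \<longlonglongrightarrow> 0 + 0"
    by (intro tendsto_add inv0) (rule tendsto_norm_zero)
  then have e0: "e \<longlonglongrightarrow> 0"
    using tendsto_real_root[of _ "0 + 0" sequentially 4] unfolding e_def[abs_def] by simp
  have "\<exists>y. poly (p k) y = 0 \<and> norm (\<eta> - y) < e k" for k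
  proof (rule ccontr)
    assume "\<not> (\<exists>y. poly (p k) y = 0 \<and> norm (\<eta> - y) < e k)"
    moreover have pos: "norm (poly (p k) \<eta>) + inverse (real (Suc k)) > 0"
      by (intro add_nonneg_pos) auto
    ultimately have "e k ^ degree (p k) \<le> norm (poly (p k) \<eta>)"
      by (intro monic_poly_lower_bound) (auto simp: p_def e_def not_less)
    moreover have "degree (p k) = 4" by (simp add: p_def)
    moreover have "e k ^ 4 = norm (poly (p k) \<eta>) + inverse (real (Suc k))"
      unfolding e_def using pos by (intro real_root_pow_pos2) auto
    ultimately have "inverse (real (Suc k)) \<le> 0" by simp
    then show False by simp
  qed
  then obtain y where y: "\<And>k. poly (p k) (y k) = 0" "\<And>k. norm (\<eta> - y k) < e k"
    by metis
  have "(\<lambda>k. \<eta> - y k) \<longlonglongrightarrow> 0"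
    by (rule Lim_null_comparison[OF _ e0]) (use y(2) in \<open>auto intro: always_eventually less_imp_le\<close>)
  then have "y \<longlonglongrightarrow> \<eta>"
    using tendsto_diff[OF tendsto_const[of \<eta>], of "\<lambda>k. \<eta> - y k" 0 sequentially] by simp
  moreover have "quartic_form (hpoint (w k) 1 (y k)) = 0" for k
    using y(1)[of k] by (simp add: quartic_form_def p_def algebra_simps power_numeral_reduce)
  ultimately show ?thesis using that w0 w by blast
qed

section \<open>Irreducibility of the projective quartic\<close>

lemma hpoint_tendsto:
  assumes "(w \<longlongrightarrow> a) net" "(x \<longlongrightarrow> b) net" "(y \<longlongrightarrow> c) net"
  shows "((\<lambda>k. hpoint (w k) (x k) (y k) i) \<longlongrightarrow> hpoint a b c i) net"
  using assms by (simp add: hpoint_def)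

text \<open>Each point at infinity is a limit of affine points of the curve by
  \<open>quartic_near_infinity\<close>, and forms are continuous. So the affine part is dense enough
  to detect whether a form vanishes on the whole curve.\<close>

lemma quartic_curve_vanish:
  assumes F: "F \<in> hpoly 2 d" and zero: "\<And>x y. quartic x y = 0 \<Longrightarrow> F (hpoint 1 x y) = 0"
    and "v \<in> quartic_curve"
  shows "F v = 0"
  using assms(3)
proof (cases rule: quartic_curve_cases)
  case (affine c x y)
  then show ?thesis using hpoly_scale[OF F] zero by simp
next
  case (infinite c \<eta>)
  obtain w y where wy: "\<And>k. w k \<noteq> 0" "w \<longlonglongrightarrow> 0" "y \<longlonglongrightarrow> \<eta>"
      "\<And>k. quartic_form (hpoint (w k) 1 (y k)) = 0"
    using quartic_near_infinity[OF infinite(3)] by blast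
  have "F (hpoint (w k) 1 (y k)) = 0" for k
  proof -
    have eq: "hpoint (w k) 1 (y k) = (\<lambda>i. w k * hpoint 1 (1 / w k) (y k / w k) i)"
      unfolding scale_hpoint using wy(1) by simp
    have "quartic (1 / w k) (y k / w k) = 0"
      using wy(4)[of k] wy(1)[of k] unfolding eq hpoly_scale[OF hpoly_quartic_form] quartic_form_hpoint by simp
    then show ?thesis unfolding eq hpoly_scale[OF F] using zero by simp
  qed
  moreover have "(\<lambda>k. F (hpoint (w k) 1 (y k))) \<longlonglongrightarrow> F (hpoint 0 1 \<eta>)"
    by (rule hpoly_tendsto[OF F hpoint_tendsto]) (use wy in auto)
  ultimately have "(\<lambda>k::nat. 0) \<longlonglongrightarrow> F (hpoint 0 1 \<eta>)" by simp
  then have "F (hpoint 0 1 \<eta>) = 0" by (simp add: LIMSEQ_const_iff)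
  then show ?thesis unfolding infinite(2) hpoly_scale[OF F] by simp
qed

text \<open>A form that is nonzero somewhere on the curve is, by
  \<open>quartic_curve_vanish\<close>, nonzero somewhere on the affine part, hence has finitely many
  zeros there; infinity adds only finitely many points.\<close>

lemma irreducible_curve_quartic: "irreducible_curve (projective_closed_sets 2) quartic_curve"
proof (rule irreducible_curveI[where E = line_of])
  show "quartic_curve \<in> projective_closed_sets 2" by (rule quartic_curve_closed)
  show "line_of v \<in> projective_closed_sets 2" if "v \<in> quartic_curve" for v
    using that by (intro line_of_closed) (simp add: quartic_curve_def)
  show "finite (line_of ` (A \<inter> quartic_curve))"
    if A: "A \<in> projective_closed_sets 2" "\<not> quartic_curve \<subseteq> A" for A
  proof -
    obtain S where S: "S \<subseteq> (\<Union>d. hpoly 2 d)" "A = {v \<in> homogeneous_coords 2. \<forall>F\<in>S. F v = 0}"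
      using A(1) by (auto simp: projective_closed_sets_def)
    obtain v where v: "v \<in> quartic_curve" "v \<notin> A" using A(2) by auto
    then obtain F where F: "F \<in> S" "F v \<noteq> 0" by (auto simp: S quartic_curve_def)
    then obtain d where d: "F \<in> hpoly 2 d" using S by auto
    have fin: "finite {(x, y). quartic x y = 0 \<and> F (hpoint 1 x y) = 0}"
      using quartic_zeros_finite_or_all[OF polyfun2_hpoly[OF d]] quartic_curve_vanish[OF d _ v(1)] F(2)
      by blast
    have "{\<eta> :: complex. \<eta> ^ 4 = \<eta>} = {\<eta>. poly [:0, -1, 0, 0, 1:] \<eta> = 0}"
      by (simp add: algebra_simps power_numeral_reduce)
    then have fin': "finite {\<eta> :: complex. \<eta> ^ 4 = \<eta>}"
      by (simp only:) (rule poly_roots_finite, simp)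
    have "line_of ` (A \<inter> quartic_curve) \<subseteq>
        (\<lambda>(x, y). line_of (hpoint 1 x y)) ` {(x, y). quartic x y = 0 \<and> F (hpoint 1 x y) = 0}
        \<union> (\<lambda>\<eta>. line_of (hpoint 0 1 \<eta>)) ` {\<eta>. \<eta> ^ 4 = \<eta>}" (is "_ \<subseteq> ?L")
    proof
      fix l assume "l \<in> line_of ` (A \<inter> quartic_curve)"
      then obtain u where u: "u \<in> A" "u \<in> quartic_curve" "l = line_of u" by auto
      from u(2) show "l \<in> ?L"
      proof (cases rule: quartic_curve_cases)
        case (affine c x y)
        have "F u = 0" using u(1) F(1) by (auto simp: S)
        then have "F (hpoint 1 x y) = 0" using affine hpoly_scale[OF d] by simp
        then show ?thesis using affine u(3) line_of_scale by auto
      next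
        case (infinite c \<eta>)
        then show ?thesis using u(3) line_of_scale by auto
      qed
    qed
    then show ?thesis using fin fin' finite_subset by blast
  qed
  show "infinite (line_of ` quartic_curve)"
  proof
    assume fin: "finite (line_of ` quartic_curve)"
    have "inj (\<lambda>(x, y). line_of (hpoint 1 x y))"
    proof (rule injI, clarify)
      fix x y x' y' assume "line_of (hpoint 1 x y) = line_of (hpoint 1 x' y')"
      then have "hpoint 1 x y \<in> line_of (hpoint 1 x' y')" using line_of_refl by metis
      then obtain c where c: "hpoint 1 x y = hpoint c (c * x') (c * y')"
        by (auto simp: line_of_def scale_hpoint)
      show "x = x' \<and> y = y'"
        using fun_cong[OF c, of 0] fun_cong[OF c, of 1] fun_cong[OF c, of 2] by simp
    qed
    then have "infinite ((\<lambda>(x, y). line_of (hpoint 1 x y)) ` {(x, y). quartic x y = 0})"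
      using infinite_quartic_zeros finite_imageD inj_on_subset by blast
    moreover have "(\<lambda>(x, y). line_of (hpoint 1 x y)) ` {(x, y). quartic x y = 0} \<subseteq> line_of ` quartic_curve"
      using quartic_curve_affine by auto
    ultimately show False using fin finite_subset by blast
  qed
qed (auto intro: projective_closed_Un line_of_refl line_of_sym projective_closed_saturated)

text \<open>The kernel of a nonzero functional on a three-dimensional space is a plane, so one
  vector besides (x, y, z) spans it. Since a is nonzero, p is determined by q and r, and only these
  two coordinates have to be matched.\<close>

lemma kernel_of_functional:
  fixes a b c x y z :: complex
  assumes "a \<noteq> 0" "a * x + b * y + c * z = 0" "x \<noteq> 0 \<or> y \<noteq> 0 \<or> z \<noteq> 0"
  shows "\<exists>u v w. \<forall>p q r. a * p + b * q + c * r = 0 \<longrightarrow>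
           (\<exists>s t. p = s * x + t * u \<and> q = s * y + t * v \<and> r = s * z + t * w)"
proof -
  have *: "p = s * x + t" if "a * p + b * q + c * r = 0" "b * q + c * r = s * (b * y + c * z) - a * t"
    for p q r s t
  proof -
    have "a * p = a * (s * x + t)"
      using that assms(2) by algebra
    then show ?thesis using assms(1) by simp
  qed
  show ?thesis
  proof (cases "y = 0")
    case False
    have "\<exists>s t. p = s * x + t * (- c / a) \<and> q = s * y + t * 0 \<and> r = s * z + t * 1"
      if eq: "a * p + b * q + c * r = 0" for p q r
    proof -
      define s where "s = q / y"
      have q: "q = s * y" using False by (simp add: s_def)
      have "p = s * x + (r - s * z) * (- c / a)"
        by (rule *[OF eq]) (use assms(1) in \<open>simp add: q algebra_simps\<close>)
      then show ?thesis using q by - (rule exI[of _ s], rule exI[of _ "r - s * z"], simp)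
    qed
    then show ?thesis by blast
  next
    case True
    \<comment> \<open>With y = z = 0 the equation would read a * x = 0 and make x vanish as
      well.\<close>
    then have z: "z \<noteq> 0" using assms by auto
    have "\<exists>s t. p = s * x + t * (- b / a) \<and> q = s * y + t * 1 \<and> r = s * z + t * 0"
      if eq: "a * p + b * q + c * r = 0" for p q r
    proof -
      define s where "s = r / z"
      have r: "r = s * z" using z by (simp add: s_def)
      have "p = s * x + (q - s * y) * (- b / a)"
        by (rule *[OF eq]) (use assms(1) in \<open>simp add: r algebra_simps\<close>)
      then show ?thesis using r by - (rule exI[of _ s], rule exI[of _ "q - s * y"], simp)
    qed
    then show ?thesis by blast
  qed
qed

text \<open>The Jacobian criterion: the first three hypotheses say that the partial derivatives of
  \<open>quartic_form\<close> by v 1, v 2 and v 0 vanish at (w : x : y), the last one that the form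
  itself does.\<close>

lemma quartic_smooth:
  fixes w x y :: complex
  assumes "y * (2 * w^2 - 3 * x^2) = 0" "4 * y^3 - x^3 - 6 * y * w^2 + 2 * x * w^2 = 0"
    "2 * w * (2 * w^2 - 3 * y^2 + 2 * x * y) = 0" "y^4 - x^3 * y - 3 * (y^2 * w^2) + 2 * (x * y * w^2) + w^4 = 0"
  shows "w = 0 \<and> x = 0 \<and> y = 0"
proof (cases "y = 0")
  case True
  then show ?thesis using assms by simp
next
  case False
  then have x2: "2 * w^2 = 3 * x^2" using assms(1) by simp
  show ?thesis
  proof (cases "w = 0")
    case True
    then show ?thesis using x2 assms(4) by simp
  next
    case w: False
    then have y2: "2 * w^2 - 3 * y^2 + 2 * x * y = 0" using assms(3) by simp
    have 1: "3 * y^4 - 3 * y^2 * w^2 - w^4 = 0"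
      using x2 y2 assms(4) by algebra
    \<comment> \<open>Square 2 * x * y = 3 * y^2 - 2 * w^2 and replace x^2 by 2/3 * w^2. Both
      relations 1 and 2 are then free of x, and the second minus nine times the first
      factors.\<close>
    have 2: "27 * y^4 - 44 * y^2 * w^2 + 12 * w^4 = 0"
      using x2 y2 by algebra
    have "w^2 * (21 * w^2 - 17 * y^2) = 0"
      using 1 2 by algebra
    then have "21 * w^2 = 17 * y^2" using w by simp
    then have "w^4 = 0" using 1 by algebra
    then show ?thesis using w by simp
  qed
qed

text \<open>A tangent vector of the cone is annihilated by the gradient (a, b, c) of the form. The
  gradient is nonzero by \<open>quartic_smooth\<close>, and by Euler's identity its kernel contains
  v, so \<open>kernel_of_functional\<close> gives the required second vector.\<close>

lemma smooth_quartic_curve: "smooth_projective_curve 2 quartic_curve"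
  unfolding smooth_projective_curve_def
proof (intro conjI ballI irreducible_curve_quartic)
  fix v assume v: "v \<in> quartic_curve"
  define a where "a = 2 * v 0 * (2 * v 0^2 - 3 * v 2^2 + 2 * v 1 * v 2)"
  define b where "b = v 2 * (2 * v 0^2 - 3 * v 1^2)"
  define c where "c = 4 * v 2^3 - v 1^3 - 6 * v 2 * v 0^2 + 2 * v 1 * v 0^2"
  have vh: "v \<in> homogeneous_coords 2" and q: "quartic_form v = 0"
    using v by (auto simp: quartic_curve_def)
  have euler: "a * v 0 + b * v 1 + c * v 2 = 0"
    using q unfolding a_def b_def c_def quartic_form_def by algebra
  have v0: "v 0 \<noteq> 0 \<or> v 1 \<noteq> 0 \<or> v 2 \<noteq> 0"
    using vh hpoint_homogeneous_coords homogeneous_coords_2 by metis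
  have grad: "a \<noteq> 0 \<or> b \<noteq> 0 \<or> c \<noteq> 0"
    using quartic_smooth[of "v 2" "v 0" "v 1"] v0 q unfolding a_def b_def c_def quartic_form_def
    by blast
  have "\<exists>u0 u1 u2. \<forall>p q r. a * p + b * q + c * r = 0 \<longrightarrow>
      (\<exists>s t. p = s * v 0 + t * u0 \<and> q = s * v 1 + t * u1 \<and> r = s * v 2 + t * u2)"
  proof -
    \<comment> \<open>\<open>kernel_of_functional\<close> wants its first coefficient nonzero; the
      other two cases rotate the coordinates cyclically.\<close>
    consider "a \<noteq> 0" | "b \<noteq> 0" | "c \<noteq> 0" using grad by blast
    then show ?thesis
    proof cases
      case 1
      from kernel_of_functional[OF 1 euler v0] show ?thesis .
    next
      case 2
      have "b * v 1 + c * v 2 + a * v 0 = 0" "v 1 \<noteq> 0 \<or> v 2 \<noteq> 0 \<or> v 0 \<noteq> 0"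
        using euler v0 by (auto simp: algebra_simps)
      from kernel_of_functional[OF 2 this] obtain u1 u2 u0 where
        u: "\<forall>q r p. b * q + c * r + a * p = 0 \<longrightarrow>
           (\<exists>s t. q = s * v 1 + t * u1 \<and> r = s * v 2 + t * u2 \<and> p = s * v 0 + t * u0)" by blast
      show ?thesis
      proof (rule exI[of _ u0], rule exI[of _ u1], rule exI[of _ u2], intro allI impI)
        fix p q r assume "a * p + b * q + c * r = 0"
        then have "b * q + c * r + a * p = 0" by (simp add: add.commute add.left_commute)
        then show "\<exists>s t. p = s * v 0 + t * u0 \<and> q = s * v 1 + t * u1 \<and> r = s * v 2 + t * u2"
          using u by blast
      qed
    next
      case 3
      have "c * v 2 + a * v 0 + b * v 1 = 0" "v 2 \<noteq> 0 \<or> v 0 \<noteq> 0 \<or> v 1 \<noteq> 0"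
        using euler v0 by (auto simp: algebra_simps)
      from kernel_of_functional[OF 3 this] obtain u2 u0 u1 where
        u: "\<forall>r p q. c * r + a * p + b * q = 0 \<longrightarrow>
           (\<exists>s t. r = s * v 2 + t * u2 \<and> p = s * v 0 + t * u0 \<and> q = s * v 1 + t * u1)" by blast
      show ?thesis
      proof (rule exI[of _ u0], rule exI[of _ u1], rule exI[of _ u2], intro allI impI)
        fix p q r assume "a * p + b * q + c * r = 0"
        then have "c * r + a * p + b * q = 0" by (simp add: add.commute add.left_commute)
        then show "\<exists>s t. p = s * v 0 + t * u0 \<and> q = s * v 1 + t * u1 \<and> r = s * v 2 + t * u2"
          using u by blast
      qed
    qed
  qed
  then obtain u0 u1 u2 where u: "\<And>p q r. a * p + b * q + c * r = 0 \<Longrightarrow>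
      (\<exists>s t. p = s * v 0 + t * u0 \<and> q = s * v 1 + t * u1 \<and> r = s * v 2 + t * u2)" by blast
  show "\<exists>u. \<forall>w\<in>cone_tangent_space 2 quartic_curve v. \<exists>s t. w = (\<lambda>i. s * v i + t * u i)"
  proof (intro exI[of _ "hpoint u0 u1 u2"] ballI)
    fix w assume w: "w \<in> cone_tangent_space 2 quartic_curve v"
    have "deriv (\<lambda>t. quartic_form (\<lambda>i. v i + t * w i)) 0 = 0"
      using w hpoly_quartic_form by (auto simp: cone_tangent_space_def quartic_curve_def)
    moreover have "((\<lambda>t. quartic_form (\<lambda>i. v i + t * w i)) has_field_derivative
        (a * w 0 + b * w 1 + c * w 2)) (at 0)"
      unfolding quartic_form_def a_def b_def c_def
      by (auto intro!: derivative_eq_intros simp: algebra_simps power_numeral_reduce)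
    ultimately have "a * w 0 + b * w 1 + c * w 2 = 0"
      using DERIV_imp_deriv by fastforce
    then obtain s t where st: "w 0 = s * v 0 + t * u0" "w 1 = s * v 1 + t * u1" "w 2 = s * v 2 + t * u2"
      using u by blast
    have "w i = s * v i + t * hpoint u0 u1 u2 i" for i
    proof -
      consider "i = 0" | "i = 1" | "i = 2" | "i > 2" by linarith
      then show ?thesis
      proof cases
        case 4
        then have "w i = 0" "v i = 0"
          using w vh by (auto simp: cone_tangent_space_def homogeneous_coords_def)
        then show ?thesis using 4 by (simp add: hpoint_def)
      qed (use st in \<open>simp_all add: hpoint_def\<close>)
    qed
    then show "\<exists>s t. w = (\<lambda>i. s * v i + t * hpoint u0 u1 u2 i)" by blast
  qed
qed


section \<open>The curve of characters\<close>

text \<open>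
  The relator says \<open>b\<^sup>2a\<^sup>3b\<^sup>2 = ab\<^sup>3a\<close>.  Both sides are palindromes, hence linear combinations of
  \<open>1\<close>, \<open>a\<close>, \<open>b\<close> in \<open>SL(2,C)\<close>; the three equations compare the coefficients, as polynomials in
  \<open>x = tr a\<close>, \<open>y = tr b\<close>, \<open>z = tr ab\<close>.
\<close>

definition char_curve :: "complex \<Rightarrow> complex \<Rightarrow> complex \<Rightarrow> bool" where
  "char_curve x y z \<longleftrightarrow>
     x^2 - 1 = (y^2 - 1) * z - x * y \<and>
     (x^2 - 1) * (z * y^2 - x * y) - x * (y^3 - 2 * y) = y^2 - 1 \<and>
     x * (y^2 - 1) - (x^2 - 1) * z * y = 2 * y - y^3"

definition char_z :: "complex \<Rightarrow> complex \<Rightarrow> complex" where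
  "char_z x y = (x^2 + x * y - 1) / (y^2 - 1)"

text \<open>Eliminating z from the three equations yields x times the quartic, so the case x = 0 is
  treated separately.\<close>

lemma char_curve_quartic:
  assumes "char_curve x y z"
  shows "quartic x y = 0"
proof (cases "x = 0")
  case True
  have "- 1 = (y^2 - 1) * z" "- (z * y^2) = y^2 - 1" "z * y = 2 * y - y^3"
    using assms True by (simp_all add: char_curve_def)
  then have "y^4 - 3 * y^2 + 1 = 0" by algebra
  then show ?thesis using True by (simp add: quartic_def)
next
  case False
  have "x * (y^4 - x^3 * y - 3 * y^2 + 2 * x * y + 1) = 0"
    using assms unfolding char_curve_def by algebra
  then show ?thesis using False by (simp add: quartic_def)
qed

text \<open>Two expressions of z as a fraction in x and y. Their denominators never vanish together,
  so z is determined by x and y at every point, including those with y^2 = 1.\<close>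

lemma char_curve_z:
  assumes "char_curve x y z"
  shows "(y^2 - 1) * z = x^2 + x * y - 1"
    and "((x^2 - 1) * y) * z = x * (y^2 - 1) + y^3 - 2 * y"
    and "y^2 - 1 \<noteq> 0 \<or> (x^2 - 1) * y \<noteq> 0"
proof -
  show 1: "(y^2 - 1) * z = x^2 + x * y - 1"
    using assms unfolding char_curve_def by algebra
  show "((x^2 - 1) * y) * z = x * (y^2 - 1) + y^3 - 2 * y"
    using assms unfolding char_curve_def by algebra
  show "y^2 - 1 \<noteq> 0 \<or> (x^2 - 1) * y \<noteq> 0"
  proof (rule ccontr)
    assume "\<not> ?thesis"
    then have y: "y^2 - 1 = 0" and x: "(x^2 - 1) * y = 0" by auto
    have "x^2 - 1 = - x * y" using 1 y by algebra
    then have "x = 0" using x y by algebra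
    then show False using 1 y by simp
  qed
qed

lemma char_curve_z_unique:
  assumes "char_curve x y z" "char_curve x y z'"
  shows "z = z'"
  using char_curve_z[OF assms(1)] char_curve_z[OF assms(2)] by (metis mult_left_cancel)

lemma char_curve_char_z:
  assumes "quartic x y = 0" "y^2 \<noteq> 1"
  shows "char_curve x y (char_z x y)"
proof -
  define z where "z = char_z x y"
  have ne: "y^2 - 1 \<noteq> 0" using assms(2) by simp
  then have z: "(y^2 - 1) * z = x^2 + x * y - 1"
    by (simp add: z_def char_z_def)
  have q: "y^4 - x^3 * y - 3 * y^2 + 2 * x * y + 1 = 0"
    using assms(1) by (simp add: quartic_def)
  have "(y^2 - 1) * ((x^2 - 1) * (z * y^2 - x * y) - x * (y^3 - 2 * y) - (y^2 - 1)) = 0"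
    using z q by algebra
  then have 2: "(x^2 - 1) * (z * y^2 - x * y) - x * (y^3 - 2 * y) = y^2 - 1"
    using ne by (metis mult_eq_0_iff right_minus_eq)
  have "(y^2 - 1) * (x * (y^2 - 1) - (x^2 - 1) * z * y - (2 * y - y^3)) = 0"
    using z q by algebra
  then have 3: "x * (y^2 - 1) - (x^2 - 1) * z * y = 2 * y - y^3"
    using ne by (metis mult_eq_0_iff right_minus_eq)
  have "x^2 - 1 = (y^2 - 1) * z - x * y" using z by algebra
  then show ?thesis unfolding char_curve_def using 2 3 z_def by blast
qed

text \<open>By the dichotomy for zeros on the quartic, one point of it with y^2 different from 1
  suffices; such a point is found on x = 0, where y^4 - 3 * y^2 + 1 = 0.\<close>

lemma finite_quartic_y2: "finite {(x, y). quartic x y = 0 \<and> y^2 - 1 = 0}"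
proof -
  have "\<exists>y. poly [:1, 0, -3, 0, 1:] y = (0::complex)"
    by (intro fundamental_theorem_of_algebra_alt) auto
  then obtain y :: complex where y: "y^4 - 3 * y^2 + 1 = 0"
    by (auto simp: algebra_simps power_numeral_reduce)
  have "quartic 0 y = 0" using y by (simp add: quartic_def)
  moreover have "y^2 - 1 \<noteq> 0"
  proof
    assume "y^2 - 1 = 0"
    then have "(1::complex) = 0" using y by algebra
    then show False by simp
  qed
  moreover have "polyfun2 (\<lambda>x y. y^2 - 1)" by (intro polyfun2_intros)
  ultimately show ?thesis using quartic_zeros_finite_or_all by blast
qed

lemma infinite_char_curve: "infinite {(x, y). quartic x y = 0 \<and> y^2 \<noteq> 1}"
proof
  assume "finite {(x, y). quartic x y = 0 \<and> y^2 \<noteq> 1}"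
  then have "finite ({(x, y). quartic x y = 0 \<and> y^2 \<noteq> 1} \<union> {(x, y). quartic x y = 0 \<and> y^2 - 1 = 0})"
    using finite_quartic_y2 by simp
  moreover have "{(x, y). quartic x y = 0} \<subseteq>
      {(x, y). quartic x y = 0 \<and> y^2 \<noteq> 1} \<union> {(x, y). quartic x y = 0 \<and> y^2 - 1 = 0}" by auto
  ultimately show False using infinite_quartic_zeros finite_subset by blast
qed

text \<open>Stated for an arbitrary fraction N/D for z, because the two fractions in
  \<open>char_curve_z\<close> are used at different points. Each occurrence of z costs one factor
  D.\<close>

lemma polyfun3_clear_denominator:
  assumes "Q \<in> polyfun3" "polyfun2 D" "polyfun2 N"
    and z: "\<And>x y z. R x y z \<Longrightarrow> D x y * z = N x y"
  shows "\<exists>n f. polyfun2 f \<and> (\<forall>x y z. R x y z \<longrightarrow> D x y ^ n * Q x y z = f x y)"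
  using assms(1)
proof induction
  case (const c)
  show ?case by (rule exI[of _ 0], rule exI[of _ "\<lambda>x y. c"]) (simp add: polyfun2_intros)
next
  case fst
  show ?case by (rule exI[of _ 0], rule exI[of _ "\<lambda>x y. x"]) (simp add: polyfun2_intros)
next
  case snd
  show ?case by (rule exI[of _ 0], rule exI[of _ "\<lambda>x y. y"]) (simp add: polyfun2_intros)
next
  case thd
  show ?case by (rule exI[of _ 1], rule exI[of _ N]) (simp add: assms(3) z)
next
  case (add P Q)
  then obtain n f m h where f: "polyfun2 f" "\<And>x y z. R x y z \<Longrightarrow> D x y ^ n * P x y z = f x y"
    and h: "polyfun2 h" "\<And>x y z. R x y z \<Longrightarrow> D x y ^ m * Q x y z = h x y" by blast
  have "D x y ^ (n + m) * (P x y z + Q x y z) = D x y ^ m * f x y + D x y ^ n * h x y" if "R x y z" for x y z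
    unfolding f(2)[OF that, symmetric] h(2)[OF that, symmetric] by (simp add: power_add algebra_simps)
  moreover have "polyfun2 (\<lambda>x y. D x y ^ m * f x y + D x y ^ n * h x y)"
    by (intro polyfun2_intros assms f h)
  ultimately show ?case by blast
next
  case (mult P Q)
  then obtain n f m h where f: "polyfun2 f" "\<And>x y z. R x y z \<Longrightarrow> D x y ^ n * P x y z = f x y"
    and h: "polyfun2 h" "\<And>x y z. R x y z \<Longrightarrow> D x y ^ m * Q x y z = h x y" by blast
  have "D x y ^ (n + m) * (P x y z * Q x y z) = f x y * h x y" if "R x y z" for x y z
    unfolding f(2)[OF that, symmetric] h(2)[OF that, symmetric] by (simp add: power_add algebra_simps)
  moreover have "polyfun2 (\<lambda>x y. f x y * h x y)"
    by (intro polyfun2_intros f h)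
  ultimately show ?case by blast
qed

lemma finite_zeros_on_char_curve:
  assumes Q: "Q \<in> polyfun3" and pt: "char_curve x0 y0 z0" "Q x0 y0 z0 \<noteq> 0"
  shows "finite {(x, y, z). char_curve x y z \<and> Q x y z = 0}"
proof -
  \<comment> \<open>The denominator is chosen not to vanish at the given point, so that clearing it
    leaves a polynomial in x and y which is still nonzero there.\<close>
  obtain D N where DN: "polyfun2 D" "polyfun2 N" "D x0 y0 \<noteq> 0"
    and z: "\<And>x y z. char_curve x y z \<Longrightarrow> D x y * z = N x y"
  proof (cases "y0^2 - 1 = 0")
    case False
    show ?thesis
      by (rule that[of "\<lambda>x y. y^2 - 1" "\<lambda>x y. x^2 + x * y - 1"])
         (use False char_curve_z(1) in \<open>auto intro!: polyfun2_intros\<close>)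
  next
    case True
    then have "(x0^2 - 1) * y0 \<noteq> 0" using char_curve_z(3)[OF pt(1)] by simp
    show ?thesis
    proof (rule that[of "\<lambda>x y. (x^2 - 1) * y" "\<lambda>x y. x * (y^2 - 1) + y^3 - 2 * y"])
      show "(x0^2 - 1) * y0 \<noteq> 0" by fact
      show "(x^2 - 1) * y * z = x * (y^2 - 1) + y^3 - 2 * y" if "char_curve x y z" for x y z
        by (rule char_curve_z(2)[OF that])
    qed (intro polyfun2_intros)+
  qed
  obtain n f where f: "polyfun2 f" "\<And>x y z. char_curve x y z \<Longrightarrow> D x y ^ n * Q x y z = f x y"
    using polyfun3_clear_denominator[of Q D N char_curve, OF Q DN(1,2) z] by blast
  have "f x0 y0 \<noteq> 0" using f(2)[OF pt(1)] DN(3) pt(2) by (metis mult_eq_0_iff power_eq_0_iff)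
  then have fin: "finite {(x, y). quartic x y = 0 \<and> f x y = 0}"
    using quartic_zeros_finite_or_all[OF f(1)] char_curve_quartic[OF pt(1)] by blast
  let ?Z = "{(x, y, z). char_curve x y z \<and> Q x y z = 0}"
  have "inj_on (\<lambda>(x, y, z). (x, y)) ?Z"
    by (auto simp: inj_on_def intro: char_curve_z_unique)
  moreover have "(\<lambda>(x, y, z). (x, y)) ` ?Z \<subseteq> {(x, y). quartic x y = 0 \<and> f x y = 0}"
    using char_curve_quartic f(2) by fastforce
  ultimately show ?thesis using fin by (meson finite_imageD finite_subset)
qed


section \<open>Representations\<close>

lemma (in group) m137_relator_eq_one:
  assumes "a \<in> carrier G" "b \<in> carrier G"
    and rel: "b [^] (2::int) \<otimes> a [^] (3::int) \<otimes> b [^] (2::int) = a \<otimes> b [^] (3::int) \<otimes> a"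
  shows "word_value G (gen_pair a b) m137_relator = \<one>"
proof -
  define p q c where "p = a [^] (3::int)" and "q = b [^] (2::int)" and "c = b [^] (3::int)"
  have carr: "p \<in> carrier G" "q \<in> carrier G" "c \<in> carrier G"
    using assms by (auto simp: p_def q_def c_def)
  have pow: "a [^] (-1::int) = inv a" "b [^] (-3::int) = inv c"
    using assms int_pow_neg[of a 1] int_pow_neg[of b 3] by (simp_all add: c_def)
  have "word_value G (gen_pair a b) m137_relator = p \<otimes> (q \<otimes> (inv a \<otimes> (inv c \<otimes> (inv a \<otimes> (q \<otimes> \<one>)))))"
    by (simp add: m137_relator_def pow p_def q_def)
  also have "\<dots> = p \<otimes> q \<otimes> inv (a \<otimes> c \<otimes> a) \<otimes> q"
    using assms carr by (simp add: inv_mult_group m_assoc)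
  also have "\<dots> = p \<otimes> q \<otimes> inv (q \<otimes> p \<otimes> q) \<otimes> q"
    using rel by (simp add: p_def q_def c_def)
  also have "\<dots> = \<one>"
    using carr by (simp add: inv_mult_group m_assoc inv_solve_right r_inv l_inv) (simp add: m_assoc[symmetric])
  finally show ?thesis .
qed

lemma SL2C_powers:
  "det A = 1 \<Longrightarrow> A [^]\<^bsub>SL2C\<^esub> (2::int) = A ** A"
  "det A = 1 \<Longrightarrow> A [^]\<^bsub>SL2C\<^esub> (3::int) = A ** (A ** A)"
  "det A = 1 \<Longrightarrow> A [^]\<^bsub>SL2C\<^esub> (4::int) = A ** (A ** (A ** A))"
  "det A = 1 \<Longrightarrow> A [^]\<^bsub>SL2C\<^esub> (-1::int) = adjugate2 A"
  by (simp_all add: int_pow_def2 numeral_eq_Suc matrix_mul_assoc inv_SL2C del: pow_nat)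

lemma lin4_one: "lin4 1 0 0 0 A B = mat 1"
  by (simp add: lin4_def mat2_eq_iff)

text \<open>Both sides are expanded in 1, A, B, AB by \<open>mult_lin4\<close>, and
  \<open>char_curve\<close> is exactly what makes the coefficients agree.\<close>

lemma SL2C_relation:
  fixes A B :: "complex^2^2"
  assumes "det A = 1" "det B = 1" "char_curve (trace A) (trace B) (trace (A ** B))"
  shows "B ** (B ** (A ** (A ** (A ** (B ** B))))) = A ** (B ** (B ** (B ** A)))"
proof -
  define x y z where "x = trace A" and "y = trace B" and "z = trace (A ** B)"
  have eqs: "x^2 - 1 = (y^2 - 1) * z - x * y"
     "(x^2 - 1) * (z * y^2 - x * y) - x * (y^3 - 2 * y) = y^2 - 1"
     "x * (y^2 - 1) - (x^2 - 1) * z * y = 2 * y - y^3"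
    using assms(3) unfolding char_curve_def x_def y_def z_def by blast+
  have lin4_eqI: "lin4 p q r s A B = lin4 p' q' r' s' A B" if "p = p'" "q = q'" "r = r'" "s = s'" for p q r s p' q' r' s'
    using that by simp
  note mults = mult_lin4(1,3)[OF assms(1,2), folded x_def y_def z_def]
  have "B ** (B ** (A ** (A ** (A ** (B ** (B ** lin4 1 0 0 0 A B)))))) = A ** (B ** (B ** (B ** (A ** lin4 1 0 0 0 A B))))"
    unfolding mults
    apply (rule lin4_eqI)
    subgoal using eqs by algebra
    subgoal using eqs by algebra
    subgoal using eqs by algebra
    \<comment> \<open>The coefficient of AB agrees identically, both sides being
      palindromes.\<close>
    subgoal by (simp add: algebra_simps)
    done
  then show ?thesis by (simp add: lin4_one)
qed

lemma word_m137_relator_SL2C: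
  fixes A B :: "complex^2^2"
  assumes "det A = 1" "det B = 1" "char_curve (trace A) (trace B) (trace (A ** B))"
  shows "word_value SL2C (gen_pair A B) m137_relator = mat 1"
  using group.m137_relator_eq_one[OF group_SL2C, of A B] SL2C_relation[OF assms] assms(1,2)
  by (simp add: SL2C_powers matrix_mul_assoc)

lemma trace_beta_word:
  fixes A B :: "complex^2^2"
  assumes "det A = 1" "det B = 1" "char_curve (trace A) (trace B) (trace (A ** B))"
  defines "x \<equiv> trace A" and "y \<equiv> trace B" and "z \<equiv> trace (A ** B)"
  shows "trace (word_value SL2C (gen_pair A B) beta_word) = x^3 - x^2 * y - 3 * x + y * z^2"
proof -
  have eqs: "x^2 - 1 = (y^2 - 1) * z - x * y"
     "(x^2 - 1) * (z * y^2 - x * y) - x * (y^3 - 2 * y) = y^2 - 1"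
     "x * (y^2 - 1) - (x^2 - 1) * z * y = 2 * y - y^3"
    using assms(3) unfolding char_curve_def x_def y_def z_def by blast+
  have q: "y^4 - x^3 * y - 3 * y^2 + 2 * x * y + 1 = 0"
    using char_curve_quartic[OF assms(3)] by (simp add: quartic_def x_def y_def)
  have W: "word_value SL2C (gen_pair A B) beta_word =
      adjugate2 A ** (B ** (B ** (A ** (A ** (A ** (A ** (B ** (B ** lin4 1 0 0 0 A B))))))))"
    using assms(1,2) by (simp add: beta_word_def SL2C_powers matrix_mul_assoc lin4_one)
  \<comment> \<open>The right-hand side is x tr(b^3 a) - x tr(a^-1 b^2 a b^2) + x tr(b^4) - tr(a
    b^4). It arises from a^4 = x a^3 - a^2 and a^2 = x a - 1 together with the relation in the form
    a^-1 b^2 a^3 b^2 = b^3 a.\<close>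
  have "trace (word_value SL2C (gen_pair A B) beta_word) =
      x * ((y^2 - 1) * z - x * y) - x * (y^2 * ((x * y - z) * z - x^2 + 2) - 2 * y^2 + 2)
      + x * (y^4 - 4 * y^2 + 2) - ((y^3 - 2 * y) * z - (y^2 - 1) * x)"
    unfolding W mult_lin4[OF assms(1,2), folded x_def y_def z_def]
      trace_lin4[of _ _ _ _ A B, folded x_def y_def z_def]
    using eqs by algebra
  also have "\<dots> = x^3 - x^2 * y - 3 * x + y * z^2"
    using eqs q by algebra
  finally show ?thesis .
qed

text \<open>With \<open>rep_b\<close>, a normal form that realizes the traces x, y, s + 1/s for any
  nonzero s and makes a^-1 b^-1 upper triangular with diagonal s, 1/s.\<close>

definition rep_a :: "complex \<Rightarrow> complex \<Rightarrow> complex^2^2" where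
  "rep_a s x = vector [vector [0, s], vector [- inverse s, x]]"

definition rep_b :: "complex \<Rightarrow> complex^2^2" where
  "rep_b y = vector [vector [y, -1], vector [1, 0]]"

lemma rep_nth [simp]:
  "rep_a s x $ 1 $ 1 = 0" "rep_a s x $ 1 $ 2 = s" "rep_a s x $ 2 $ 1 = - inverse s" "rep_a s x $ 2 $ 2 = x"
  "rep_b y $ 1 $ 1 = y" "rep_b y $ 1 $ 2 = -1" "rep_b y $ 2 $ 1 = 1" "rep_b y $ 2 $ 2 = 0"
  by (simp_all add: rep_a_def rep_b_def)

lemma rep_traces:
  assumes "s \<noteq> 0"
  shows "det (rep_a s x) = 1" "det (rep_b y) = 1" "trace (rep_a s x) = x" "trace (rep_b y) = y"
    "trace (rep_a s x ** rep_b y) = s + inverse s"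
  using assms by (simp_all add: det_2 trace_2 mat2_mult_nth)

lemma alpha_word_rep:
  assumes "s \<noteq> 0"
  shows "word_value SL2C (gen_pair (rep_a s x) (rep_b y)) alpha_word $ 1 $ 1 = s"
    "word_value SL2C (gen_pair (rep_a s x) (rep_b y)) alpha_word $ 2 $ 1 = 0"
    "word_value SL2C (gen_pair (rep_a s x) (rep_b y)) alpha_word $ 2 $ 2 = inverse s"
  using assms
  by (simp_all add: alpha_word_def SL2C_powers rep_traces mat2_mult_nth adjugate2_def trace_2)

lemma exists_eigenvalue: "\<exists>s::complex. s \<noteq> 0 \<and> s + inverse s = z"
proof -
  have "\<exists>s. poly [:1, - z, 1:] s = 0"
    by (intro fundamental_theorem_of_algebra_alt) auto
  then obtain s where s: "1 + s * (s - z) = 0" by (auto simp: algebra_simps)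
  then have "s \<noteq> 0" by auto
  then have "s + inverse s = z" using s by (simp add: field_simps)
  then show ?thesis using \<open>s \<noteq> 0\<close> by blast
qed


section \<open>Growth of traces on a rank two abelian group\<close>

lemma SL2C_upper_triangular_int_pow:
  fixes M :: "complex^2^2"
  assumes M: "det M = 1" "M $ 2 $ 1 = 0"
  shows "(M [^]\<^bsub>SL2C\<^esub> (k::int)) $ 2 $ 1 = 0" "(M [^]\<^bsub>SL2C\<^esub> k) $ 1 $ 1 = (M $ 1 $ 1) powi k"
proof -
  interpret S: group SL2C by (rule group_SL2C)
  have nat: "(M [^]\<^bsub>SL2C\<^esub> (n::nat)) $ 2 $ 1 = 0 \<and> (M [^]\<^bsub>SL2C\<^esub> n) $ 1 $ 1 = (M $ 1 $ 1) ^ n" for n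
    using M(2) by (induction n) (auto simp: mat2_mult_nth)
  have det: "det (M [^]\<^bsub>SL2C\<^esub> (n::nat)) = 1" for n
    using S.nat_pow_closed[of M n] M(1) by simp
  have inv: "adjugate2 (M [^]\<^bsub>SL2C\<^esub> (n::nat)) $ 2 $ 1 = 0 \<and>
      adjugate2 (M [^]\<^bsub>SL2C\<^esub> n) $ 1 $ 1 = inverse (M $ 1 $ 1) ^ n" for n
  proof -
    have "(M [^]\<^bsub>SL2C\<^esub> n) $ 1 $ 1 * (M [^]\<^bsub>SL2C\<^esub> n) $ 2 $ 2 = 1"
      using det[of n] nat[of n] by (simp add: det_2)
    then show ?thesis
      using nat[of n] by (simp add: adjugate2_def trace_2 power_inverse inverse_unique)
  qed
  show "(M [^]\<^bsub>SL2C\<^esub> (k::int)) $ 2 $ 1 = 0" "(M [^]\<^bsub>SL2C\<^esub> k) $ 1 $ 1 = (M $ 1 $ 1) powi k"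
    using nat[of "nat k"] inv[of "nat (- k)"]
    by (simp_all add: int_pow_def2 inv_SL2C det power_int_def del: pow_nat)
qed

lemma trace_upper_triangular:
  fixes M :: "complex^2^2"
  assumes "det M = 1" "M $ 2 $ 1 = 0"
  shows "M $ 1 $ 1 \<noteq> 0" "trace M = M $ 1 $ 1 + inverse (M $ 1 $ 1)"
proof -
  have "M $ 1 $ 1 * M $ 2 $ 2 = 1" using assms by (simp add: det_2)
  then show "M $ 1 $ 1 \<noteq> 0" "trace M = M $ 1 $ 1 + inverse (M $ 1 $ 1)"
    by (auto simp: trace_2 inverse_unique)
qed

text \<open>The maximum depends only on N = |n|, which is at least 1: for r >= 1 the power dominates
  r, and for r < 1 its inverse is at least 1.\<close>

lemma le_max_powi:
  fixes r :: real
  assumes "r > 0" "n \<noteq> 0"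
  shows "r \<le> max (r powi n) (inverse (r powi n))"
proof -
  define N where "N = nat \<bar>n\<bar>"
  have N: "N > 0" using assms(2) by (simp add: N_def)
  have "max (r powi n) (inverse (r powi n)) = max (r ^ N) (inverse (r ^ N))"
    by (cases "n \<ge> 0") (auto simp: N_def power_int_def power_inverse)
  moreover have "r \<le> max (r ^ N) (inverse (r ^ N))"
  proof (cases "r \<ge> 1")
    case True
    then show ?thesis using self_le_power[OF True N] by simp
  next
    case False
    then have "r ^ N \<le> 1" using assms(1) by (intro power_le_one) auto
    then have "1 \<le> inverse (r ^ N)" using assms(1) by (simp add: one_le_inverse)
    then show ?thesis using False by simp
  qed
  ultimately show ?thesis by simp
qed

lemma norm_powi_le:
  fixes s :: complex
  assumes "norm s \<le> 3" "norm (inverse s) \<le> 3"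
  shows "norm (s powi m) \<le> 3 ^ nat \<bar>m\<bar>"
  using power_mono[OF assms(1), of "nat \<bar>m\<bar>"] power_mono[OF assms(2), of "nat \<bar>m\<bar>"]
  by (auto simp: power_int_def norm_power)

text \<open>Here s and L stand for eigenvalues of two commuting matrices. Both s^m and its inverse
  are bounded by c. If Q = L^n has norm at least 1, then 1/P is bounded by c, hence P by the trace
  plus c, and Q by c times that; otherwise exchange Q and 1/Q. The larger of the two norms bounds
  both L and 1/L, as n is nonzero.\<close>

lemma trace_growth:
  fixes s L :: complex and m n :: int
  assumes s: "s \<noteq> 0" "norm s \<le> 3" "norm (inverse s) \<le> 3" and "L \<noteq> 0" "n \<noteq> 0"
  defines "P \<equiv> s powi m * L powi n" and "c \<equiv> 3 ^ nat \<bar>m\<bar>"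
  shows "norm (L + inverse L) \<le> 2 * (c * (norm (P + inverse P) + c))"
proof -
  define S Q where "S = s powi m" and "Q = L powi n"
  have ne: "S \<noteq> 0" "Q \<noteq> 0" using assms by (auto simp: S_def Q_def)
  have P: "P = S * Q" by (simp add: P_def S_def Q_def)
  have c: "c \<ge> 1" by (simp add: c_def)
  have S: "norm S \<le> c" "norm (inverse S) \<le> c"
    using norm_powi_le[OF s(2,3), of m] norm_powi_le[OF s(2,3), of "- m"]
    by (simp_all add: S_def c_def power_int_minus)
  define t where "t = max (norm Q) (norm (inverse Q))"
  have "norm L \<le> t"
    using le_max_powi[of "norm L" n] assms by (simp add: t_def Q_def norm_power_int norm_inverse)
  moreover have "norm (inverse L) \<le> t"
    using le_max_powi[of "inverse (norm L)" n] assms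
    by (simp add: t_def Q_def norm_power_int norm_inverse power_int_inverse max.commute)
  ultimately have "norm (L + inverse L) \<le> 2 * t"
    using norm_triangle_ineq[of L "inverse L"] by linarith
  moreover have "t \<le> c * (norm (P + inverse P) + c)"
  proof (cases "norm Q \<ge> 1")
    case True
    then have Q: "norm (inverse Q) \<le> 1" by (simp add: norm_inverse inverse_le_1_iff)
    have "norm (inverse P) = norm (inverse S) * norm (inverse Q)" by (simp add: P norm_mult[symmetric])
    also have "\<dots> \<le> c * 1" using S Q c by (intro mult_mono) auto
    finally have "norm (inverse P) \<le> c" by simp
    then have "norm P \<le> norm (P + inverse P) + c"
      using norm_triangle_ineq4[of "P + inverse P" "inverse P"] by simp
    moreover have "norm Q = norm (inverse S) * norm P" using ne by (simp add: P norm_mult norm_inverse)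
    ultimately have "norm Q \<le> c * (norm (P + inverse P) + c)"
      using S c by (auto intro!: mult_mono)
    moreover have "t = norm Q" using True Q by (simp add: t_def)
    ultimately show ?thesis by simp
  next
    case False
    then have Q: "norm Q \<le> 1" by simp
    have "norm P = norm S * norm Q" by (simp add: P norm_mult)
    also have "\<dots> \<le> c * 1" using S Q c by (intro mult_mono) auto
    finally have "norm P \<le> c" by simp
    then have "norm (inverse P) \<le> norm (P + inverse P) + c"
      using norm_triangle_ineq4[of "P + inverse P" P] by simp
    moreover have "norm (inverse Q) = norm S * norm (inverse P)" using ne by (simp add: P norm_mult norm_inverse)
    ultimately have "norm (inverse Q) \<le> c * (norm (P + inverse P) + c)"
      using S c by (auto intro!: mult_mono)
    moreover have "norm (inverse Q) \<ge> 1" using Q ne by (simp add: norm_inverse one_le_inverse)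
    then have "t = norm (inverse Q)" using Q by (simp add: t_def)
    ultimately show ?thesis by simp
  qed
  ultimately show ?thesis by linarith
qed

text \<open>If s had norm above 3, then 1/s would have norm below 1 and s at most 2 + 1. The bound 2
  fits the use near the ideal point, where the trace of \<open>alpha\<close> tends to -1.\<close>

lemma eigenvalue_bounded:
  fixes s :: complex
  assumes "s \<noteq> 0" "norm (s + inverse s) \<le> 2"
  shows "norm s \<le> 3"
proof (rule ccontr)
  assume "\<not> norm s \<le> 3"
  then have s: "norm s > 3" by simp
  then have "norm (inverse s) < 1" by (simp add: norm_inverse inverse_less_1_iff)
  moreover have "norm s \<le> norm (s + inverse s) + norm (inverse s)"
    using norm_triangle_ineq4[of "s + inverse s" "inverse s"] by simp
  ultimately show False using s assms(2) by linarith
qed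


section \<open>Characters of the presented group\<close>

lemma polyfun3_power: "P \<in> polyfun3 \<Longrightarrow> (\<lambda>x y z. P x y z ^ n) \<in> polyfun3"
  by (induction n) (auto intro: polyfun3_intros)

text \<open>The argument is carried out for an abstract group with this one-relator presentation;
  the fundamental group of the glued manifold is an instance.\<close>

locale m137_presentation = group G for G (structure) +
  fixes g :: "gen \<Rightarrow> 'a"
  assumes presented: "presented_by G g {m137_relator}"
begin

abbreviation "tr_a \<xi> \<equiv> \<xi> (g Gen_a)"
abbreviation "tr_b \<xi> \<equiv> \<xi> (g Gen_b)"
abbreviation "tr_ab \<xi> \<equiv> \<xi> (g Gen_a \<otimes> g Gen_b)"

lemma g_range: "range g \<subseteq> carrier G"
  and word_surj: "\<gamma> \<in> carrier G \<Longrightarrow> \<exists>w. \<gamma> = word_value G g w"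
  using presented by (auto simp: presented_by_def)

lemma g_closed [simp]: "g i \<in> carrier G"
  using g_range by auto

lemma hom_word:
  assumes "\<rho> \<in> hom G SL2C"
  shows "\<rho> (word_value G g w) = word_value SL2C (gen_pair (\<rho> (g Gen_a)) (\<rho> (g Gen_b))) w"
proof -
  have "(\<lambda>i. \<rho> (g i)) = gen_pair (\<rho> (g Gen_a)) (\<rho> (g Gen_b))"
  proof
    show "\<rho> (g i) = gen_pair (\<rho> (g Gen_a)) (\<rho> (g Gen_b)) i" for i by (cases i) simp_all
  qed
  then show ?thesis
    using hom_word_value[OF is_group group_SL2C assms g_range] by simp
qed

lemma hom_det: "\<rho> \<in> hom G SL2C \<Longrightarrow> \<gamma> \<in> carrier G \<Longrightarrow> det (\<rho> \<gamma>) = 1"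
  by (auto simp: hom_def)

lemma hom_matrix_mult: "\<rho> \<in> hom G SL2C \<Longrightarrow> \<gamma> \<in> carrier G \<Longrightarrow> \<delta> \<in> carrier G \<Longrightarrow> \<rho> (\<gamma> \<otimes> \<delta>) = \<rho> \<gamma> ** \<rho> \<delta>"
  by (auto simp: hom_def)

lemma character_polynomial:
  assumes "\<gamma> \<in> carrier G"
  shows "\<exists>P\<in>polyfun3. \<forall>\<xi>\<in>character_variety G. \<xi> \<gamma> = P (tr_a \<xi>) (tr_b \<xi>) (tr_ab \<xi>)"
proof -
  obtain w where w: "\<gamma> = word_value G g w" using word_surj[OF assms] by blast
  obtain P where P: "P \<in> polyfun3" "\<And>A B. det A = 1 \<Longrightarrow> det B = 1 \<Longrightarrow>
      trace (word_value SL2C (gen_pair A B) w) = P (trace A) (trace B) (trace (A ** B))"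
    using trace_word_polyfun3 by blast
  have "\<xi> \<gamma> = P (tr_a \<xi>) (tr_b \<xi>) (tr_ab \<xi>)" if \<xi>: "\<xi> \<in> character_variety G" for \<xi>
  proof -
    obtain \<rho> where \<rho>: "\<rho> \<in> hom G SL2C" "\<xi> = (\<lambda>\<gamma>\<in>carrier G. trace (\<rho> \<gamma>))"
      using \<xi> by (auto simp: character_variety_def)
    have "\<xi> \<gamma> = trace (word_value SL2C (gen_pair (\<rho> (g Gen_a)) (\<rho> (g Gen_b))) w)"
      using assms by (simp add: \<rho>(2) w hom_word[OF \<rho>(1)])
    also have "\<dots> = P (tr_a \<xi>) (tr_b \<xi>) (tr_ab \<xi>)"
      using P(2) hom_det[OF \<rho>(1)] by (simp add: \<rho>(2) hom_matrix_mult[OF \<rho>(1)])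
    finally show ?thesis .
  qed
  then show ?thesis using P(1) by blast
qed

lemma character_eqI:
  assumes "\<xi> \<in> character_variety G" "\<eta> \<in> character_variety G"
    and "tr_a \<xi> = tr_a \<eta>" "tr_b \<xi> = tr_b \<eta>" "tr_ab \<xi> = tr_ab \<eta>"
  shows "\<xi> = \<eta>"
proof
  fix \<gamma>
  show "\<xi> \<gamma> = \<eta> \<gamma>"
  proof (cases "\<gamma> \<in> carrier G")
    case True
    then obtain P where P: "\<And>\<xi>. \<xi> \<in> character_variety G \<Longrightarrow> \<xi> \<gamma> = P (tr_a \<xi>) (tr_b \<xi>) (tr_ab \<xi>)"
      using character_polynomial by blast
    show ?thesis unfolding P[OF assms(1)] P[OF assms(2)] assms(3-5) ..
  next
    case False
    \<comment> \<open>Characters are restricted to the carrier, so outside it both take the value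
      \<open>undefined\<close>.\<close>
    then show ?thesis using assms(1,2) by (auto simp: character_variety_def)
  qed
qed

lemma rep_hom:
  assumes "char_curve x y z" "s \<noteq> 0" "s + inverse s = z"
  obtains \<rho> where "\<rho> \<in> hom G SL2C"
    "\<And>w. \<rho> (word_value G g w) = word_value SL2C (gen_pair (rep_a s x) (rep_b y)) w"
    "(\<lambda>\<gamma>\<in>carrier G. trace (\<rho> \<gamma>)) \<in> character_variety G"
    "trace (\<rho> (g Gen_a)) = x" "trace (\<rho> (g Gen_b)) = y" "trace (\<rho> (g Gen_a \<otimes> g Gen_b)) = z"
proof -
  have "word_value SL2C (gen_pair (rep_a s x) (rep_b y)) m137_relator = \<one>\<^bsub>SL2C\<^esub>"
    using word_m137_relator_SL2C[of "rep_a s x" "rep_b y"] assms by (simp add: rep_traces)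
  moreover have "range (gen_pair (rep_a s x) (rep_b y)) \<subseteq> carrier SL2C"
    using assms(2) by (simp add: range_gen_pair rep_traces)
  ultimately obtain \<rho> where \<rho>: "\<rho> \<in> hom G SL2C"
      "\<And>w. \<rho> (word_value G g w) = word_value SL2C (gen_pair (rep_a s x) (rep_b y)) w"
    using presented_by_hom_exists[OF is_group group_SL2C presented] by blast
  interpret S: group SL2C by (rule group_SL2C)
  have ab: "\<rho> (g Gen_a) = rep_a s x" "\<rho> (g Gen_b) = rep_b y"
    using \<rho>(2)[of "[(Gen_a, 1)]"] \<rho>(2)[of "[(Gen_b, 1)]"] assms(2)
      S.int_pow_1[of "rep_a s x"] S.int_pow_1[of "rep_b y"]
    by (simp_all add: rep_traces)
  show ?thesis
  proof (rule that[OF \<rho>])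
    show "(\<lambda>\<gamma>\<in>carrier G. trace (\<rho> \<gamma>)) \<in> character_variety G"
      using \<rho>(1) by (auto simp: character_variety_def)
  qed (use assms(2,3) in \<open>simp_all add: ab hom_matrix_mult[OF \<rho>(1)] rep_traces\<close>)
qed

text \<open>By \<open>character_eqI\<close> at most one character qualifies, so the choice does not
  depend on which of the two eigenvalues s of trace z enters the representation.\<close>

definition char_of :: "complex \<Rightarrow> complex \<Rightarrow> complex \<Rightarrow> 'a \<Rightarrow> complex" where
  "char_of x y z = (SOME \<xi>. \<xi> \<in> character_variety G \<and> tr_a \<xi> = x \<and> tr_b \<xi> = y \<and> tr_ab \<xi> = z)"

lemma char_of:
  assumes "char_curve x y z"
  shows "char_of x y z \<in> character_variety G" "tr_a (char_of x y z) = x"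
    "tr_b (char_of x y z) = y" "tr_ab (char_of x y z) = z"
proof -
  obtain s where s: "s \<noteq> 0" "s + inverse s = z" using exists_eigenvalue by blast
  obtain \<rho> where \<rho>: "\<rho> \<in> hom G SL2C" "(\<lambda>\<gamma>\<in>carrier G. trace (\<rho> \<gamma>)) \<in> character_variety G"
    "trace (\<rho> (g Gen_a)) = x" "trace (\<rho> (g Gen_b)) = y" "trace (\<rho> (g Gen_a \<otimes> g Gen_b)) = z"
    using rep_hom[OF assms s] by metis
  have "\<exists>\<xi>. \<xi> \<in> character_variety G \<and> tr_a \<xi> = x \<and> tr_b \<xi> = y \<and> tr_ab \<xi> = z"
    by (rule exI[of _ "\<lambda>\<gamma>\<in>carrier G. trace (\<rho> \<gamma>)"]) (simp add: \<rho>)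
  from someI_ex[OF this] show "char_of x y z \<in> character_variety G" "tr_a (char_of x y z) = x"
    "tr_b (char_of x y z) = y" "tr_ab (char_of x y z) = z"
    unfolding char_of_def by auto
qed

lemma char_of_eq:
  assumes "\<xi> \<in> character_variety G" "char_curve (tr_a \<xi>) (tr_b \<xi>) (tr_ab \<xi>)"
  shows "char_of (tr_a \<xi>) (tr_b \<xi>) (tr_ab \<xi>) = \<xi>"
  using char_of[OF assms(2)] assms(1) by (intro character_eqI) auto

lemma char_of_rep:
  assumes "char_curve x y z" "s \<noteq> 0" "s + inverse s = z"
  obtains \<rho> where "\<rho> \<in> hom G SL2C"
    "\<And>w. \<rho> (word_value G g w) = word_value SL2C (gen_pair (rep_a s x) (rep_b y)) w"
    "\<And>\<gamma>. \<gamma> \<in> carrier G \<Longrightarrow> char_of x y z \<gamma> = trace (\<rho> \<gamma>)"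
proof -
  obtain \<rho> where \<rho>: "\<rho> \<in> hom G SL2C"
    "\<And>w. \<rho> (word_value G g w) = word_value SL2C (gen_pair (rep_a s x) (rep_b y)) w"
    "(\<lambda>\<gamma>\<in>carrier G. trace (\<rho> \<gamma>)) \<in> character_variety G"
    "trace (\<rho> (g Gen_a)) = x" "trace (\<rho> (g Gen_b)) = y" "trace (\<rho> (g Gen_a \<otimes> g Gen_b)) = z"
    using rep_hom[OF assms] by metis
  have "char_of x y z = (\<lambda>\<gamma>\<in>carrier G. trace (\<rho> \<gamma>))"
    using char_of[OF assms(1)] \<rho>(3-6) by (intro character_eqI) auto
  then show ?thesis using that[OF \<rho>(1,2)] by simp
qed

lemma regular_polyfun3:
  "P \<in> polyfun3 \<Longrightarrow> (\<lambda>\<xi>. P (tr_a \<xi>) (tr_b \<xi>) (tr_ab \<xi>)) \<in> regular_functions G"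
  by (induction rule: polyfun3.induct) (auto intro: regular_functions.intros)

lemma regular_eq_polyfun3:
  assumes "\<phi> \<in> regular_functions G"
  shows "\<exists>P\<in>polyfun3. \<forall>\<xi>\<in>character_variety G. \<phi> \<xi> = P (tr_a \<xi>) (tr_b \<xi>) (tr_ab \<xi>)"
  using assms
proof induction
  case (const c)
  show ?case by (rule bexI[OF _ polyfun3.const[of c]]) simp
next
  case (trace_function \<gamma>)
  then show ?case by (rule character_polynomial)
next
  case (add \<phi> \<psi>)
  then obtain P Q where "P \<in> polyfun3" "\<forall>\<xi>\<in>character_variety G. \<phi> \<xi> = P (tr_a \<xi>) (tr_b \<xi>) (tr_ab \<xi>)"
    "Q \<in> polyfun3" "\<forall>\<xi>\<in>character_variety G. \<psi> \<xi> = Q (tr_a \<xi>) (tr_b \<xi>) (tr_ab \<xi>)" by blast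
  then show ?case by (intro bexI[OF _ polyfun3.add[of P Q]]) auto
next
  case (mult \<phi> \<psi>)
  then obtain P Q where "P \<in> polyfun3" "\<forall>\<xi>\<in>character_variety G. \<phi> \<xi> = P (tr_a \<xi>) (tr_b \<xi>) (tr_ab \<xi>)"
    "Q \<in> polyfun3" "\<forall>\<xi>\<in>character_variety G. \<psi> \<xi> = Q (tr_a \<xi>) (tr_b \<xi>) (tr_ab \<xi>)" by blast
  then show ?case by (intro bexI[OF _ polyfun3.mult[of P Q]]) auto
qed

section \<open>The curve of characters as a closed set\<close>

definition X0 :: "('a \<Rightarrow> complex) set" where
  "X0 = {\<xi> \<in> character_variety G. char_curve (tr_a \<xi>) (tr_b \<xi>) (tr_ab \<xi>)}"

lemma character_closed_Un:
  assumes "A \<in> character_closed_sets G" "B \<in> character_closed_sets G"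
  shows "A \<union> B \<in> character_closed_sets G"
proof -
  obtain S T where S: "S \<subseteq> regular_functions G" "A = {\<xi> \<in> character_variety G. \<forall>\<phi>\<in>S. \<phi> \<xi> = 0}"
    and T: "T \<subseteq> regular_functions G" "B = {\<xi> \<in> character_variety G. \<forall>\<phi>\<in>T. \<phi> \<xi> = 0}"
    using assms by (auto simp: character_closed_sets_def)
  let ?U = "{\<lambda>\<xi>. \<phi> \<xi> * \<psi> \<xi> | \<phi> \<psi>. \<phi> \<in> S \<and> \<psi> \<in> T}"
  have "?U \<subseteq> regular_functions G"
    using S(1) T(1) regular_functions.mult by fastforce
  moreover have "A \<union> B = {\<xi> \<in> character_variety G. \<forall>\<phi>\<in>?U. \<phi> \<xi> = 0}"
    unfolding S T by fastforce
  ultimately show ?thesis unfolding character_closed_sets_def by blast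
qed

lemma character_closed_zeros:
  assumes "set Ps \<subseteq> polyfun3"
  shows "{\<xi> \<in> character_variety G. \<forall>P\<in>set Ps. P (tr_a \<xi>) (tr_b \<xi>) (tr_ab \<xi>) = 0} \<in> character_closed_sets G"
proof -
  let ?S = "(\<lambda>P \<xi>. P (tr_a \<xi>) (tr_b \<xi>) (tr_ab \<xi>)) ` set Ps"
  have "?S \<subseteq> regular_functions G" using assms regular_polyfun3 by blast
  moreover have "{\<xi> \<in> character_variety G. \<forall>P\<in>set Ps. P (tr_a \<xi>) (tr_b \<xi>) (tr_ab \<xi>) = 0}
      = {\<xi> \<in> character_variety G. \<forall>\<phi>\<in>?S. \<phi> \<xi> = 0}" by simp
  ultimately show ?thesis unfolding character_closed_sets_def by blast
qed

lemma X0_closed: "X0 \<in> character_closed_sets G"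
proof -
  let ?Ps = "[\<lambda>x y z. (x^2 - 1) - ((y^2 - 1) * z - x * y),
     \<lambda>x y z. ((x^2 - 1) * (z * y^2 - x * y) - x * (y^3 - 2 * y)) - (y^2 - 1),
     \<lambda>x y z. (x * (y^2 - 1) - (x^2 - 1) * z * y) - (2 * y - y^3)]"
  have "set ?Ps \<subseteq> polyfun3"
    by (auto intro!: polyfun3_intros polyfun3_power)
  from character_closed_zeros[OF this] show ?thesis
    by (simp add: X0_def char_curve_def)
qed

lemma character_singleton_closed:
  assumes "\<xi> \<in> character_variety G"
  shows "{\<xi>} \<in> character_closed_sets G"
proof -
  let ?Ps = "[\<lambda>x y z. x - tr_a \<xi>, \<lambda>x y z. y - tr_b \<xi>, \<lambda>x y z. z - tr_ab \<xi>]"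
  have "set ?Ps \<subseteq> polyfun3"
    by (auto intro!: polyfun3_intros)
  from character_closed_zeros[OF this] 
  have "{\<eta> \<in> character_variety G. tr_a \<eta> = tr_a \<xi> \<and> tr_b \<eta> = tr_b \<xi> \<and> tr_ab \<eta> = tr_ab \<xi>} \<in> character_closed_sets G"
    by simp
  moreover have "{\<eta> \<in> character_variety G. tr_a \<eta> = tr_a \<xi> \<and> tr_b \<eta> = tr_b \<xi> \<and> tr_ab \<eta> = tr_ab \<xi>} = {\<xi>}"
    using assms character_eqI by blast
  ultimately show ?thesis by simp
qed

text \<open>Regular functions are polynomials in the three traces, so one that is nonzero somewhere
  on the curve has finitely many zeros there. Infinitely many characters come from the points of the
  quartic with y^2 different from 1, which lift by \<open>char_z\<close>.\<close>

lemma irreducible_curve_X0: "irreducible_curve (character_closed_sets G) X0"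
proof (rule irreducible_curveI[where E = "\<lambda>\<xi>. {\<xi>}"])
  show "X0 \<in> character_closed_sets G" by (rule X0_closed)
  show "{\<xi>} \<in> character_closed_sets G" if "\<xi> \<in> X0" for \<xi>
    using that by (intro character_singleton_closed) (simp add: X0_def)
  show "finite ((\<lambda>\<xi>. {\<xi>}) ` (A \<inter> X0))"
    if A: "A \<in> character_closed_sets G" "\<not> X0 \<subseteq> A" for A
  proof -
    obtain S where S: "S \<subseteq> regular_functions G" "A = {\<xi> \<in> character_variety G. \<forall>\<phi>\<in>S. \<phi> \<xi> = 0}"
      using A(1) by (auto simp: character_closed_sets_def)
    obtain \<xi>0 where \<xi>0: "\<xi>0 \<in> X0" "\<xi>0 \<notin> A" using A(2) by auto
    then obtain \<phi> where \<phi>: "\<phi> \<in> S" "\<phi> \<xi>0 \<noteq> 0" by (auto simp: S X0_def)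
    then have "\<phi> \<in> regular_functions G" using S by auto
    then obtain Q where Q: "Q \<in> polyfun3"
        "\<And>\<xi>. \<xi> \<in> character_variety G \<Longrightarrow> \<phi> \<xi> = Q (tr_a \<xi>) (tr_b \<xi>) (tr_ab \<xi>)"
      using regular_eq_polyfun3 by blast
    have fin: "finite {(x, y, z). char_curve x y z \<and> Q x y z = 0}"
      using finite_zeros_on_char_curve[OF Q(1), of "tr_a \<xi>0" "tr_b \<xi>0" "tr_ab \<xi>0"] \<xi>0(1) \<phi>(2) Q(2)[of \<xi>0]
      by (simp add: X0_def)
    have "inj_on (\<lambda>\<xi>. (tr_a \<xi>, tr_b \<xi>, tr_ab \<xi>)) (A \<inter> X0)"
      by (rule inj_onI) (auto simp: X0_def intro: character_eqI)
    moreover have "(\<lambda>\<xi>. (tr_a \<xi>, tr_b \<xi>, tr_ab \<xi>)) ` (A \<inter> X0) \<subseteq> {(x, y, z). char_curve x y z \<and> Q x y z = 0}"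
      using \<phi>(1) Q(2) by (auto simp: S X0_def)
    ultimately have "finite (A \<inter> X0)" using fin by (meson finite_imageD finite_subset)
    then show ?thesis by simp
  qed
  show "infinite ((\<lambda>\<xi>. {\<xi>}) ` X0)"
  proof
    assume "finite ((\<lambda>\<xi>. {\<xi>}) ` X0)"
    then have "finite X0" by (rule finite_imageD) (simp add: inj_on_def)
    then have "finite ((\<lambda>\<xi>. (tr_a \<xi>, tr_b \<xi>)) ` X0)" by simp
    moreover have "{(x, y). quartic x y = 0 \<and> y^2 \<noteq> 1} \<subseteq> (\<lambda>\<xi>. (tr_a \<xi>, tr_b \<xi>)) ` X0"
    proof clarify
      fix x y :: complex assume "quartic x y = 0" "y^2 \<noteq> 1"
      then have "char_curve x y (char_z x y)" by (rule char_curve_char_z)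
      note this char_of[OF this]
      then show "(x, y) \<in> (\<lambda>\<xi>. (tr_a \<xi>, tr_b \<xi>)) ` X0"
        by (intro image_eqI[of _ _ "char_of x y (char_z x y)"]) (auto simp: X0_def)
    qed
    ultimately show False using infinite_char_curve finite_subset by blast
  qed
qed (auto intro: character_closed_Un)

end


section \<open>The smooth projective model\<close>

text \<open>Removes the line at infinity and the points y = w and y = -w, where the fraction
  defining \<open>char_z\<close> has denominator 0.\<close>

definition quartic_domain :: "hvec set" where
  "quartic_domain = quartic_curve - {v \<in> homogeneous_coords 2. v 0 * (v 2 ^ 2 - v 0 ^ 2) = 0}"

lemma hpoly_forms:
  "(\<lambda>v. v 1 ^ 2 + v 1 * v 2 - v 0 ^ 2) \<in> hpoly 2 2"
  "(\<lambda>v. v 2 ^ 2 - v 0 ^ 2) \<in> hpoly 2 2"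
  "(\<lambda>v. v 0 * (v 2 ^ 2 - v 0 ^ 2)) \<in> hpoly 2 3"
proof -
  have 1: "(\<lambda>v. v 1 * v 2) \<in> hpoly 2 2"
    by (rule hpoly_mult_eq[OF hpoly_coord hpoly_coord]) simp_all
  show "(\<lambda>v. v 1 ^ 2 + v 1 * v 2 - v 0 ^ 2) \<in> hpoly 2 2"
    by (intro hpoly_add hpoly_diff 1 hpoly_2_coord_power)
  show 2: "(\<lambda>v. v 2 ^ 2 - v 0 ^ 2) \<in> hpoly 2 2"
    by (intro hpoly_diff hpoly_2_coord_power)
  show "(\<lambda>v. v 0 * (v 2 ^ 2 - v 0 ^ 2)) \<in> hpoly 2 3"
    by (rule hpoly_mult_eq[OF hpoly_coord 2]) simp_all
qed

lemma char_z_divide: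
  assumes "w \<noteq> 0" "y^2 - w^2 \<noteq> 0"
  shows "char_z (x / w) (y / w) = (x^2 + x * y - w^2) / (y^2 - w^2)"
proof -
  have "(x / w)^2 + x / w * (y / w) - 1 = (x^2 + x * y - w^2) / w^2" "(y / w)^2 - 1 = (y^2 - w^2) / w^2"
    using assms(1) by (simp_all add: field_simps power2_eq_square)
  then show ?thesis using assms by (simp add: char_z_def)
qed

lemma quartic_domainD:
  assumes "v \<in> quartic_domain"
  shows "v 0 \<noteq> 0" "v 2 ^ 2 - v 0 ^ 2 \<noteq> 0" "v \<in> homogeneous_coords 2"
    "quartic (v 1 / v 0) (v 2 / v 0) = 0" "(v 2 / v 0)^2 \<noteq> 1"
    "char_curve (v 1 / v 0) (v 2 / v 0) (char_z (v 1 / v 0) (v 2 / v 0))"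
proof -
  show 1: "v \<in> homogeneous_coords 2" "v 0 \<noteq> 0" "v 2 ^ 2 - v 0 ^ 2 \<noteq> 0"
    using assms by (auto simp: quartic_domain_def quartic_curve_def)
  have v: "v = (\<lambda>i. v 0 * hpoint 1 (v 1 / v 0) (v 2 / v 0) i)"
    unfolding scale_hpoint using 1 homogeneous_coords_2[of v] by simp
  have "quartic_form (\<lambda>i. v 0 * hpoint 1 (v 1 / v 0) (v 2 / v 0) i) = 0"
    using assms v by (simp add: quartic_domain_def quartic_curve_def)
  then show q: "quartic (v 1 / v 0) (v 2 / v 0) = 0"
    using hpoly_scale[OF hpoly_quartic_form] 1 by (simp add: quartic_form_hpoint)
  show y: "(v 2 / v 0)^2 \<noteq> 1"
    using 1 by (simp add: power_divide)
  show "char_curve (v 1 / v 0) (v 2 / v 0) (char_z (v 1 / v 0) (v 2 / v 0))"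
    by (rule char_curve_char_z[OF q y])
qed

lemma hpoint_quartic_domain: "quartic x y = 0 \<Longrightarrow> y^2 \<noteq> 1 \<Longrightarrow> hpoint 1 x y \<in> quartic_domain"
  by (simp add: quartic_domain_def quartic_curve_affine)

text \<open>The form v 0 * (v 2 ^ 2 - v 0 ^ 2) is a common denominator of x, y and z of degree 3 and
  has no zero on the domain; products and sums only raise its exponent.\<close>

lemma polyfun3_homogenize:
  assumes "Q \<in> polyfun3"
  shows "\<exists>n. \<exists>F\<in>hpoly 2 (n * 3). \<forall>v\<in>quartic_domain.
    F v = Q (v 1 / v 0) (v 2 / v 0) (char_z (v 1 / v 0) (v 2 / v 0)) * (v 0 * (v 2 ^ 2 - v 0 ^ 2)) ^ n"
  using assms
proof induction
  case (const c)
  show ?case by (rule exI[of _ 0], rule bexI[of _ "\<lambda>_. c"]) (simp_all add: hpoly_const)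
next
  case fst
  have "(\<lambda>v. v 1 * (v 2 ^ 2 - v 0 ^ 2)) \<in> hpoly 2 (1 * 3)"
    by (rule hpoly_mult_eq[OF hpoly_coord hpoly_forms(2)]) simp_all
  then show ?case
    by (intro exI[of _ 1] bexI[of _ "\<lambda>v. v 1 * (v 2 ^ 2 - v 0 ^ 2)"]) (simp_all add: quartic_domainD)
next
  case snd
  have "(\<lambda>v. v 2 * (v 2 ^ 2 - v 0 ^ 2)) \<in> hpoly 2 (1 * 3)"
    by (rule hpoly_mult_eq[OF hpoly_coord hpoly_forms(2)]) simp_all
  then show ?case
    by (intro exI[of _ 1] bexI[of _ "\<lambda>v. v 2 * (v 2 ^ 2 - v 0 ^ 2)"]) (simp_all add: quartic_domainD)
next
  case thd
  have "(\<lambda>v. v 0 * (v 1 ^ 2 + v 1 * v 2 - v 0 ^ 2)) \<in> hpoly 2 (1 * 3)"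
    by (rule hpoly_mult_eq[OF hpoly_coord hpoly_forms(1)]) simp_all
  moreover have "v 0 * (v 1 ^ 2 + v 1 * v 2 - v 0 ^ 2) =
      char_z (v 1 / v 0) (v 2 / v 0) * (v 0 * (v 2 ^ 2 - v 0 ^ 2)) ^ 1" if "v \<in> quartic_domain" for v
    using quartic_domainD(1,2)[OF that] by (simp add: char_z_divide)
  ultimately show ?case
    by - (rule exI[of _ 1], rule bexI[of _ "\<lambda>v. v 0 * (v 1 ^ 2 + v 1 * v 2 - v 0 ^ 2)"], simp_all)
next
  case (add P Q)
  then obtain n F m H where F: "F \<in> hpoly 2 (n * 3)" "\<And>v. v \<in> quartic_domain \<Longrightarrow>
        F v = P (v 1 / v 0) (v 2 / v 0) (char_z (v 1 / v 0) (v 2 / v 0)) * (v 0 * (v 2 ^ 2 - v 0 ^ 2)) ^ n"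
    and H: "H \<in> hpoly 2 (m * 3)" "\<And>v. v \<in> quartic_domain \<Longrightarrow>
        H v = Q (v 1 / v 0) (v 2 / v 0) (char_z (v 1 / v 0) (v 2 / v 0)) * (v 0 * (v 2 ^ 2 - v 0 ^ 2)) ^ m"
    by blast
  have "(\<lambda>v. F v * (v 0 * (v 2 ^ 2 - v 0 ^ 2)) ^ m) \<in> hpoly 2 ((n + m) * 3)"
       "(\<lambda>v. H v * (v 0 * (v 2 ^ 2 - v 0 ^ 2)) ^ n) \<in> hpoly 2 ((n + m) * 3)"
    using hpoly_mult[OF F(1) hpoly_power[OF hpoly_forms(3), of m]]
      hpoly_mult[OF H(1) hpoly_power[OF hpoly_forms(3), of n]] by (simp_all add: algebra_simps)
  from hpoly_add[OF this] show ?case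
    by (intro exI[of _ "n + m"] bexI[of _ "\<lambda>v. F v * (v 0 * (v 2 ^ 2 - v 0 ^ 2)) ^ m + H v * (v 0 * (v 2 ^ 2 - v 0 ^ 2)) ^ n"])
       (simp_all add: F(2) H(2) power_add algebra_simps)
next
  case (mult P Q)
  then obtain n F m H where F: "F \<in> hpoly 2 (n * 3)" "\<And>v. v \<in> quartic_domain \<Longrightarrow>
        F v = P (v 1 / v 0) (v 2 / v 0) (char_z (v 1 / v 0) (v 2 / v 0)) * (v 0 * (v 2 ^ 2 - v 0 ^ 2)) ^ n"
    and H: "H \<in> hpoly 2 (m * 3)" "\<And>v. v \<in> quartic_domain \<Longrightarrow>
        H v = Q (v 1 / v 0) (v 2 / v 0) (char_z (v 1 / v 0) (v 2 / v 0)) * (v 0 * (v 2 ^ 2 - v 0 ^ 2)) ^ m"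
    by blast
  have "(\<lambda>v. F v * H v) \<in> hpoly 2 ((n + m) * 3)"
    using hpoly_mult[OF F(1) H(1)] by (simp add: algebra_simps)
  then show ?case
    by (intro exI[of _ "n + m"] bexI[of _ "\<lambda>v. F v * H v"])
       (simp_all add: F(2) H(2) power_add mult_ac)
qed

text \<open>
  At the point at infinity \<open>(0 : 1 : \<omega>)\<close>, where \<open>y / x = \<omega>\<close> is a primitive cube root of unity,
  \<open>z = (x\<^sup>2 + xy - 1) / (y\<^sup>2 - 1)\<close> takes the value \<open>(1 + \<omega>) / \<omega>\<^sup>2 = -1 = \<omega> + 1 / \<omega>\<close>.
\<close>

lemma primitive_cube_root:
  obtains \<omega> :: complex where "1 + \<omega> + \<omega>^2 = 0"
proof -
  have "\<exists>\<omega>. poly [:1, 1, 1:] \<omega> = (0::complex)"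
    by (intro fundamental_theorem_of_algebra_alt) auto
  then show ?thesis using that by (auto simp: algebra_simps power2_eq_square)
qed

lemma primitive_cube_root_facts:
  fixes \<omega> :: complex
  assumes "1 + \<omega> + \<omega>^2 = 0"
  shows "\<omega> \<noteq> 0" "\<omega> \<noteq> 1" "\<omega> \<noteq> -1" "\<omega>^3 = 1" "\<omega>^4 = \<omega>" "\<omega>^6 = 1" "\<omega> + inverse \<omega> = -1"
proof -
  show "\<omega> \<noteq> 0" "\<omega> \<noteq> 1" "\<omega> \<noteq> -1" using assms by auto
  have "\<omega>^3 - 1 = (\<omega> - 1) * (1 + \<omega> + \<omega>^2)"
    by (simp add: algebra_simps power_numeral_reduce)
  then show 3: "\<omega>^3 = 1" using assms by simp
  have "\<omega>^4 = \<omega>^3 * \<omega>" "\<omega>^6 = \<omega>^3 * \<omega>^3"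
    by (simp_all add: power_numeral_reduce)
  then show "\<omega>^4 = \<omega>" "\<omega>^6 = 1" using 3 by simp_all
  have "\<omega> * \<omega>^2 = 1" using 3 by (simp add: power_numeral_reduce)
  then have "inverse \<omega> = \<omega>^2" by (rule inverse_unique)
  then show "\<omega> + inverse \<omega> = -1"
    using assms by (simp add: add_eq_0_iff add.assoc)
qed

text \<open>Along the approximating sequence y^2 - w^2 tends to \<omega>^2, which is nonzero. So the
  sequence eventually avoids the removed points, and the fraction for z converges.\<close>

lemma domain_near_cube_root:
  assumes \<omega>: "1 + \<omega> + \<omega>^2 = 0"
  obtains w y :: "nat \<Rightarrow> complex"
  where "w \<longlonglongrightarrow> 0" "y \<longlonglongrightarrow> \<omega>" "eventually (\<lambda>k. hpoint (w k) 1 (y k) \<in> quartic_domain) sequentially"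
    "(\<lambda>k. char_z (1 / w k) (y k / w k)) \<longlonglongrightarrow> -1"
proof -
  note \<omega>_facts = primitive_cube_root_facts[OF \<omega>]
  obtain w y where wy: "\<And>k. w k \<noteq> 0" "w \<longlonglongrightarrow> 0" "y \<longlonglongrightarrow> \<omega>"
      "\<And>k. quartic_form (hpoint (w k) 1 (y k)) = 0"
    using quartic_near_infinity[OF \<omega>_facts(5)] by blast
  have "(\<lambda>k. y k ^ 2 - w k ^ 2) \<longlonglongrightarrow> \<omega>^2 - 0^2"
    by (intro tendsto_intros wy)
  then have lim: "(\<lambda>k. y k ^ 2 - w k ^ 2) \<longlonglongrightarrow> \<omega>^2" by simp
  have ne: "eventually (\<lambda>k. y k ^ 2 - w k ^ 2 \<noteq> 0) sequentially"
    using tendsto_imp_eventually_ne[OF lim, of 0] \<omega>_facts(1) by simp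
  have dom: "eventually (\<lambda>k. hpoint (w k) 1 (y k) \<in> quartic_domain) sequentially"
    using ne by eventually_elim
      (use wy in \<open>auto simp: quartic_domain_def quartic_curve_def hpoint_homogeneous_coords\<close>)
  have "(\<lambda>k. (1^2 + 1 * y k - w k ^ 2) / (y k ^ 2 - w k ^ 2)) \<longlonglongrightarrow> (1^2 + 1 * \<omega> - 0^2) / \<omega>^2"
    using \<omega>_facts(1) by (intro tendsto_intros wy lim) auto
  moreover have "(1^2 + 1 * \<omega> - 0^2) / \<omega>^2 = -1"
    using \<omega> \<omega>_facts(1) by (simp add: field_simps eq_neg_iff_add_eq_0)
  moreover have "eventually (\<lambda>k. (1^2 + 1 * y k - w k ^ 2) / (y k ^ 2 - w k ^ 2) =
      char_z (1 / w k) (y k / w k)) sequentially"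
    using ne by eventually_elim (simp add: char_z_divide[OF wy(1)])
  ultimately have "(\<lambda>k. char_z (1 / w k) (y k / w k)) \<longlonglongrightarrow> -1"
    using Lim_transform_eventually by fastforce
  then show ?thesis using that wy(2,3) dom by blast
qed

context m137_presentation
begin

definition quartic_model :: "'a curve_model" where
  "quartic_model = \<lparr>adim = 2, curve = quartic_curve, rdom = quartic_domain,
     rmap = (\<lambda>v. char_of (v 1 / v 0) (v 2 / v 0) (char_z (v 1 / v 0) (v 2 / v 0)))\<rparr>"

lemma rmap_finite_value:
  assumes "\<gamma> \<in> carrier G" "v \<in> quartic_domain"
  shows "\<exists>z. finite_value_at 2 quartic_domain (\<lambda>u. rmap quartic_model u \<gamma>) v z"
proof -
  obtain P where P: "P \<in> polyfun3"
      "\<And>\<xi>. \<xi> \<in> character_variety G \<Longrightarrow> \<xi> \<gamma> = P (tr_a \<xi>) (tr_b \<xi>) (tr_ab \<xi>)"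
    using character_polynomial[OF assms(1)] by blast
  obtain n F where F: "F \<in> hpoly 2 (n * 3)" "\<And>v. v \<in> quartic_domain \<Longrightarrow>
      F v = P (v 1 / v 0) (v 2 / v 0) (char_z (v 1 / v 0) (v 2 / v 0)) * (v 0 * (v 2 ^ 2 - v 0 ^ 2)) ^ n"
    using polyfun3_homogenize[OF P(1)] by blast
  let ?H = "\<lambda>v. (v 0 * (v 2 ^ 2 - v 0 ^ 2)) ^ n"
  have "?H \<in> hpoly 2 (n * 3)" by (rule hpoly_power[OF hpoly_forms(3)])
  moreover have "F u = rmap quartic_model u \<gamma> * ?H u" if "u \<in> quartic_domain" for u
  proof -
    note char = char_of[OF quartic_domainD(6)[OF that]]
    have "rmap quartic_model u \<gamma> = P (u 1 / u 0) (u 2 / u 0) (char_z (u 1 / u 0) (u 2 / u 0))"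
      using P(2)[OF char(1)] unfolding char(2-4) by (simp add: quartic_model_def)
    then show ?thesis using F(2)[OF that] by simp
  qed
  moreover have "?H v \<noteq> 0" using quartic_domainD[OF assms(2)] by simp
  ultimately show ?thesis
    unfolding finite_value_at_def using F(1)
    by (intro exI[of _ "F v / ?H v"] exI[of _ "n * 3"] bexI[of _ F] bexI[of _ ?H]) auto
qed

text \<open>The inverse map sends a character to (1 : tr a : tr b), defined on the part of the curve
  with y^2 different from 1. There z is forced to be \<open>char_z\<close>, so the two maps are
  mutually inverse.\<close>

lemma smooth_projective_model_X0: "smooth_projective_model G X0 quartic_model"
proof -
  let ?V = "X0 - {\<xi> \<in> character_variety G. \<forall>P\<in>set [\<lambda>x y z. y^2 - 1]. P (tr_a \<xi>) (tr_b \<xi>) (tr_ab \<xi>) = 0}"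
  let ?h = "\<lambda>i::nat. if i = 0 then (\<lambda>\<xi>. 1) else if i = 1 then (\<lambda>\<xi>. tr_a \<xi>) else
    if i = 2 then (\<lambda>\<xi>. tr_b \<xi>) else (\<lambda>\<xi>. 0)"
  have h: "(\<lambda>i. ?h i \<xi>) = hpoint 1 (tr_a \<xi>) (tr_b \<xi>)" for \<xi> :: "'a \<Rightarrow> complex"
    by (rule ext) (simp add: hpoint_def)
  have V: "\<xi> \<in> ?V \<longleftrightarrow> \<xi> \<in> X0 \<and> (tr_b \<xi>)^2 \<noteq> 1" for \<xi>
    by (auto simp: X0_def)
  have rmap: "rmap quartic_model v \<in> ?V \<and> (\<exists>c. c \<noteq> 0 \<and> (\<lambda>i. ?h i (rmap quartic_model v)) = (\<lambda>i. c * v i))"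
    if v: "v \<in> quartic_domain" for v
  proof
    note char = char_of[OF quartic_domainD(6)[OF v]]
    show "rmap quartic_model v \<in> ?V"
      using char quartic_domainD(5,6)[OF v] by (simp add: quartic_model_def V X0_def)
    have "tr_a (rmap quartic_model v) = v 1 / v 0" "tr_b (rmap quartic_model v) = v 2 / v 0"
      using char by (simp_all add: quartic_model_def)
    then have "(\<lambda>i. ?h i (rmap quartic_model v)) = (\<lambda>i. inverse (v 0) * hpoint (v 0) (v 1) (v 2) i)"
      unfolding h scale_hpoint using quartic_domainD(1)[OF v]
      by (simp add: divide_inverse mult.commute)
    also have "hpoint (v 0) (v 1) (v 2) = v"
      using homogeneous_coords_2[OF quartic_domainD(3)[OF v]] by simp
    finally show "\<exists>c. c \<noteq> 0 \<and> (\<lambda>i. ?h i (rmap quartic_model v)) = (\<lambda>i. c * v i)"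
      using quartic_domainD(1)[OF v] by (intro exI[of _ "inverse (v 0)"]) simp
  qed
  have inverse: "(\<lambda>i. ?h i \<xi>) \<in> quartic_domain \<and> rmap quartic_model (\<lambda>i. ?h i \<xi>) = \<xi>" if "\<xi> \<in> ?V" for \<xi>
  proof -
    have \<xi>: "\<xi> \<in> character_variety G" "char_curve (tr_a \<xi>) (tr_b \<xi>) (tr_ab \<xi>)" "(tr_b \<xi>)^2 \<noteq> 1"
      using that unfolding V by (auto simp: X0_def)
    have "char_z (tr_a \<xi>) (tr_b \<xi>) = tr_ab \<xi>"
      by (rule char_curve_z_unique[OF char_curve_char_z[OF char_curve_quartic[OF \<xi>(2)] \<xi>(3)] \<xi>(2)])
    then show ?thesis
      unfolding h using hpoint_quartic_domain[OF char_curve_quartic[OF \<xi>(2)] \<xi>(3)] char_of_eq[OF \<xi>(1,2)]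
      by (simp add: quartic_model_def)
  qed
  have "{(x, y). quartic x y = 0 \<and> y^2 \<noteq> 1} \<noteq> {}"
    using infinite_char_curve by fastforce
  then obtain x y where "quartic x y = 0" "y^2 \<noteq> 1" by auto
  then have dom: "hpoint 1 x y \<in> quartic_domain" by (rule hpoint_quartic_domain)
  have "{v \<in> homogeneous_coords 2. v 0 * (v 2 ^ 2 - v 0 ^ 2) = 0} \<in> projective_closed_sets 2"
    unfolding projective_closed_sets_def using hpoly_forms(3)
    by (intro CollectI exI[of _ "{\<lambda>v. v 0 * (v 2 ^ 2 - v 0 ^ 2)}"]) auto
  then have open_dom: "\<exists>Z\<in>projective_closed_sets 2. quartic_domain = quartic_curve - Z"
    unfolding quartic_domain_def by blast
  have "(\<lambda>x y z. y^2 - 1) \<in> polyfun3"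
    by (intro polyfun3_diff polyfun3_power polyfun3_intros)
  then have "{\<xi> \<in> character_variety G. \<forall>P\<in>set [\<lambda>x y z. y^2 - 1]. P (tr_a \<xi>) (tr_b \<xi>) (tr_ab \<xi>) = 0}
      \<in> character_closed_sets G"
    by (intro character_closed_zeros) simp
  then have closed: "\<exists>Z\<in>character_closed_sets G. ?V = X0 - Z"
    by (rule bexI[of "\<lambda>Z. ?V = X0 - Z", OF HOL.refl])
  have "\<exists>V h. V \<noteq> {} \<and> (\<exists>Z\<in>character_closed_sets G. V = X0 - Z) \<and>
        (\<forall>i. h i \<in> regular_functions G) \<and>
        (\<forall>v\<in>quartic_domain. rmap quartic_model v \<in> V \<and> (\<exists>c. c \<noteq> 0 \<and> (\<lambda>i. h i (rmap quartic_model v)) = (\<lambda>i. c * v i))) \<and>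
        (\<forall>\<xi>\<in>V. (\<lambda>i. h i \<xi>) \<in> quartic_domain \<and> rmap quartic_model (\<lambda>i. h i \<xi>) = \<xi>)"
  proof (rule exI[of _ ?V], rule exI[of _ ?h], intro conjI)
    show "?V \<noteq> {}" using rmap[OF dom] by blast
    show "\<exists>Z\<in>character_closed_sets G. ?V = X0 - Z" by (rule closed)
    show "\<forall>i. ?h i \<in> regular_functions G" by (auto intro: regular_functions.intros)
    show "\<forall>v\<in>quartic_domain. rmap quartic_model v \<in> ?V \<and>
        (\<exists>c. c \<noteq> 0 \<and> (\<lambda>i. ?h i (rmap quartic_model v)) = (\<lambda>i. c * v i))"
      using rmap by (rule ballI)
    show "\<forall>\<xi>\<in>?V. (\<lambda>i. ?h i \<xi>) \<in> quartic_domain \<and> rmap quartic_model (\<lambda>i. ?h i \<xi>) = \<xi>"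
      using inverse by (rule ballI)
  qed
  then show ?thesis
    unfolding smooth_projective_model_def
    using smooth_quartic_curve dom open_dom rmap_finite_value by (auto simp: quartic_model_def)
qed

section \<open>Peripheral traces at the ideal point\<close>

definition alpha where "alpha = word_value G g alpha_word"
definition beta where "beta = word_value G g beta_word"

lemma alpha_closed [simp]: "alpha \<in> carrier G" and beta_closed [simp]: "beta \<in> carrier G"
  by (simp_all add: alpha_def beta_def word_value_closed[OF g_range])

lemma char_of_alpha_beta:
  assumes "char_curve x y z"
  shows "char_of x y z alpha = z" "char_of x y z (inv alpha) = z"
    "char_of x y z beta = x^3 - x^2 * y - 3 * x + y * z^2"
proof -
  obtain s where s: "s \<noteq> 0" "s + inverse s = z" using exists_eigenvalue by blast
  obtain \<rho> where \<rho>: "\<rho> \<in> hom G SL2C"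
    "\<And>w. \<rho> (word_value G g w) = word_value SL2C (gen_pair (rep_a s x) (rep_b y)) w"
    "\<And>\<gamma>. \<gamma> \<in> carrier G \<Longrightarrow> char_of x y z \<gamma> = trace (\<rho> \<gamma>)"
    using char_of_rep[OF assms s] by metis
  interpret group_hom G SL2C \<rho>
    using \<rho>(1) group_SL2C by (simp add: group_hom_def group_hom_axioms_def)
  have trace: "trace (\<rho> alpha) = z"
    unfolding alpha_def \<rho>(2) using alpha_word_rep[OF s(1)] s(2) by (simp add: trace_2)
  then show "char_of x y z alpha = z" by (simp add: \<rho>(3))
  have "\<rho> (inv alpha) = adjugate2 (\<rho> alpha)"
    using hom_inv[OF alpha_closed] hom_det[OF \<rho>(1) alpha_closed] by (simp add: inv_SL2C)
  moreover have "trace (adjugate2 A) = trace A" for A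
    by (simp add: trace_2 adjugate2_def)
  ultimately show "char_of x y z (inv alpha) = z" using trace by (simp add: \<rho>(3))
  show "char_of x y z beta = x^3 - x^2 * y - 3 * x + y * z^2"
    using trace_beta_word[of "rep_a s x" "rep_b y"] assms s
    by (simp add: \<rho>(3) beta_def[symmetric]) (simp add: beta_def \<rho>(2) rep_traces)
qed

text \<open>
  \<open>alpha\<close> is upper triangular with distinct eigenvalues \<open>s\<close>, \<open>1 / s\<close>, so the commuting matrix of
  \<open>beta\<close> is upper triangular too, and \<open>alpha\<^sup>m beta\<^sup>n\<close> has the eigenvalue \<open>s\<^sup>m L\<^sup>n\<close>.
\<close>

lemma trace_beta_le:
  fixes m n :: int
  assumes "char_curve x y z" "norm z < 2" "alpha \<otimes> beta = beta \<otimes> alpha" "n \<noteq> 0"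
  defines "c \<equiv> 3 ^ nat \<bar>m\<bar>"
  shows "norm (char_of x y z beta) \<le> 2 * (c * (norm (char_of x y z (alpha [^] m \<otimes> beta [^] n)) + c))"
proof -
  obtain s where s: "s \<noteq> 0" "s + inverse s = z" using exists_eigenvalue by blast
  obtain \<rho> where \<rho>: "\<rho> \<in> hom G SL2C"
    "\<And>w. \<rho> (word_value G g w) = word_value SL2C (gen_pair (rep_a s x) (rep_b y)) w"
    "\<And>\<gamma>. \<gamma> \<in> carrier G \<Longrightarrow> char_of x y z \<gamma> = trace (\<rho> \<gamma>)"
    using char_of_rep[OF assms(1) s] by metis
  interpret group_hom G SL2C \<rho>
    using \<rho>(1) group_SL2C by (simp add: group_hom_def group_hom_axioms_def)
  define A B where "A = \<rho> alpha" and "B = \<rho> beta"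
  have det: "det A = 1" "det B = 1" using hom_det[OF \<rho>(1)] by (simp_all add: A_def B_def)
  have A: "A $ 1 $ 1 = s" "A $ 2 $ 1 = 0" "A $ 2 $ 2 = inverse s"
    unfolding A_def alpha_def \<rho>(2) by (rule alpha_word_rep[OF s(1)])+
  \<comment> \<open>Equality would give s^2 = 1 and z = 2 * s, of norm 2.\<close>
  have "s \<noteq> inverse s"
  proof
    assume eq: "s = inverse s"
    then have "s * s = 1" using s(1) by (metis right_inverse)
    then have "norm s * norm s = 1" by (metis norm_mult norm_one)
    then have "norm s = 1" by (metis norm_ge_zero abs_of_nonneg real_sqrt_abs2 real_sqrt_one)
    moreover have "z = 2 * s" using s(2) eq by simp
    ultimately show False using assms(2) by (simp add: norm_mult)
  qed
  moreover have "A ** B = B ** A"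
    using hom_matrix_mult[OF \<rho>(1)] assms(3) by (metis A_def B_def alpha_closed beta_closed)
  \<comment> \<open>This entry of the commutation relation reads (1/s - s) * B $ 2 $ 1 = 0.\<close>
  then have "(A ** B) $ 2 $ 1 = (B ** A) $ 2 $ 1" by simp
  then have "inverse s * B $ 2 $ 1 = B $ 2 $ 1 * s" by (simp add: mat2_mult_nth A)
  ultimately have B: "B $ 2 $ 1 = 0" by simp
  define L where "L = B $ 1 $ 1"
  define P where "P = s powi m * L powi n"
  define W where "W = A [^]\<^bsub>SL2C\<^esub> m ** B [^]\<^bsub>SL2C\<^esub> n"
  have L: "L \<noteq> 0" "trace B = L + inverse L"
    using trace_upper_triangular[OF det(2) B] by (simp_all add: L_def)
  have W: "W = \<rho> (alpha [^] m \<otimes> beta [^] n)"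
    by (simp add: W_def A_def B_def hom_matrix_mult[OF \<rho>(1)] hom_int_pow)
  have "W $ 2 $ 1 = 0" "W $ 1 $ 1 = P"
    using SL2C_upper_triangular_int_pow[OF det(1) A(2), of m] SL2C_upper_triangular_int_pow[OF det(2) B, of n]
    by (simp_all add: W_def mat2_mult_nth A L_def P_def)
  moreover have "det W = 1" unfolding W by (rule hom_det[OF \<rho>(1)]) simp
  ultimately have trW: "trace W = P + inverse P" using trace_upper_triangular[of W] by simp
  have "norm s \<le> 3" "norm (inverse s) \<le> 3"
    using eigenvalue_bounded[of s] eigenvalue_bounded[of "inverse s"] s assms(2)
    by (simp_all add: add.commute)
  from trace_growth[OF s(1) this L(1) assms(4), of m]
  have "norm (trace B) \<le> 2 * (c * (norm (trace W) + c))"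
    by (simp only: trW P_def L(2) c_def)
  then show ?thesis by (simp add: \<rho>(3) B_def W)
qed

text \<open>The quotient F / H clears denominators in x^3 - x^2 y - 3x + y z^2 with x = v 1 / v 0, y
  = v 2 / v 0 and z = N / D. At (0 : 1 : \<omega>) the denominator vanishes and the numerator is (1
  - \<omega>) * \<omega>^4.\<close>

lemma trace_pole_beta:
  assumes \<omega>: "1 + \<omega> + \<omega>^2 = 0"
  shows "trace_pole quartic_model (hpoint 0 1 \<omega>) beta"
proof -
  let ?D = "\<lambda>v::hvec. v 2 ^ 2 - v 0 ^ 2" and ?N = "\<lambda>v::hvec. v 1 ^ 2 + v 1 * v 2 - v 0 ^ 2"
  let ?F = "\<lambda>v. (v 1 ^ 3 - v 1 ^ 2 * v 2 - 3 * (v 0 ^ 2 * v 1)) * ?D v ^ 2 + (v 0 ^ 2 * v 2) * ?N v ^ 2"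
  let ?H = "\<lambda>v. v 0 ^ 3 * ?D v ^ 2"
  have 1: "(\<lambda>v. v 1 ^ 2 * v 2) \<in> hpoly 2 3" "(\<lambda>v. v 0 ^ 2 * v 1) \<in> hpoly 2 3" "(\<lambda>v. v 0 ^ 2 * v 2) \<in> hpoly 2 3"
    by (rule hpoly_mult_eq[OF hpoly_2_coord_power(2) hpoly_coord]
        hpoly_mult_eq[OF hpoly_2_coord_power(1) hpoly_coord]; simp)+
  have 2: "(\<lambda>v. v 1 ^ 3 - v 1 ^ 2 * v 2 - 3 * (v 0 ^ 2 * v 1)) \<in> hpoly 2 3"
    by (intro hpoly_diff hpoly_cmult 1 hpoly_2_coord_power)
  have F: "?F \<in> hpoly 2 (3 + 2 * 2)"
    by (intro hpoly_add hpoly_mult 1 2 hpoly_power hpoly_forms)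
  have H: "?H \<in> hpoly 2 (3 + 2 * 2)"
    by (intro hpoly_mult hpoly_2_coord_power hpoly_power hpoly_forms)
  have eq: "?F v = rmap quartic_model v beta * ?H v" if v: "v \<in> quartic_domain" for v
  proof -
    define w x y z where "w = v 0" and "x = v 1" and "y = v 2" and "z = ?N v / ?D v"
    have w: "w \<noteq> 0" and d: "y^2 - w^2 \<noteq> 0" using quartic_domainD(1,2)[OF v] by (simp_all add: w_def y_def)
    have N: "x^2 + x * y - w^2 = z * (y^2 - w^2)" using d by (simp add: z_def w_def x_def y_def)
    have "rmap quartic_model v beta = (x / w)^3 - (x / w)^2 * (y / w) - 3 * (x / w) + (y / w) * z^2"
      using char_of_alpha_beta(3)[OF quartic_domainD(6)[OF v]] char_z_divide[OF w d, of x]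
      by (simp add: quartic_model_def w_def x_def y_def z_def)
    also have "\<dots> = (x^3 - x^2 * y - 3 * (w^2 * x) + w^2 * y * z^2) / w^3"
      using w by (simp add: field_simps power_numeral_reduce)
    finally have "rmap quartic_model v beta * w^3 = x^3 - x^2 * y - 3 * (w^2 * x) + w^2 * y * z^2"
      using w by simp
    then have "rmap quartic_model v beta * (w^3 * (y^2 - w^2)^2) =
        (x^3 - x^2 * y - 3 * (w^2 * x)) * (y^2 - w^2)^2 + w^2 * y * (z * (y^2 - w^2))^2"
      by algebra
    then show ?thesis unfolding N[symmetric] by (simp add: w_def x_def y_def)
  qed
  have val: "?F (hpoint 0 1 \<omega>) \<noteq> 0" "?H (hpoint 0 1 \<omega>) = 0"
    using primitive_cube_root_facts[OF \<omega>] by simp_all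
  have model: "adim quartic_model = 2" "rdom quartic_model = quartic_domain"
    by (simp_all add: quartic_model_def)
  show ?thesis
    unfolding trace_pole_def pole_at_def model
    by (rule exI[of _ "3 + 2 * 2"], rule bexI[OF _ F], rule bexI[OF _ H]) (use eq val in blast)
qed

lemma trace_value_alpha:
  assumes \<omega>: "1 + \<omega> + \<omega>^2 = 0"
  shows "trace_value quartic_model (hpoint 0 1 \<omega>) alpha (-1)"
    "trace_value quartic_model (hpoint 0 1 \<omega>) (inv alpha) (-1)"
proof -
  let ?D = "\<lambda>v::hvec. v 2 ^ 2 - v 0 ^ 2" and ?N = "\<lambda>v::hvec. v 1 ^ 2 + v 1 * v 2 - v 0 ^ 2"
  have "?N v = rmap quartic_model v alpha * ?D v \<and> ?N v = rmap quartic_model v (inv alpha) * ?D v"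
    if v: "v \<in> quartic_domain" for v
    using char_of_alpha_beta(1,2)[OF quartic_domainD(6)[OF v]] char_z_divide[OF quartic_domainD(1,2)[OF v], of "v 1"]
      quartic_domainD(2)[OF v]
    by (simp add: quartic_model_def)
  moreover have "?D (hpoint 0 1 \<omega>) \<noteq> 0" "?N (hpoint 0 1 \<omega>) = (-1) * ?D (hpoint 0 1 \<omega>)"
    using primitive_cube_root_facts[OF \<omega>] \<omega> by (simp_all add: eq_neg_iff_add_eq_0)
  ultimately show "trace_value quartic_model (hpoint 0 1 \<omega>) alpha (-1)"
    "trace_value quartic_model (hpoint 0 1 \<omega>) (inv alpha) (-1)"
    unfolding trace_value_def finite_value_at_def
    by (intro exI[of _ 2] bexI[OF _ hpoly_forms(1)] bexI[OF _ hpoly_forms(2)]; simp add: quartic_model_def)+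
qed

text \<open>A finite value would make F / H converge along the sequence towards the point.
  Multiplied by w^3, the estimate \<open>trace_beta_le\<close> would then force w^3 tr \<beta> to 0,
  whereas it tends to 1 - \<omega>.\<close>

lemma trace_not_finite:
  fixes m n :: int
  assumes \<omega>: "1 + \<omega> + \<omega>^2 = 0" and comm: "alpha \<otimes> beta = beta \<otimes> alpha" and n: "n \<noteq> 0"
  shows "\<not> trace_value quartic_model (hpoint 0 1 \<omega>) (alpha [^] m \<otimes> beta [^] n) t"
proof
  assume "trace_value quartic_model (hpoint 0 1 \<omega>) (alpha [^] m \<otimes> beta [^] n) t"
  then obtain d F H where FH: "F \<in> hpoly 2 d" "H \<in> hpoly 2 d"
      "\<And>v. v \<in> quartic_domain \<Longrightarrow> F v = rmap quartic_model v (alpha [^] m \<otimes> beta [^] n) * H v"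
      "H (hpoint 0 1 \<omega>) \<noteq> 0"
    by (auto simp: trace_value_def finite_value_at_def quartic_model_def)
  obtain w y where w: "w \<longlonglongrightarrow> 0" and y: "y \<longlonglongrightarrow> \<omega>"
    and dom: "eventually (\<lambda>k. hpoint (w k) 1 (y k) \<in> quartic_domain) sequentially"
    and z: "(\<lambda>k. char_z (1 / w k) (y k / w k)) \<longlonglongrightarrow> -1"
    using domain_near_cube_root[OF \<omega>] by blast
  define v where "v k = hpoint (w k) 1 (y k)" for k
  define z where "z k = char_z (1 / w k) (y k / w k)" for k
  define c :: real where "c = 3 ^ nat \<bar>m\<bar>"
  have c: "c > 0" by (simp add: c_def)
  have lim_v: "(\<lambda>k. K (v k)) \<longlonglongrightarrow> K (hpoint 0 1 \<omega>)" if "K \<in> hpoly 2 d" for K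
    unfolding v_def by (rule hpoly_tendsto[OF that hpoint_tendsto]) (use w y in auto)
  have lim: "(\<lambda>k. norm (F (v k) / H (v k))) \<longlonglongrightarrow> norm (F (hpoint 0 1 \<omega>) / H (hpoint 0 1 \<omega>))"
    by (intro tendsto_intros lim_v FH)
  \<comment> \<open>The factor w^3 matches the growth of tr \<beta>: with x = 1/w and y/w for y, w^3
    tr \<beta> is the expression 1 - y - 3 w^2 + w^2 y z^2 used below.\<close>
  have "(\<lambda>k. norm (w k ^ 3) * (2 * (c * (norm (F (v k) / H (v k)) + c)))) \<longlonglongrightarrow>
      norm ((0::complex) ^ 3) * (2 * (c * (norm (F (hpoint 0 1 \<omega>) / H (hpoint 0 1 \<omega>)) + c)))"
    by (intro tendsto_intros lim w)
  then have upper: "(\<lambda>k. norm (w k ^ 3) * (2 * (c * (norm (F (v k) / H (v k)) + c)))) \<longlonglongrightarrow> 0"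
    by simp
  have "(\<lambda>k. norm (z k)) \<longlonglongrightarrow> norm (-1 :: complex)"
    unfolding z_def by (intro tendsto_norm z)
  then have small: "eventually (\<lambda>k. norm (z k) < 2) sequentially"
    by (rule order_tendstoD(2)) simp
  have H: "eventually (\<lambda>k. H (v k) \<noteq> 0) sequentially"
    using tendsto_imp_eventually_ne[OF lim_v[OF FH(2)] FH(4)] .
  have bound: "eventually (\<lambda>k. norm (1 - y k - 3 * w k ^ 2 + w k ^ 2 * y k * z k ^ 2)
      \<le> norm (w k ^ 3) * (2 * (c * (norm (F (v k) / H (v k)) + c)))) sequentially"
    using dom small H
  proof eventually_elim
    case (elim k)
    note dom' = quartic_domainD[OF elim(1)]
    have w0: "w k \<noteq> 0" using dom'(1) by simp
    have char: "char_curve (1 / w k) (y k / w k) (z k)" using dom'(6) by (simp add: z_def)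
    have "F (v k) / H (v k) = rmap quartic_model (v k) (alpha [^] m \<otimes> beta [^] n)"
      using FH(3)[of "v k"] elim by (simp add: v_def)
    also have "\<dots> = char_of (1 / w k) (y k / w k) (z k) (alpha [^] m \<otimes> beta [^] n)"
      by (simp add: quartic_model_def v_def z_def)
    finally have "norm (char_of (1 / w k) (y k / w k) (z k) beta) \<le> 2 * (c * (norm (F (v k) / H (v k)) + c))"
      using trace_beta_le[OF char elim(2) comm n, of m] by (simp add: c_def)
    moreover have "1 - y k - 3 * w k ^ 2 + w k ^ 2 * y k * z k ^ 2 =
        w k ^ 3 * char_of (1 / w k) (y k / w k) (z k) beta"
      unfolding char_of_alpha_beta(3)[OF char] using w0 by (simp add: field_simps power_numeral_reduce)
    ultimately show ?case
      by (simp only: norm_mult) (intro mult_left_mono, auto)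
  qed
  have "(\<lambda>k. 1 - y k - 3 * w k ^ 2 + w k ^ 2 * y k * z k ^ 2) \<longlonglongrightarrow> 0"
    by (rule Lim_null_comparison[OF bound upper])
  moreover have "(\<lambda>k. 1 - y k - 3 * w k ^ 2 + w k ^ 2 * y k * z k ^ 2) \<longlonglongrightarrow>
      1 - \<omega> - 3 * 0 ^ 2 + 0 ^ 2 * \<omega> * (-1) ^ 2"
    unfolding z_def by (intro tendsto_intros w y z)
  ultimately have "1 - \<omega> - 3 * 0 ^ 2 + 0 ^ 2 * \<omega> * (-1) ^ 2 = 0"
    using LIMSEQ_unique by blast
  then show False using primitive_cube_root_facts(2)[OF \<omega>] by simp
qed

lemma ideal_point_quartic_model:
  assumes "1 + \<omega> + \<omega>^2 = 0"
  shows "ideal_point G X0 quartic_model (hpoint 0 1 \<omega>)"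
proof -
  have "hpoint 0 1 \<omega> \<in> quartic_curve"
    using primitive_cube_root_facts(5)[OF assms]
    by (simp add: quartic_curve_def quartic_form_def hpoint_homogeneous_coords)
  then show ?thesis
    unfolding ideal_point_def
    using irreducible_curve_X0 smooth_projective_model_X0 trace_pole_beta[OF assms] beta_closed
    by (auto simp: quartic_model_def)
qed

text \<open>A peripheral element is \<alpha>^m \<beta>^n; finiteness forces n = 0 by
  \<open>trace_not_finite\<close>, and primitivity then forces m to be 1 or -1. That \<alpha> is
  itself primitive follows by comparing exponents in the basis.\<close>

lemma associated_slope_alpha:
  assumes \<omega>: "1 + \<omega> + \<omega>^2 = 0" and basis: "free_abelian_basis G Per alpha beta"
  shows "associated_slope G Per quartic_model (hpoint 0 1 \<omega>) {alpha, inv alpha}"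
proof -
  have comm: "alpha \<otimes> beta = beta \<otimes> alpha"
    and bij: "bij_betw (\<lambda>(m :: int, n :: int). alpha [^] m \<otimes> beta [^] n) UNIV Per"
    using basis by (auto simp: free_abelian_basis_def)
  have Per: "Per = (\<lambda>(m :: int, n :: int). alpha [^] m \<otimes> beta [^] n) ` UNIV"
    using bij by (simp add: bij_betw_def)
  have inj: "m = m' \<and> n = n'" if "alpha [^] m \<otimes> beta [^] n = alpha [^] m' \<otimes> beta [^] n'" for m n m' n' :: int
    using bij_betw_imp_inj_on[OF bij] that by (auto simp: inj_on_def)
  have alpha_eq: "alpha [^] (1::int) \<otimes> beta [^] (0::int) = alpha" by simp
  have "alpha [^] (1::int) \<otimes> beta [^] (0::int) \<in> Per"
    unfolding Per by (rule image_eqI[of _ _ "(1, 0)"]) simp_all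
  then have alpha_Per: "alpha \<in> Per" unfolding alpha_eq .
  have prim: "primitive_element G Per alpha"
    unfolding primitive_element_def
  proof (intro conjI ballI allI impI alpha_Per)
    fix \<eta> and k :: int assume "\<eta> \<in> Per" and eq: "alpha = \<eta> [^] k"
    then obtain p q :: int where \<eta>: "\<eta> = alpha [^] p \<otimes> beta [^] q" by (auto simp: Per)
    have "alpha [^] p \<otimes> beta [^] q = beta [^] q \<otimes> alpha [^] p"
      using commute_int_pow[OF commute_int_pow[OF comm, of p, symmetric], of q] by simp
    then have "\<eta> [^] k = alpha [^] (p * k) \<otimes> beta [^] (q * k)"
      unfolding \<eta> by (subst int_pow_mult_distrib) (simp_all add: int_pow_pow)
    then have "alpha [^] (1::int) \<otimes> beta [^] (0::int) = alpha [^] (p * k) \<otimes> beta [^] (q * k)"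
      unfolding alpha_eq using eq by simp
    then have "p * k = 1" using inj by metis
    then show "\<bar>k\<bar> = 1" using zmult_eq_1_iff[of p k] by auto
  qed
  have "s' = {alpha, inv alpha}"
    if slope: "s' \<in> slopes G Per"
      and finite: "\<forall>\<delta>\<in>s'. \<exists>z. trace_value quartic_model (hpoint 0 1 \<omega>) \<delta> z" for s'
  proof -
    obtain \<delta> where \<delta>: "s' = {\<delta>, inv \<delta>}" "primitive_element G Per \<delta>"
      using slope by (auto simp: slopes_def)
    then have "\<delta> \<in> Per" by (simp add: primitive_element_def)
    then obtain m n :: int where mn: "\<delta> = alpha [^] m \<otimes> beta [^] n" by (auto simp: Per)
    have "n = 0" using trace_not_finite[OF \<omega> comm] finite \<delta>(1) mn by blast
    then have m: "\<delta> = alpha [^] m" by (simp add: mn)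
    then have "\<bar>m\<bar> = 1" using \<delta>(2) alpha_Per by (auto simp: primitive_element_def)
    then have "m = 1 \<or> m = -1" by linarith
    then have "\<delta> = alpha \<or> \<delta> = inv alpha"
      using m int_pow_neg[OF alpha_closed, of 1] by auto
    then show ?thesis using \<delta>(1) by auto
  qed
  moreover have "{alpha, inv alpha} \<in> slopes G Per" using prim by (auto simp: slopes_def)
  ultimately show ?thesis
    unfolding associated_slope_def using trace_value_alpha[OF \<omega>] by blast
qed

lemma exists_ideal_point:
  assumes "free_abelian_basis G Per alpha beta"
  shows "\<exists>X0 M x. ideal_point G X0 M x \<and> (\<exists>\<gamma>\<in>Per. trace_pole M x \<gamma>) \<and>
    associated_slope G Per M x {alpha, inv alpha} \<and>
    (\<exists>\<omega>. associated_root_of_unity G Per M x \<omega> \<and> \<omega> ^ 6 = 1 \<and> \<omega> \<noteq> 1 \<and> \<omega> \<noteq> -1)"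
proof -
  obtain \<omega> :: complex where \<omega>: "1 + \<omega> + \<omega>^2 = 0" by (rule primitive_cube_root)
  note facts = primitive_cube_root_facts[OF \<omega>]
  have Per: "Per = (\<lambda>(m :: int, n :: int). alpha [^] m \<otimes> beta [^] n) ` UNIV"
    using assms by (auto simp: free_abelian_basis_def bij_betw_def)
  have "alpha [^] (0::int) \<otimes> beta [^] (1::int) \<in> Per"
    unfolding Per by (rule image_eqI[of _ _ "(0, 1)"]) simp_all
  then have "beta \<in> Per" by simp
  moreover note slope = associated_slope_alpha[OF \<omega> assms]
  moreover have "associated_root_of_unity G Per quartic_model (hpoint 0 1 \<omega>) \<omega>"
    unfolding associated_root_of_unity_def facts(7)
    \<comment> \<open>The exponent witnessing a root of unity is 3, and \<omega> + 1/\<omega> = -1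
      is the common value of the traces of \<alpha> and its inverse.\<close>
    using facts(4) slope trace_value_alpha[OF \<omega>]
    by (intro conjI exI[of _ "{alpha, inv alpha}"] exI[of _ "3::nat"]) auto
  ultimately show ?thesis
    using ideal_point_quartic_model[OF \<omega>] trace_pole_beta[OF \<omega>] facts(2,3,6) by blast
qed

end

theorem mainTheorem2:
  fixes x0 :: glued_point
    and g :: "gen \<Rightarrow> (real \<Rightarrow> glued_point) set"
    and \<alpha> \<beta> :: "(real \<Rightarrow> glued_point) set"
  assumes "x0 \<in> glued_boundary m137"
    and "presented_by (m137_group x0) g {m137_relator}"
    and "\<alpha> = word_value (m137_group x0) g alpha_word"
    and "\<beta> = word_value (m137_group x0) g beta_word"
    and "free_abelian_basis (m137_group x0) (m137_peripheral x0) \<alpha> \<beta>"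
  shows "\<exists>X0 M x.
           ideal_point (m137_group x0) X0 M x \<and>
           (\<exists>\<gamma>\<in>m137_peripheral x0. trace_pole M x \<gamma>) \<and>
           associated_slope (m137_group x0) (m137_peripheral x0) M x {\<alpha>, inv\<^bsub>m137_group x0\<^esub> \<alpha>} \<and>
           (\<exists>\<omega>. associated_root_of_unity (m137_group x0) (m137_peripheral x0) M x \<omega> \<and>
                \<omega> ^ 6 = 1 \<and> \<omega> \<noteq> 1 \<and> \<omega> \<noteq> -1)"
proof -
  have "carrier (m137_group x0) \<noteq> {}"
    using assms(2) by (auto simp: presented_by_def)
  then have "group (m137_group x0)"
    by (intro group_fundamental_group fundamental_group_nonempty_imp_topspace)
  then interpret m137_presentation "m137_group x0" g
    using assms(2) by (simp add: m137_presentation_def m137_presentation_axioms_def)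
  have "\<alpha> = alpha" "\<beta> = beta" by (simp_all add: assms(3,4) alpha_def beta_def)
  then show ?thesis using exists_ideal_point assms(5) by simp
qed

end
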